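(* Let $r\ge3$. The only physical invariants for $B_{r,3}$ (the affine algebra $B_r^{(1)}$ at level $3$) are the identity matrix $M=I$ and the simple current invariant $M=\mathcal{I}[J_b]$.
   Context: **Weights.** For $r\ge 3$, the set $P_+$ of level-$k$ integrable highest weights of $B_r^{(1)}$ consists of all $\lambda=\sum_{i=0}^r\lambda_i\Lambda_i$ with $\lambda_i\in\mathbb{Z}_{\ge 0}$ and $k=\lambda_0+\lambda_1+2\lambda_2+\cdots+2\lambda_{r-1}+\lambda_r$, where $\Lambda_i$ are the fundamental weights. Here $k=3$. The weight $k\Lambda_0$ is written $0$. Let $\rho=\sum_i\Lambda_i$ and $n=k+2r-1=2r+2$. **Kac–Peterson matrices.** With $\bar\lambda=\sum_{i\ge1}\lambda_i\Lambda_i$ and $\bar\rho$ the finite parts, $W$ the finite Weyl group of $B_r$, $\Delta_+$ its positive roots, $h^\vee=2r-1$, and the invariant form normalised so that long roots have norm 2, $$S_{\lambda\mu}=\mathrm{i}^{|\Delta_+|}\,n^{-r/2}\,|P/Q^\vee|^{-1/2}\sum_{w\in W}\det(w)\exp\!\Big[-\tfrac{2\pi \mathrm{i}}{n}\big(w(\bar\lambda+\bar\rho)\,|\,\bar\mu+\bar\rho\big)\Big],\qquad T_{\lambda\mu}=\delta_{\lambda,\mu}\exp\!\Big[\tfrac{\pi \mathrm{i}\,(\bar\lambda+\bar\rho)^2}{n}-\tfrac{\pi \mathrm{i}\,\bar\rho^2}{h^\vee}\Big]$$ for $\lambda,\mu\in P_+$, where $P$ is the weight lattice and $Q^\vee$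 the coroot lattice of $B_r$. **Physical invariant.** A matrix $M=(M_{\mu\nu})_{\mu,\nu\in P_+}$ with $MS=SM$, $MT=TM$, all $M_{\mu\nu}\in\mathbb{Z}_{\ge0}$, and $M_{00}=1$. **Simple current invariant.** $J_b$ acts on $P_+$ by $J_b(\lambda_0,\lambda_1,\lambda_2,\ldots,\lambda_r)=(\lambda_1,\lambda_0,\lambda_2,\ldots,\lambda_r)$. At level 3, $\mathcal{I}[J_b]$ is the matrix $$\mathcal{I}[J_b]_{\mu,\nu}=\sum_{\ell=1}^{2}\delta_{J_b^\ell\mu,\nu}\,\delta^1\big(\tfrac{\mu_r}{2}+\tfrac{3\ell}{2}\big),$$ where $\delta^1(x)=1$ if $x\in\mathbb{Z}$ and $0$ otherwise. *)

theory Defs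
  imports Complex_Main "Jordan_Normal_Form.Determinant"
begin

text \<open>
  The root system $B_r$ is realised in $\mathbb{R}^r$ with the standard scalar product, for which
  the long roots $\pm e_i \pm e_j$ have norm 2. Vector coordinates are 0-based: the basis
  vector usually called $e_{i+1}$ is \<open>unit_vec r i\<close>. Affine weights and matrices over weights
  use the Dynkin labels $\lambda_0,\dots,\lambda_r$ with their usual indices.
\<close>

section \<open>The finite root system $B_r$\<close>

definition pos_roots :: "nat \<Rightarrow> real vec set" where
  "pos_roots r =
     {unit_vec r i - unit_vec r j | i j. i < j \<and> j < r} \<union>
     {unit_vec r i + unit_vec r j | i j. i < j \<and> j < r} \<union>
     {unit_vec r i | i. i < r}"

definition roots :: "nat \<Rightarrow> real vec set" where
  "roots r = pos_roots r \<union> uminus ` pos_roots r"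

definition coroot :: "real vec \<Rightarrow> real vec" where
  "coroot \<alpha> = (2 / (\<alpha> \<bullet> \<alpha>)) \<cdot>\<^sub>v \<alpha>"

text \<open>The matrix of $x \mapsto x - (x\,|\,\alpha^\vee)\,\alpha$.\<close>
definition reflection :: "nat \<Rightarrow> real vec \<Rightarrow> real mat" where
  "reflection r \<alpha> = mat r r (\<lambda>(i, j). (if i = j then 1 else 0) - \<alpha> $ i * coroot \<alpha> $ j)"

text \<open>Reflections are involutions, so the monoid they generate is the Weyl group.\<close>
inductive_set weyl_group :: "nat \<Rightarrow> real mat set" for r :: nat where
  one: "1\<^sub>m r \<in> weyl_group r"
| step: "\<lbrakk>w \<in> weyl_group r; \<alpha> \<in> roots r\<rbrakk> \<Longrightarrow> reflection r \<alpha> * w \<in> weyl_group r"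

definition weight_lattice :: "nat \<Rightarrow> real vec set" where
  "weight_lattice r = {x \<in> carrier_vec r. \<forall>\<alpha>\<in>roots r. x \<bullet> coroot \<alpha> \<in> \<int>}"

text \<open>The coroots are closed under negation, so adding coroots repeatedly yields their
  $\mathbb{Z}$-span.\<close>
inductive_set coroot_lattice :: "nat \<Rightarrow> real vec set" for r :: nat where
  zero: "0\<^sub>v r \<in> coroot_lattice r"
| add: "\<lbrakk>x \<in> coroot_lattice r; \<alpha> \<in> roots r\<rbrakk> \<Longrightarrow> x + coroot \<alpha> \<in> coroot_lattice r"

definition weight_coroot_quotient :: "nat \<Rightarrow> real vec set set" where
  "weight_coroot_quotient r =
     weight_lattice r //
       {(x, y). x \<in> weight_lattice r \<and> y \<in> weight_lattice r \<and> x - y \<in> coroot_lattice r}"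

definition simple_root :: "nat \<Rightarrow> nat \<Rightarrow> real vec" where
  "simple_root r i =
     (if i < r then unit_vec r (i - 1) - unit_vec r i else unit_vec r (r - 1))"

text \<open>For $1 \le i < r$ this is $e_1 + \dots + e_i$, and for $i = r$ it is
  $\frac12(e_1 + \dots + e_r)$.\<close>
definition fund_weight :: "nat \<Rightarrow> nat \<Rightarrow> real vec" where
  "fund_weight r i = vec r (\<lambda>j. if i < r then (if j < i then 1 else 0) else 1 / 2)"

lemma fund_weight_dual_simple_coroot:
  assumes "1 \<le> i" "i \<le> r" "1 \<le> j" "j \<le> r"
  shows "fund_weight r i \<bullet> coroot (simple_root r j) = (if i = j then 1 else 0)"
proof (cases "j < r")
  case True
  have [simp]: "unit_vec r (j - 1) \<in> carrier_vec r" "unit_vec r j \<in> carrier_vec r"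
    "fund_weight r i \<in> carrier_vec r"
    by (auto simp: fund_weight_def)
  have *: "v \<bullet> (unit_vec r (j - 1) - unit_vec r j) = v $ (j - 1) - v $ j"
    if "v \<in> carrier_vec r" for v :: "real vec"
    using that True assms by (subst scalar_prod_minus_distrib[of _ r]) auto
  have n: "(unit_vec r (j - 1) - unit_vec r j) \<bullet> (unit_vec r (j - 1) - unit_vec r j) = (2::real)"
    using True assms by (subst *) auto
  have c: "coroot (simple_root r j) = unit_vec r (j - 1) - unit_vec r j"
    unfolding coroot_def simple_root_def if_P[OF True] n by (intro eq_vecI) auto
  have "fund_weight r i \<bullet> coroot (simple_root r j)
      = fund_weight r i $ (j - 1) - fund_weight r i $ j"
    unfolding c by (rule *) simp
  then show ?thesis
    using True assms by (auto simp: fund_weight_def)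
next
  case False
  then have [simp]: "j = r" using assms by simp
  show ?thesis
    using assms by (auto simp: coroot_def simple_root_def fund_weight_def)
qed

section \<open>Affine weights at level $k$\<close>

definition P_plus :: "nat \<Rightarrow> nat \<Rightarrow> nat vec set" where
  "P_plus r k =
     {lam \<in> carrier_vec (r + 1).
        k = lam $ 0 + lam $ 1 + 2 * (\<Sum>i = 2..r - 1. lam $ i) + lam $ r}"

definition vacuum :: "nat \<Rightarrow> nat \<Rightarrow> nat vec" where
  "vacuum r k = vec (r + 1) (\<lambda>i. if i = 0 then k else 0)"

definition rho :: "nat \<Rightarrow> nat vec" where
  "rho r = vec (r + 1) (\<lambda>_. 1)"

definition finite_part :: "nat \<Rightarrow> nat vec \<Rightarrow> real vec" where
  "finite_part r lam = vec r (\<lambda>j. \<Sum>i = 1..r. real (lam $ i) * fund_weight r i $ j)"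

definition dual_coxeter :: "nat \<Rightarrow> nat" where
  "dual_coxeter r = 2 * r - 1"

definition height :: "nat \<Rightarrow> nat \<Rightarrow> nat" where
  "height r k = k + dual_coxeter r"

section \<open>Kac--Peterson matrices and physical invariants\<close>

definition S_matrix :: "nat \<Rightarrow> nat \<Rightarrow> nat vec \<Rightarrow> nat vec \<Rightarrow> complex" where
  "S_matrix r k lam \<mu> =
     \<i> ^ card (pos_roots r)
     * of_real (real (height r k) powr (- real r / 2))
     * of_real (real (card (weight_coroot_quotient r)) powr (- 1 / 2))
     * (\<Sum>w\<in>weyl_group r. of_real (det w) *
          exp (- (2 * of_real pi * \<i> / of_nat (height r k)) *
               of_real ((w *\<^sub>v (finite_part r lam + finite_part r (rho r)))
                          \<bullet> (finite_part r \<mu> + finite_part r (rho r)))))"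

definition T_matrix :: "nat \<Rightarrow> nat \<Rightarrow> nat vec \<Rightarrow> nat vec \<Rightarrow> complex" where
  "T_matrix r k lam \<mu> =
     (if lam = \<mu> then
        exp (of_real pi * \<i> *
               of_real ((finite_part r lam + finite_part r (rho r))
                          \<bullet> (finite_part r lam + finite_part r (rho r))) / of_nat (height r k)
             - of_real pi * \<i> *
               of_real (finite_part r (rho r) \<bullet> finite_part r (rho r)) / of_nat (dual_coxeter r))
      else 0)"

text \<open>A matrix indexed by \<^term>\<open>P_plus r k\<close> is a function of two weights of which only the values
  on \<^term>\<open>P_plus r k\<close> matter.\<close>
definition commute_on ::
    "'a set \<Rightarrow> ('a \<Rightarrow> 'a \<Rightarrow> complex) \<Rightarrow> ('a \<Rightarrow> 'a \<Rightarrow> complex) \<Rightarrow> bool" where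
  "commute_on A M N \<longleftrightarrow>
     (\<forall>\<mu>\<in>A. \<forall>\<nu>\<in>A. (\<Sum>\<kappa>\<in>A. M \<mu> \<kappa> * N \<kappa> \<nu>) = (\<Sum>\<kappa>\<in>A. N \<mu> \<kappa> * M \<kappa> \<nu>))"

definition equal_on ::
    "'a set \<Rightarrow> ('a \<Rightarrow> 'a \<Rightarrow> complex) \<Rightarrow> ('a \<Rightarrow> 'a \<Rightarrow> complex) \<Rightarrow> bool" where
  "equal_on A M N \<longleftrightarrow> (\<forall>\<mu>\<in>A. \<forall>\<nu>\<in>A. M \<mu> \<nu> = N \<mu> \<nu>)"

definition physical_invariant :: "nat \<Rightarrow> nat \<Rightarrow> (nat vec \<Rightarrow> nat vec \<Rightarrow> complex) \<Rightarrow> bool" where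
  "physical_invariant r k M \<longleftrightarrow>
     commute_on (P_plus r k) M (S_matrix r k) \<and>
     commute_on (P_plus r k) M (T_matrix r k) \<and>
     (\<forall>\<mu>\<in>P_plus r k. \<forall>\<nu>\<in>P_plus r k. M \<mu> \<nu> \<in> \<nat>) \<and>
     M (vacuum r k) (vacuum r k) = 1"

definition identity_invariant :: "nat vec \<Rightarrow> nat vec \<Rightarrow> complex" where
  "identity_invariant \<mu> \<nu> = (if \<mu> = \<nu> then 1 else 0)"

definition J_b :: "nat \<Rightarrow> nat vec \<Rightarrow> nat vec" where
  "J_b r lam = vec (r + 1) (\<lambda>i. lam $ (if i = 0 then 1 else if i = 1 then 0 else i))"

definition delta1 :: "real \<Rightarrow> complex" where
  "delta1 x = (if x \<in> \<int> then 1 else 0)"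

text \<open>The phase $\frac{\mu_r}{2} + \frac{3\ell}{2}$ is specific to level 3.\<close>
definition simple_current_invariant :: "nat \<Rightarrow> nat vec \<Rightarrow> nat vec \<Rightarrow> complex" where
  "simple_current_invariant r \<mu> \<nu> =
     (\<Sum>l = 1..2. (if (J_b r ^^ l) \<mu> = \<nu> then 1 else 0)
        * delta1 (real (\<mu> $ r) / 2 + 3 * real l / 2))"

end

theory Submission
  imports Defs "HOL-Number_Theory.Cong"
begin

text \<open>
  In orthogonal coordinates the Weyl sum is a determinant of sines. At level 3 the coordinates of
  a shifted weight omit one of $r + 1$ values (up to $J_b$), so the entries of $S$ are maximal
  minors of orthogonal sine matrices and hence, by the adjugate formula, single sines: $S$ and $T$
  are those of $SU(2)$ at level $4r + 2$ up to complex conjugation of $T$, with the weights of odd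
  $\lambda_r$ folded under $J_b$.

  An invariant commutes with every word in $S$ and $T$. The words $T^m S T^l S T^m$ with
  $ml \equiv 1$ give relations whose signs contradict nonnegativity unless the sines attached to a
  nonzero entry of the vacuum row keep equal signs under all units $m$. Together with
  $T$-invariance this leaves only the diagonal entry in the rows and columns of $0$ and $J_b 0$.
  Then $M$ preserves the class of $\lambda_r$ modulo 2. On even $\lambda_r$ it is the identity,
  because nonnegative rows and columns preserve the quantum dimensions; on odd $\lambda_r$
  orthogonality of sines leaves only the exchange of $2\Lambda_0 + \Lambda_r$ and
  $2\Lambda_1 + \Lambda_r$.
\<close>

section \<open>Sine sums and Gauss sums\<close>

text \<open>The height at level 3 is 2r + 2 = 2N with N = r + 1, and shifted coordinates are
  integers or half-integers; hence the denominators 4N in the sines and 8N in the phases of T. Three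
  coincidences shape the argument. The weights A and 4N - A have equal quantum dimension, so
  positivity cannot separate them and T has to. The rows of S at 0 and J_b 0 agree where \<lambda>_r
  is even and are opposite where it is odd; this is why both rows must be determined before the two
  classes can be split. Finally, T carries an additional constant on odd \<lambda>_r, and replacing
  its exponent m by the inverse l changes that constant by a sign. A coupling of the vacuum to a
  weight with odd \<lambda>_r therefore obeys a sign rule twisted by this sign, and its exclusion
  needs arithmetic of its own, modulo 8. The freedom that remains comes from the two weights sharing
  the angle 2N: sines against weights of even \<lambda>_r see only the sum of their
  multiplicities.\<close>

definition sn :: "nat \<Rightarrow> int \<Rightarrow> real" where
  "sn N k = sin (pi * of_int k / (4 * of_nat N))"

definition ph :: "nat \<Rightarrow> int \<Rightarrow> complex" where
  "ph N x = cis (pi * of_int x / (8 * of_nat N))"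

definition gauss_sum :: "nat \<Rightarrow> int \<Rightarrow> complex" where
  "gauss_sum N l = (\<Sum>b\<in>{0..<2 * int N}. ph N (- 4 * l * b\<^sup>2))"

lemma sn_uminus [simp]: "sn N (- k) = - sn N k"
  by (simp add: sn_def)

lemma sn_0 [simp]: "sn N 0 = 0"
  by (simp add: sn_def)

lemma sn_shift_half:
  assumes "N > 0"
  shows "sn N (k + 4 * int N) = - sn N k"
proof -
  have "pi * of_int (k + 4 * int N) / (4 * real N) = pi * of_int k / (4 * real N) + pi"
    using assms by (simp add: field_simps)
  then show ?thesis unfolding sn_def by (simp add: sin_add)
qed

lemma sn_shift:
  assumes "N > 0"
  shows "sn N (k + 8 * int N * t) = sn N k"
proof -
  have "pi * of_int (k + 8 * int N * t) / (4 * real N) = pi * of_int k / (4 * real N) + 2 * pi * of_int t"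
    using assms by (simp add: field_simps)
  then show ?thesis unfolding sn_def by (simp add: sin_add)
qed

lemma sn_pos:
  assumes "0 < k" "k < 4 * int N"
  shows "sn N k > 0"
proof -
  have "N > 0" using assms by simp
  moreover have "real_of_int k < 4 * real N" using assms by linarith
  ultimately show ?thesis unfolding sn_def using assms by (intro sin_gt_zero) (auto simp: field_simps)
qed

lemma sn_nonpos:
  assumes "N > 0" "8 * int N * t + 4 * int N \<le> k" "k \<le> 8 * int N * t + 8 * int N"
  shows "sn N k \<le> 0"
proof -
  define y where "y = k - 8 * int N * t - 4 * int N"
  have "sn N k = - sn N y"
    using sn_shift[OF assms(1), of "y + 4 * int N" t] sn_shift_half[OF assms(1), of y]
    by (simp add: y_def)
  moreover have "sn N y \<ge> 0"
    using sn_pos[of y N] assms(2,3) sn_shift_half[OF assms(1), of 0]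
    by (cases "y = 0 \<or> y = 4 * int N") (auto simp: y_def)
  ultimately show ?thesis by simp
qed

text \<open>The map j -> 4N - j is J_b on odd indices. It replaces the argument x by E\<pi> - x, and
  sin(E\<pi> - x) = sin x for odd E.\<close>

lemma sn_fold:
  assumes "N > 0" "odd E"
  shows "sn N ((4 * int N - j) * E) = sn N (j * E)"
proof -
  obtain q where q: "E = 2 * q + 1" using assms(2) by (auto elim: oddE)
  have "(4 * int N - j) * E = (- (j * E) + 4 * int N) + 8 * int N * q"
    by (simp add: q algebra_simps)
  then show ?thesis by (simp only: sn_shift[OF assms(1)] sn_shift_half[OF assms(1)] sn_uminus minus_minus)
qed

lemma ph_add: "ph N (x + y) = ph N x * ph N y"
  by (simp add: ph_def cis_mult add_divide_distrib distrib_left)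

lemma ph_period [simp]:
  assumes "N > 0"
  shows "ph N (16 * int N * t) = 1"
proof -
  have "pi * of_int (16 * int N * t) / (8 * real N) = 2 * pi * of_int t"
    using assms by (simp add: field_simps)
  then show ?thesis unfolding ph_def by (simp add: complex_eq_iff)
qed

lemma ph_0 [simp]: "ph N 0 = 1" by (simp add: ph_def)

lemma ph_nonzero [simp]: "ph N x \<noteq> 0" by (simp add: ph_def)

lemma ph_power: "ph N x ^ k = ph N (int k * x)"
  by (induction k) (simp_all add: ph_add algebra_simps)

lemma ph_eqI:
  assumes "N > 0" "x = y + 16 * int N * t"
  shows "ph N x = ph N y"
  using assms by (simp add: ph_add)

lemma ph_eq_iff:
  assumes "N > 0"
  shows "ph N x = ph N y \<longleftrightarrow> [x = y] (mod (16 * int N))"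
proof
  assume "ph N x = ph N y"
  then obtain t :: int where t: "pi * of_int x / (8 * real N) = pi * of_int y / (8 * real N) + 2 * pi * of_int t"
    unfolding ph_def complex_eq_iff cis.sel using sin_cos_eq_iff by metis
  then have "pi * of_int x = pi * of_int (y + 16 * int N * t)"
    using assms by (simp add: field_simps)
  then have "real_of_int x = real_of_int (y + 16 * int N * t)"
    by (simp only: mult_cancel_left pi_neq_zero simp_thms)
  then have "x = y + 16 * int N * t" by linarith
  then show "[x = y] (mod (16 * int N))" by (simp add: cong_def)
next
  assume "[x = y] (mod (16 * int N))"
  then obtain t where "x = y + 16 * int N * t" by (metis cong_iff_lin cong_sym)
  then show "ph N x = ph N y" using ph_eqI[OF assms] by blast
qed

lemma sn_ph: "complex_of_real (sn N x) = (ph N (2 * x) - ph N (- 2 * x)) / (2 * \<i>)"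
  by (simp add: ph_def sn_def complex_eq_iff)

section \<open>Orthogonality of sines at odd multiples, and Gauss sums\<close>

lemma sn_mult: "sn N x * sn N y = (cos (pi * of_int (x - y) / (4 * real N)) - cos (pi * of_int (x + y) / (4 * real N))) / 2"
  by (simp add: sn_def sin_times_sin add_divide_distrib diff_divide_distrib distrib_left right_diff_distrib)

text \<open>Multiplying by $2\sin y$ makes the sum telescope.\<close>
lemma sum_cos_odd_mult_sin: "2 * sin y * (\<Sum>e<n. cos (real (2 * e + 1) * y)) = sin (2 * real n * y)"
proof (induction n)
  case (Suc n)
  have "2 * sin y * cos (real (2 * n + 1) * y) = sin (2 * real (Suc n) * y) - sin (2 * real n * y)"
  proof -
    have "2 * real (Suc n) * y = real (2 * n + 1) * y + y" "2 * real n * y = real (2 * n + 1) * y - y"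
      by (simp_all add: algebra_simps)
    then show ?thesis by (simp only: sin_add sin_diff) simp
  qed
  then show ?case using Suc by (simp add: distrib_left)
qed simp

text \<open>With y = \<pi>D/(2M): if 2M divides D, the terms are all 1 or all -1; otherwise sin y
  \<noteq> 0, while the telescoped value is sin(\<pi>D) = 0.\<close>

lemma sum_cos_odd:
  fixes D :: int
  assumes "M > 0"
  shows "(\<Sum>e<M. cos (real (2 * e + 1) * (pi * of_int D / (2 * real M)))) =
    (if 4 * int M dvd D then real M else if 4 * int M dvd D - 2 * int M then - real M else 0)"
proof -
  define y where "y = pi * of_int D / (2 * real M)"
  have y: "2 * real M * y = pi * of_int D" using assms by (simp add: y_def)
  consider (a) t where "D = 4 * int M * t" | (b) t where "D = 4 * int M * t + 2 * int M" | (c) "\<not> 2 * int M dvd D"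
  proof (cases "2 * int M dvd D")
    case True
    then obtain k where k: "D = 2 * int M * k" by auto
    show ?thesis
    proof (cases "even k")
      case True then obtain t where "k = 2 * t" by auto
      then show ?thesis using k that(1)[of t] by simp
    next
      case False then obtain t where "k = 2 * t + 1" by (auto elim: oddE)
      then show ?thesis using k that(2)[of t] by (simp add: algebra_simps)
    qed
  qed (use that(3) in blast)
  then show ?thesis
  proof cases
    case a
    have yt: "y = 2 * pi * of_int t" using assms by (simp add: y_def a field_simps)
    have "cos (real (2 * e + 1) * y) = 1" for e
    proof -
      have "real (2 * e + 1) * y = 2 * pi * of_int (t * int (2 * e + 1))" by (simp add: yt)
      then show ?thesis by (simp only: cos_int_2pin)
    qed
    then have "(\<Sum>e<M. cos (real (2 * e + 1) * y)) = real M" by (simp only: sum_constant) simp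
    then show ?thesis using a by (simp only: y_def) simp
  next
    case b
    have yt: "y = 2 * pi * of_int t + pi" using assms by (simp add: y_def b field_simps)
    have "cos (real (2 * e + 1) * y) = - 1" for e
    proof -
      have "real (2 * e + 1) * y = 2 * pi * of_int (t * int (2 * e + 1) + int e) + pi" by (simp add: yt algebra_simps)
      then show ?thesis by (simp only: cos_add cos_int_2pin sin_int_2pin) simp
    qed
    moreover have "\<not> 4 * int M dvd D"
    proof
      assume "4 * int M dvd D"
      then have "4 * int M dvd D - 4 * int M * t" by (simp add: dvd_diff)
      then have "4 * int M dvd 2 * int M" by (simp add: b)
      then show False using assms by (auto dest: zdvd_imp_le)
    qed
    moreover have "4 * int M dvd D - 2 * int M" by (simp add: b)
    moreover have "(\<Sum>e<M. cos (real (2 * e + 1) * y)) = - real M"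
      using calculation(1) by (simp only: sum_constant) simp
    ultimately show ?thesis unfolding y_def by simp
  next
    case c
    have "sin y \<noteq> 0"
    proof
      assume "sin y = 0"
      then obtain k :: int where "y = of_int k * pi" by (auto simp: sin_zero_iff_int2)
      then have "real_of_int D = of_int (2 * int M * k)" using y assms by (simp add: algebra_simps)
      then have "D = 2 * int M * k" by linarith
      then show False using c by simp
    qed
    moreover have "sin (2 * real M * y) = 0" unfolding y by (metis mult.commute sin_int_times_real sin_zero_iff_int2)
    ultimately have "(\<Sum>e<M. cos (real (2 * e + 1) * y)) = 0" using sum_cos_odd_mult_sin[of y M] by simp
    moreover have d24: "2 * int M dvd 4 * int M" by simp
    moreover have "\<not> 4 * int M dvd D" using c d24 dvd_trans by blast
    moreover have "\<not> 4 * int M dvd D - 2 * int M"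
    proof
      assume "4 * int M dvd D - 2 * int M"
      then have "2 * int M dvd D - 2 * int M" by (rule dvd_trans[OF d24])
      then have "2 * int M dvd D - 2 * int M + 2 * int M" by (intro dvd_add) simp_all
      then show False using c by simp
    qed
    ultimately show ?thesis unfolding y_def by simp
  qed
qed

lemma sum_shift_periodic:
  fixes f :: "int \<Rightarrow> 'a :: comm_monoid_add"
  assumes "p > 0" and per: "\<And>x. f (x + p) = f x"
  shows "(\<Sum>b\<in>{0..<p}. f (b + c)) = (\<Sum>b\<in>{0..<p}. f b)"
proof -
  have pern: "f (x + p * int n) = f x" for x n
  proof (induction n)
    case (Suc n)
    have "x + p * int (Suc n) = (x + p * int n) + p" by (simp add: algebra_simps)
    then show ?case using Suc per by metis
  qed simp
  have perk: "f (x + p * k) = f x" for x k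
  proof (cases "k \<ge> 0")
    case True then show ?thesis using pern[of x "nat k"] by simp
  next
    case False then show ?thesis using pern[of "x + p * k" "nat (- k)"] by simp
  qed
  have fm: "f (x mod p) = f x" for x
    using perk[of "x mod p" "x div p"] by (simp add: mult.commute)
  show ?thesis
    by (rule sum.reindex_bij_witness[of _ "\<lambda>b. (b - c) mod p" "\<lambda>b. (b + c) mod p"])
       (use assms(1) in \<open>auto simp: fm mod_simps\<close>)
qed

text \<open>The sum of cos(\<pi>D(2e + 1)/(4N)) over e < 2N. Only odd multiples occur, so a shift of
  D by 4N reverses the sign; this is where the value -2N comes from.\<close>

definition cos_sum :: "nat \<Rightarrow> int \<Rightarrow> real" where
  "cos_sum N D = (if 8 * int N dvd D then 2 * real N else if 8 * int N dvd D - 4 * int N then - 2 * real N else 0)"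

lemma sn_orth:
  assumes "N > 0"
  shows "(\<Sum>e<2 * N. sn N (j * (2 * int e + 1)) * sn N (k * (2 * int e + 1))) = (cos_sum N (j - k) - cos_sum N (j + k)) / 2"
proof -
  have cos_sum: "(\<Sum>e<2 * N. cos (pi * of_int (D * (2 * int e + 1)) / (4 * real N))) = cos_sum N D" for D
  proof -
    have "pi * of_int (D * (2 * int e + 1)) / (4 * real N) = real (2 * e + 1) * (pi * of_int D / (2 * real (2 * N)))" for e
      by (simp add: field_simps)
    then have "(\<Sum>e<2 * N. cos (pi * of_int (D * (2 * int e + 1)) / (4 * real N)))
      = (\<Sum>e<2 * N. cos (real (2 * e + 1) * (pi * of_int D / (2 * real (2 * N)))))"
      by (simp only:)
    also have "\<dots> = cos_sum N D"
      using assms by (subst sum_cos_odd) (simp_all add: cos_sum_def)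
    finally show ?thesis .
  qed
  have "(\<Sum>e<2 * N. sn N (j * (2 * int e + 1)) * sn N (k * (2 * int e + 1)))
    = (\<Sum>e<2 * N. (cos (pi * of_int ((j - k) * (2 * int e + 1)) / (4 * real N))
        - cos (pi * of_int ((j + k) * (2 * int e + 1)) / (4 * real N))) / 2)"
    by (simp only: sn_mult left_diff_distrib distrib_right)
  also have "\<dots> = (cos_sum N (j - k) - cos_sum N (j + k)) / 2"
    by (simp only: cos_sum[symmetric] sum_divide_distrib[symmetric] sum_subtractf)
  finally show ?thesis .
qed

text \<open>Completing the square with the inverse m of l: for B = 2b + c, the exponent -lB^2 + 2BD
  equals mD^2 - l(B - mD)^2 modulo 16N. The parity condition makes B - mD even, so the remaining sum
  is a translate of the Gauss sum.\<close>

lemma gauss_shift: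
  assumes "N > 0" "[m * l = 1] (mod (16 * int N))" "even (D - c)" "odd m"
  shows "(\<Sum>b\<in>{0..<2 * int N}. ph N (- l * (2 * b + c)\<^sup>2 + 2 * (2 * b + c) * D)) = ph N (m * D\<^sup>2) * gauss_sum N l"
proof -
  obtain t where t: "m * l = 1 + 16 * int N * t" using assms(2) by (metis cong_iff_lin cong_sym)
  have "even (c - m * D)" using assms(3,4) by simp
  then obtain d where d: "c - m * D = 2 * d" by (rule dvdE)
  have *: "ph N (- l * (2 * b + c)\<^sup>2 + 2 * (2 * b + c) * D) = ph N (m * D\<^sup>2) * ph N (- 4 * l * (b + d)\<^sup>2)" for b
  proof -
    have c: "c = 2 * d + m * D" using d by simp
    have "- l * (2 * b + c)\<^sup>2 + 2 * (2 * b + c) * D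
      = m * D\<^sup>2 - 4 * l * (b + d)\<^sup>2 + (1 - m * l) * (4 * (b + d) * D + m * D\<^sup>2)"
      unfolding c by (simp add: power2_eq_square algebra_simps)
    also have "\<dots> = (m * D\<^sup>2 + - 4 * l * (b + d)\<^sup>2) + 16 * int N * (- t * (4 * (b + d) * D + m * D\<^sup>2))"
      unfolding t by (simp add: algebra_simps)
    finally show ?thesis using ph_eqI[OF assms(1)] by (metis ph_add)
  qed
  have "ph N (- 4 * l * (x + 2 * int N)\<^sup>2) = ph N (- 4 * l * x\<^sup>2)" for x
    by (rule ph_eqI[OF assms(1), of _ _ "- l * x - l * int N"]) (simp add: power2_eq_square algebra_simps)
  then have "(\<Sum>b\<in>{0..<2 * int N}. ph N (- 4 * l * (b + d)\<^sup>2)) = gauss_sum N l"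
    unfolding gauss_sum_def using assms(1) by (intro sum_shift_periodic) auto
  then show ?thesis unfolding * by (simp flip: sum_distrib_left)
qed

text \<open>By \<open>gauss_shift\<close> every Fourier coefficient of b ->
  \<open>ph N (- 4 * l * b\<^sup>2)\<close> is a multiple of the Gauss sum. If that vanished,
  Fourier inversion at b = 0, where the function is 1, would give 2N = 0.\<close>

lemma gauss_sum_nonzero:
  assumes "N > 0" "[m * l = 1] (mod (16 * int N))" "odd m"
  shows "gauss_sum N l \<noteq> 0"
proof
  assume "gauss_sum N l = 0"
  then have z: "(\<Sum>b\<in>{0..<2 * int N}. ph N (- 4 * l * b\<^sup>2) * ph N (8 * b * int D)) = 0" for D
    using gauss_shift[OF assms(1,2) _ assms(3), of "2 * int D" 0]
    by (simp add: power_mult_distrib algebra_simps flip: ph_add)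
  have inner: "(\<Sum>D<2 * N. ph N (8 * b * int D)) = (if b = 0 then 2 * of_nat N else 0)"
    if b: "b \<in> {0..<2 * int N}" for b
  proof (cases "b = 0")
    case False
    have "ph N (8 * b) \<noteq> ph N 0"
    proof
      assume "ph N (8 * b) = ph N 0"
      then have "16 * int N dvd 8 * b"
        unfolding ph_eq_iff[OF assms(1)] by (simp add: cong_0_iff)
      then show False using b False by (auto dest!: zdvd_imp_le)
    qed
    moreover have "ph N (8 * b) ^ (2 * N) = 1"
      unfolding ph_power using ph_period[OF assms(1), of b] by (simp add: mult_ac)
    ultimately have "(\<Sum>D<2 * N. ph N (8 * b) ^ D) = 0"
      by (subst geometric_sum) simp_all
    then show ?thesis using False by (simp add: ph_power mult_ac)
  qed simp
  have "0 = (\<Sum>D<2 * N. \<Sum>b\<in>{0..<2 * int N}. ph N (- 4 * l * b\<^sup>2) * ph N (8 * b * int D))"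
    by (simp only: z sum.neutral_const)
  also have "\<dots> = (\<Sum>b\<in>{0..<2 * int N}. ph N (- 4 * l * b\<^sup>2) * (\<Sum>D<2 * N. ph N (8 * b * int D)))"
    by (subst sum.swap) (simp only: sum_distrib_left)
  also have "\<dots> = (\<Sum>b\<in>{0..<2 * int N}. if b = 0 then 2 * of_nat N else 0)"
    by (intro sum.cong refl) (simp add: inner)
  also have "\<dots> = 2 * of_nat N"
    using assms(1) by simp
  finally show False using assms(1) by simp
qed

text \<open>The middle part S T^l S of the words used later, without constants. The offset c selects
  the parity of the intermediate index: even numbers for c = 0, odd ones for c = 1.\<close>

definition sine_gauss :: "nat \<Rightarrow> int \<Rightarrow> int \<Rightarrow> int \<Rightarrow> int \<Rightarrow> complex" where
  "sine_gauss N l c A C = (\<Sum>b\<in>{0..<2 * int N}.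
     of_real (sn N (A * (2 * b + c))) * of_real (sn N ((2 * b + c) * C)) * ph N (- l * (2 * b + c)\<^sup>2))"

text \<open>The product of two sines splits into four phases, and \<open>gauss_shift\<close> turns
  each into the phase of m(A - C)^2 or m(A + C)^2. The outer factors remove mA^2 and mC^2, and the
  cross terms 2mAC reassemble to one sine.\<close>

lemma sum_sn_gauss:
  assumes "N > 0" "[m * l = 1] (mod (16 * int N))" "odd m" "even (A + C - c)"
  shows "ph N (- m * A\<^sup>2) * sine_gauss N l c A C * ph N (- m * C\<^sup>2)
    = - \<i> * gauss_sum N l * of_real (sn N (m * A * C))"
proof -
  let ?B = "\<lambda>b. 2 * b + c"
  let ?g = "\<lambda>D b. ph N (- l * (?B b)\<^sup>2 + 2 * ?B b * D)"
  have *: "complex_of_real (sn N (A * B)) * of_real (sn N (B * C)) * p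
     = (ph N (2 * B * (A - C)) * p + ph N (2 * B * (C - A)) * p - ph N (2 * B * (A + C)) * p - ph N (2 * B * (- A - C)) * p) / 4" for B p
  proof -
    have "ph N (2 * B * (A - C)) = ph N (2 * (A * B)) * ph N (- 2 * (B * C))"
      "ph N (2 * B * (C - A)) = ph N (- 2 * (A * B)) * ph N (2 * (B * C))"
      "ph N (2 * B * (A + C)) = ph N (2 * (A * B)) * ph N (2 * (B * C))"
      "ph N (2 * B * (- A - C)) = ph N (- 2 * (A * B)) * ph N (- 2 * (B * C))"
      by (simp_all add: ph_add[symmetric] algebra_simps)
    then show ?thesis unfolding sn_ph by (simp add: field_simps)
  qed
  have **: "complex_of_real (sn N (A * ?B b)) * of_real (sn N (?B b * C)) * ph N (- l * (?B b)\<^sup>2)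
     = (?g (A - C) b + ?g (C - A) b - ?g (A + C) b - ?g (- A - C) b) / 4" for b
    unfolding * by (simp only: ph_add mult.commute)
  have ev: "even (A - C - c)" "even (C - A - c)" "even (A + C - c)" "even (- A - C - c)"
    using assms(4) by presburger+
  have "(\<Sum>b\<in>{0..<2 * int N}. of_real (sn N (A * ?B b)) * of_real (sn N (?B b * C)) * ph N (- l * (?B b)\<^sup>2))
    = ((\<Sum>b\<in>{0..<2 * int N}. ?g (A - C) b) + (\<Sum>b\<in>{0..<2 * int N}. ?g (C - A) b)
       - (\<Sum>b\<in>{0..<2 * int N}. ?g (A + C) b) - (\<Sum>b\<in>{0..<2 * int N}. ?g (- A - C) b)) / 4"
    unfolding ** by (simp only: sum_divide_distrib[symmetric] sum_subtractf sum.distrib)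
  also have "\<dots> = gauss_sum N l * (ph N (m * (A - C)\<^sup>2) + ph N (m * (C - A)\<^sup>2) - ph N (m * (A + C)\<^sup>2) - ph N (m * (- A - C)\<^sup>2)) / 4"
    unfolding gauss_shift[OF assms(1,2) ev(1) assms(3)] gauss_shift[OF assms(1,2) ev(2) assms(3)]
      gauss_shift[OF assms(1,2) ev(3) assms(3)] gauss_shift[OF assms(1,2) ev(4) assms(3)]
    by (simp add: algebra_simps)
  also have "\<dots> = gauss_sum N l * (ph N (m * (A - C)\<^sup>2) - ph N (m * (A + C)\<^sup>2)) / 2"
  proof -
    have "(C - A)\<^sup>2 = (A - C)\<^sup>2" "(- A - C)\<^sup>2 = (A + C)\<^sup>2" by (simp_all add: power2_eq_square algebra_simps)
    then show ?thesis by simp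
  qed
  finally have S: "(\<Sum>b\<in>{0..<2 * int N}. of_real (sn N (A * ?B b)) * of_real (sn N (?B b * C)) * ph N (- l * (?B b)\<^sup>2))
    = gauss_sum N l * (ph N (m * (A - C)\<^sup>2) - ph N (m * (A + C)\<^sup>2)) / 2" .
  have e: "ph N (- m * A\<^sup>2) * ph N (m * (A - C)\<^sup>2) * ph N (- m * C\<^sup>2) = ph N (- 2 * (m * A * C))"
    "ph N (- m * A\<^sup>2) * ph N (m * (A + C)\<^sup>2) * ph N (- m * C\<^sup>2) = ph N (2 * (m * A * C))"
    unfolding ph_add[symmetric] by (rule arg_cong[of _ _ "ph N"], simp add: power2_eq_square algebra_simps)+
  have "ph N (- m * A\<^sup>2) * (gauss_sum N l * (ph N (m * (A - C)\<^sup>2) - ph N (m * (A + C)\<^sup>2)) / 2) * ph N (- m * C\<^sup>2)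
    = gauss_sum N l * (ph N (- m * A\<^sup>2) * ph N (m * (A - C)\<^sup>2) * ph N (- m * C\<^sup>2)
       - ph N (- m * A\<^sup>2) * ph N (m * (A + C)\<^sup>2) * ph N (- m * C\<^sup>2)) / 2"
    by (simp add: algebra_simps)
  also have "\<dots> = - \<i> * gauss_sum N l * of_real (sn N (m * A * C))"
    unfolding e sn_ph by (simp add: field_simps)
  finally show ?thesis unfolding sine_gauss_def S .
qed

section \<open>The parity rule\<close>

lemma odd_part:
  assumes "(n::int) > 0"
  obtains k q where "n = 2 ^ k * q" "odd q" "q > 0"
proof -
  have "\<exists>k q. m = 2 ^ k * q \<and> odd q" if "m > 0" for m :: nat
    using that
  proof (induction m rule: less_induct)
    case (less m)
    show ?case
    proof (cases "even m")
      case True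
      then obtain j where j: "m = 2 * j" by auto
      then obtain k q where "j = 2 ^ k * q" "odd q" using less.IH[of j] less.prems by auto
      then show ?thesis using j by (intro exI[of _ "Suc k"] exI[of _ q]) simp
    next
      case False
      then show ?thesis by (intro exI[of _ 0] exI[of _ m]) simp
    qed
  qed
  from this[of "nat n"] obtain k q where "nat n = 2 ^ k * q" "odd q" using assms by auto
  then have "int (nat n) = int (2 ^ k * q)" "odd q" by auto
  then have "n = 2 ^ k * int q" "odd (int q)" "int q > 0"
    using assms by (simp_all add: odd_pos)
  then show ?thesis by (rule that)
qed

lemma coprime_self_diff: "coprime x n \<Longrightarrow> coprime (n - x) n" for n :: int
  by (simp only: coprime_iff_gcd_eq_1 gcd_diff2)

lemma coprime_self_add: "coprime x n \<Longrightarrow> coprime (n + x) n" for n :: int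
  by (simp only: coprime_iff_gcd_eq_1 add.commute[of n] gcd_add1)

lemma coprime_two_power_mult:
  fixes Q :: int
  assumes "odd Q" "odd m" "coprime m Q"
  shows "coprime m (2 * (2 ^ k * Q))"
  using assms by simp

text \<open>Write $N = 2^k Q$ with $Q$ odd. The multipliers $2N - 1$, $Q - 2^j$, $Q + 2$ and $Q - 4$
  suffice.\<close>
lemma parity_rule_half:
  fixes N :: nat and A :: int
  assumes N: "N \<ge> 4" and A: "odd A" "0 < A" "A \<le> 2 * int N"
    and sq: "[A\<^sup>2 = 1] (mod (8 * int N))"
    and pos: "\<And>m. coprime m (2 * int N) \<Longrightarrow> 0 < m \<Longrightarrow> m < 4 * int N \<Longrightarrow> sn N (m * A) > 0"
  shows "A = 1"
proof (rule ccontr)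
  assume A1: "A \<noteq> 1"
  have N0: "N > 0" using N by simp
  have bad: False if "coprime m (2 * int N)" "0 < m" "m < 4 * int N"
    "8 * int N * t + 4 * int N \<le> m * A" "m * A \<le> 8 * int N * t + 8 * int N" for m t
    using pos[OF that(1-3)] sn_nonpos[OF N0 that(4,5)] by simp
  obtain k Q where kQ: "int N = 2 ^ k * Q" "odd Q" "Q > 0"
    using odd_part[of "int N"] N by auto
  have NQ: "int N \<ge> Q" using kQ(1,3) by (simp add: mult_le_cancel_right1)
  have cop: "coprime m (2 * int N)" if "odd m" "coprime m Q" for m
    unfolding kQ(1) using kQ(2) that by (rule coprime_two_power_mult)
  have A2N: "A < 2 * int N" using A by (metis dvd_triv_left order_le_less)
  \<comment> \<open>Multiplier 2N - 1: for A = 4u + 3 the product is 6N - A modulo 8N, which lies in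
    the half period where the sine is not positive.\<close>
  have A4: "A mod 4 = 1"
  proof (rule ccontr)
    assume "A mod 4 \<noteq> 1"
    then have "A mod 4 = 3" using A(1) by presburger
    then obtain u where u: "A = 4 * u + 3" by (metis mult_div_mod_eq)
    have "coprime (2 * int N - 1) (2 * int N)" by (rule coprime_self_diff) simp
    moreover have "(2 * int N - 1) * A = 8 * int N * u + (6 * int N - A)" unfolding u by (simp add: algebra_simps)
    ultimately show False using bad[of "2 * int N - 1" u] A(2) A2N N by simp
  qed
  then obtain v where v: "A = 4 * v + 1" by (metis mult_div_mod_eq)
  \<comment> \<open>The congruence reduces to N dividing v(2v + 1), and the odd factor 2v + 1
    contributes nothing to the power of two.\<close>
  have "2 ^ (k + 2) dvd A - 1"
  proof -
    have "8 * int N dvd A\<^sup>2 - 1" using sq by (simp add: cong_iff_dvd_diff)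
    also have "A\<^sup>2 - 1 = 8 * (v * (2 * v + 1))" unfolding v by (simp add: power2_eq_square algebra_simps)
    finally have "int N dvd v * (2 * v + 1)" by simp
    then have "2 ^ k dvd v * (2 * v + 1)" unfolding kQ(1) by (rule dvd_mult_left)
    moreover have "coprime (2 ^ k) (2 * v + 1)" by (simp add: coprime_power_left_iff)
    ultimately have "2 ^ k dvd v" by (simp add: coprime_dvd_mult_left_iff)
    then show ?thesis unfolding v by (simp add: power_add mult.commute)
  qed
  then obtain g where g: "A = 1 + 4 * 2 ^ k * g" by (auto elim!: dvdE simp: power_add algebra_simps)
  have g0: "g > 0"
  proof (rule ccontr)
    assume "\<not> g > 0"
    then have "(2 ^ k :: int) * g \<le> 0" by (simp add: mult_nonneg_nonpos)
    then show False using g A(2) A1 by simp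
  qed
  have Ag: "1 + 4 * 2 ^ k \<le> A" unfolding g using g0 by (simp add: mult_le_cancel_left1)
  \<comment> \<open>Q shares a factor with N once Q \<ge> 3, but QA is known exactly: it lies Q
    above the multiple 4Ng of the half period. The units below are Q altered by a power of two, and
    the parity of g decides in which direction the product must be moved.\<close>
  have QA: "Q * A = Q + 4 * int N * g" unfolding g kQ(1) by (simp add: algebra_simps)
  have Q3: "Q \<ge> 3"
  proof (rule ccontr)
    assume "\<not> Q \<ge> 3"
    then have "Q = 1" using kQ(2,3) by presburger
    then have "A \<le> 2 * 2 ^ k" using A(3) kQ(1) by simp
    moreover have "(0 :: int) < 2 ^ k" by simp
    ultimately show False using Ag by linarith
  qed
  show False
  proof (cases "even g")
    case True
    then obtain h where h: "g = 2 * h" by auto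
    have A9: "A \<ge> 5" using Ag one_le_power[of "2 :: int" k] by linarith
    \<comment> \<open>For even g the product must drop just below a multiple of 8N. The least power
      of two with 2^j A > Q overshoots by a factor of at most two, except when j has to be raised to
      1; in both cases the drop stays within 4N.\<close>
    have "\<exists>j\<ge>1. Q < 2 ^ j * A \<and> (2 ^ j * A \<le> 2 * A \<or> 2 ^ j * A \<le> 2 * Q)"
    proof -
      define j where "j = (LEAST j. Q < 2 ^ j * A)"
      have ex: "Q < 2 ^ nat Q * A"
      proof -
        have "Q < 2 ^ nat Q" using of_nat_less_two_power[of "nat Q", where 'a = int] kQ(3) by simp
        also have "\<dots> \<le> 2 ^ nat Q * A" using A(2) by (simp add: mult_le_cancel_left1)
        finally show ?thesis .
      qed
      then have j: "Q < 2 ^ j * A" unfolding j_def by (rule LeastI)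
      show ?thesis
      proof (cases "j \<le> 1")
        case True
        have "2 ^ j * A \<le> 2 ^ 1 * A" using True A(2) by (intro mult_right_mono power_increasing) auto
        then show ?thesis using j by (intro exI[of _ 1]) auto
      next
        case False
        then obtain i where i: "j = Suc i" by (cases j) auto
        then have "\<not> Q < 2 ^ i * A" using not_less_Least[of i "\<lambda>j. Q < 2 ^ j * A"] by (simp add: j_def)
        then show ?thesis using j i by (intro exI[of _ j]) auto
      qed
    qed
    then obtain j where j: "j \<ge> 1" "Q < 2 ^ j * A" "2 ^ j * A \<le> 2 * A \<or> 2 ^ j * A \<le> 2 * Q" by blast
    have jQ: "2 ^ j < Q"
    proof (cases "2 ^ j * A \<le> 2 * A")
      case True
      then have "2 ^ j \<le> (2 :: int)" using A(2) by (simp add: mult_le_cancel_right)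
      then show ?thesis using Q3 by simp
    next
      case False
      have "2 ^ j * 5 \<le> 2 ^ j * A" using A9 by simp
      then show ?thesis using False j(3) kQ(3) by linarith
    qed
    have "odd (Q - 2 ^ j)" using kQ(2) j(1) by simp
    moreover have "coprime (Q - 2 ^ j) Q"
    proof -
      have "coprime (2 ^ j) Q" using kQ(2) by (simp add: coprime_power_left_iff)
      then show ?thesis by (rule coprime_self_diff)
    qed
    moreover have "(Q - 2 ^ j) * A = 8 * int N * (h - 1) + 8 * int N + (Q - 2 ^ j * A)"
      using QA by (simp add: left_diff_distrib right_diff_distrib h)
    moreover have "- 4 * int N \<le> Q - 2 ^ j * A" using j(3) A(3) NQ kQ(3) by linarith
    moreover have "0 < (2 :: int) ^ j" by simp
    ultimately show False using bad[of "Q - 2 ^ j" "h - 1"] cop[of "Q - 2 ^ j"] jQ j(2) NQ kQ(3)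
      by linarith
  next
    case False
    then obtain h where h: "g = 2 * h + 1" by (auto elim: oddE)
    have QA': "Q * A = 8 * int N * h + 4 * int N + Q" unfolding QA h by (simp add: algebra_simps)
    \<comment> \<open>For odd g, QA lies Q above the left end of a half period without positive
      values; adding 2A stays inside as long as Q + 2A \<le> 4N.\<close>
    have plus2: False if "Q + 2 * A \<le> 4 * int N"
    proof -
      have "odd (Q + 2)" "coprime (Q + 2) Q" using kQ(2) by (auto intro: coprime_self_add)
      moreover have "(Q + 2) * A = 8 * int N * h + 4 * int N + (Q + 2 * A)" using QA' by (simp add: distrib_right)
      ultimately show False using bad[of "Q + 2" h] cop[of "Q + 2"] that A(2) NQ kQ(3) N by simp
    qed
    show False
    \<comment> \<open>The multiplier Q - 4 used below must be positive. For Q = 3 we have N = 3 *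
      2^k with k > 0, the bound on A forces g = 1, and Q + 2 is enough.\<close>
    proof (cases "Q = 3")
      case True
      have "k \<noteq> 0" using kQ(1) N True by (intro notI) simp
      then have k2: "2 ^ k \<ge> (2 :: int)" by (cases k) auto
      have "g = 1"
      proof (rule ccontr)
        assume "g \<noteq> 1"
        then have "2 ^ k * 2 \<le> (2 ^ k :: int) * g" using g0 by (intro mult_left_mono) auto
        moreover have "A = 1 + 4 * (2 ^ k * g)" "int N = 3 * 2 ^ k" using g kQ(1) True by simp_all
        ultimately show False using A(3) k2 by linarith
      qed
      then show False using plus2 g kQ(1) True k2 by simp
    next
      case False
      then have Q5: "Q \<ge> 5" using Q3 kQ(2) by presburger
      show False
      proof (cases "Q + 2 * A \<le> 4 * int N")
        case False
        \<comment> \<open>Now 4A > 8N - 2Q, so subtracting 4A from QA crosses the preceding positive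
          half period completely; A \<le> 2N keeps the result within the nonpositive one before
          it.\<close>
        have "odd (Q - 4)" using kQ(2) by simp
        moreover have "coprime (Q - 4) Q"
        proof -
          have "coprime (2 ^ 2) Q" using kQ(2) by (simp only: coprime_power_left_iff) simp
          then show ?thesis by (intro coprime_self_diff) simp
        qed
        moreover have "(Q - 4) * A = 8 * int N * (h - 1) + 8 * int N + (4 * int N + Q - 4 * A)"
          using QA' by (simp add: algebra_simps)
        ultimately show False using bad[of "Q - 4" "h - 1"] cop[of "Q - 4"] Q5 NQ A(3) False by simp
      qed (use plus2 in blast)
    qed
  qed
qed

text \<open>Both hypotheses survive A -> 4N - A: the squares differ by a multiple of 8N, and units
  are odd, so \<open>sn_fold\<close> applies. This reduces the claim to A \<le> 2N.\<close>

lemma parity_rule: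
  fixes N :: nat and A :: int
  assumes N: "N \<ge> 4" and A: "odd A" "0 < A" "A < 4 * int N"
    and sq: "[A\<^sup>2 = 1] (mod (8 * int N))"
    and pos: "\<And>m. coprime m (2 * int N) \<Longrightarrow> 0 < m \<Longrightarrow> m < 4 * int N \<Longrightarrow> sn N (m * A) > 0"
  shows "A = 1 \<or> A = 4 * int N - 1"
proof (cases "A \<le> 2 * int N")
  case True
  then show ?thesis using parity_rule_half[OF N A(1,2) _ sq pos] by blast
next
  case False
  have "(4 * int N - A)\<^sup>2 - 1 = A\<^sup>2 - 1 + 8 * int N * (2 * int N - A)"
    by (simp add: power2_eq_square algebra_simps)
  then have "[(4 * int N - A)\<^sup>2 = 1] (mod (8 * int N))"
    using sq unfolding cong_iff_dvd_diff by (metis dvd_add dvd_triv_left)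
  moreover have "sn N (m * (4 * int N - A)) > 0"
    if "coprime m (2 * int N)" "0 < m" "m < 4 * int N" for m
  proof -
    have "odd m" using that(1) by simp
    then show ?thesis using pos[OF that] sn_fold[of N m A] N by (simp add: mult.commute)
  qed
  ultimately have "4 * int N - A = 1"
    using A False by (intro parity_rule_half[OF N]) auto
  then show ?thesis by simp
qed

text \<open>Excludes a coupling of the vacuum to an even index 2b. The congruence comes from
  T-invariance; \<open>pos\<close> and \<open>neg\<close> are the sign rule twisted by the sign of
  \<open>T_shift_sign\<close>. Read modulo 8, the congruence leaves N = 5 for even b and N = 1 for
  odd b, and each case has multipliers that violate the signs.\<close>

lemma parity_rule_spinor:
  fixes N :: nat and b :: int
  assumes N: "N \<ge> 4" "odd N" and b: "int N < b" "b < 2 * int N"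
    and sq: "[4 * b\<^sup>2 = 1 + 3 * int N * (2 * int N - 1)] (mod (8 * int N))"
    and pos: "\<And>m. coprime m (2 * int N) \<Longrightarrow> 0 < m \<Longrightarrow> m < 4 * int N \<Longrightarrow>
      [m = 1] (mod 8) \<or> [m = 7] (mod 8) \<Longrightarrow> sn N (m * (2 * b)) > 0"
    and neg: "\<And>m. coprime m (2 * int N) \<Longrightarrow> 0 < m \<Longrightarrow> m < 4 * int N \<Longrightarrow>
      [m = 3] (mod 8) \<Longrightarrow> sn N (m * (2 * b)) < 0"
  shows False
proof -
  have oN: "odd (int N)" using N(2) by simp
  have "int N mod 2 = 1" using oN by presburger
  have sq8: "8 dvd 4 * b\<^sup>2 - (1 + 3 * int N * (2 * int N - 1))"
    using sq unfolding cong_iff_dvd_diff by (meson dvd_mult_left)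
  obtain c where c: "int N = 2 * c + 1" using oN by (rule oddE)
  show False
  proof (cases "even b")
    case True
    then obtain d where d: "b = 2 * d" by auto
    have "8 dvd (16 * d\<^sup>2 - 24 * c\<^sup>2 - 12 * c - 6 * c - 4)"
      using sq8 unfolding c d by (simp add: power2_eq_square algebra_simps)
    then have "8 dvd 8 * (2 * d\<^sup>2 - 3 * c\<^sup>2) - (16 * d\<^sup>2 - 24 * c\<^sup>2 - 12 * c - 6 * c - 4)"
      by (rule dvd_diff[OF dvd_triv_left])
    also have "8 * (2 * d\<^sup>2 - 3 * c\<^sup>2) - (16 * d\<^sup>2 - 24 * c\<^sup>2 - 12 * c - 6 * c - 4) = 18 * c + 4"
      by simp
    finally have "c mod 4 = 2" by presburger
    then obtain k where k: "c = 4 * k + 2" by (metis mult_div_mod_eq)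
    \<comment> \<open>For N = 5 modulo 8 the unit 2N - 1 is 1 modulo 8 and so should give a positive
      sine; but b is even, so (2N - 1)2b is -2b modulo 8N.\<close>
    have "2 * int N - 1 - 1 = 8 * (2 * k + 1)" unfolding c k by simp
    then have "[2 * int N - 1 = 1] (mod 8)" unfolding cong_iff_dvd_diff by simp
    moreover have "coprime (2 * int N - 1) (2 * int N)" by (rule coprime_self_diff) simp
    ultimately have "sn N ((2 * int N - 1) * (2 * b)) > 0" using N by (intro pos) auto
    moreover have "(2 * int N - 1) * (2 * b) = - (2 * b) + 8 * int N * d" unfolding d by (simp add: algebra_simps)
    moreover have "sn N (2 * b) > 0" using b by (intro sn_pos) auto
    ultimately show False using sn_shift[of N "- (2 * b)" d] N by simp
  next
    case False
    then obtain d where d: "b = 2 * d + 1" by (auto elim: oddE)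
    have "8 dvd (16 * d\<^sup>2 + 16 * d - 24 * c\<^sup>2 - 12 * c - 6 * c)"
      using sq8 unfolding c d by (simp add: power2_eq_square algebra_simps)
    then have "8 dvd 8 * (2 * d\<^sup>2 + 2 * d - 3 * c\<^sup>2) - (16 * d\<^sup>2 + 16 * d - 24 * c\<^sup>2 - 12 * c - 6 * c)"
      by (rule dvd_diff[OF dvd_triv_left])
    also have "8 * (2 * d\<^sup>2 + 2 * d - 3 * c\<^sup>2) - (16 * d\<^sup>2 + 16 * d - 24 * c\<^sup>2 - 12 * c - 6 * c) = 18 * c"
      by simp
    finally have "4 dvd c" by presburger
    then obtain k where k: "c = 4 * k" by (rule dvdE)
    \<comment> \<open>The units N + 2 and N - 2 are 3 and 7 modulo 8 and demand opposite signs.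
      Their products with 2b add up to 4Nb, an odd multiple of 4N, which makes the two sines
      equal.\<close>
    have "coprime (int N + 2) (2 * int N)" "coprime (int N - 2) (2 * int N)"
      using oN coprime_self_add[of 2 "int N"] coprime_self_diff[of 2 "int N"] by simp_all
    moreover have "int N + 2 - 3 = 8 * k" "int N - 2 - 7 = 8 * (k - 1)" unfolding c k by simp_all
    then have "[int N + 2 = 3] (mod 8)" "[int N - 2 = 7] (mod 8)" unfolding cong_iff_dvd_diff by (simp_all only: dvd_triv_left)
    ultimately have "sn N ((int N + 2) * (2 * b)) < 0" "sn N ((int N - 2) * (2 * b)) > 0"
      using N by (auto intro!: pos neg)
    moreover have "sn N ((int N + 2) * (2 * b)) = sn N ((int N - 2) * (2 * b))"
    proof -
      have "(int N + 2) * (2 * b) = - ((int N - 2) * (2 * b)) + 4 * int N + 8 * int N * d"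
        unfolding d by (simp add: algebra_simps)
      then show ?thesis using N by (simp only: sn_shift sn_shift_half sn_uminus minus_minus)
    qed
    ultimately show False by simp
  qed
qed

section \<open>Folding indices into the fundamental range, and the pairing of sines\<close>

lemma sn_fold_ex:
  assumes "N > 0" "odd k"
  obtains c s where "0 < c" "c < 4 * int N" "odd c" "s = 1 \<or> s = - 1" "\<And>x. sn N (k * x) = s * sn N (c * x)"
proof -
  define r where "r = k mod (8 * int N)"
  have k: "k = r + 8 * int N * (k div (8 * int N))" by (simp add: r_def)
  have r: "0 \<le> r" "r < 8 * int N" using assms(1) by (simp_all add: r_def)
  have odr: "odd r" using assms(2) k by (metis dvd_add dvd_triv_left even_mult_iff even_numeral mult.assoc)
  have sr: "sn N (k * x) = sn N (r * x)" for x
  proof -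
    have "k * x = r * x + 8 * int N * (k div (8 * int N) * x)" by (subst k) (simp add: algebra_simps)
    then show ?thesis using sn_shift[OF assms(1)] by metis
  qed
  show ?thesis
  proof (cases "r < 4 * int N")
    case True
    then show ?thesis using that[of r 1] sr r odr by (cases "r = 0") auto
  next
    case False
    have "sn N (k * x) = - 1 * sn N ((8 * int N - r) * x)" for x
    proof -
      have "r * x = - ((8 * int N - r) * x) + 8 * int N * x" by (simp add: algebra_simps)
      then show ?thesis using sn_shift[OF assms(1)] sr by (metis mult_minus1 sn_uminus)
    qed
    moreover have "8 * int N - r \<noteq> 4 * int N" using odr by presburger
    ultimately show ?thesis using that[of "8 * int N - r" "- 1"] False r odr by auto
  qed
qed

text \<open>Closed form of the sum in \<open>sn_orth_pairing\<close>. It is defined for all integer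
  frequencies, so that an index multiplied by a unit need not be reduced first.\<close>

definition sn_pairing :: "nat \<Rightarrow> int \<Rightarrow> int \<Rightarrow> real" where
  "sn_pairing N j k = (cos_sum N (j - k) - cos_sum N (j + k)) / 2"

lemma cos_sum_small:
  assumes "N > 0" "- 4 * int N < D" "D < 4 * int N"
  shows "cos_sum N D = (if D = 0 then 2 * real N else 0)"
proof -
  have "8 * int N dvd D \<longleftrightarrow> D = 0" using assms dvd_imp_le_int[of D "8 * int N"] by fastforce
  moreover have "\<not> 8 * int N dvd D - 4 * int N"
    using assms zdvd_imp_le[of "8 * int N" "4 * int N - D"] by (auto simp: dvd_diff_commute)
  ultimately show ?thesis by (simp add: cos_sum_def)
qed

lemma cos_sum_shift:
  assumes "N > 0"
  shows "cos_sum N (D + 4 * int N) = - cos_sum N D"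
proof -
  have "8 * int N dvd D + 4 * int N \<longleftrightarrow> 8 * int N dvd D - 4 * int N"
    using dvd_add_left_iff[of "8 * int N" "8 * int N" "D - 4 * int N"] by (simp add: algebra_simps)
  moreover have "\<not> (8 * int N dvd D \<and> 8 * int N dvd D - 4 * int N)"
  proof
    assume "8 * int N dvd D \<and> 8 * int N dvd D - 4 * int N"
    then have "8 * int N dvd D - (D - 4 * int N)" by (blast intro: dvd_diff)
    then show False using assms by (auto dest: zdvd_imp_le)
  qed
  ultimately show ?thesis by (auto simp: cos_sum_def)
qed

lemma cos_sum_odd:
  assumes "odd D"
  shows "cos_sum N D = 0"
proof -
  have "even c" if "8 * int N dvd c" for c using dvd_trans[OF _ that, of 2] by simp
  from this[of D] this[of "D - 4 * int N"] show ?thesis using assms by (auto simp: cos_sum_def)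
qed

text \<open>The second term appears because the sines of j and 4N - j coincide at odd multiples, as
  in \<open>sn_fold\<close>.\<close>

lemma sn_pairing_eq:
  assumes "N > 0" "0 < j" "j < 4 * int N" "0 < k" "k < 4 * int N"
  shows "sn_pairing N j k = (if j = k then real N else 0) + (if j + k = 4 * int N then real N else 0)"
proof -
  have "cos_sum N (j + k) = - cos_sum N (j + k - 4 * int N)" using cos_sum_shift[OF assms(1), of "j + k - 4 * int N"] by simp
  then show ?thesis unfolding sn_pairing_def using assms by (simp add: cos_sum_small)
qed

lemma sn_pairing_parity: "even (j + k + 1) \<Longrightarrow> sn_pairing N j k = 0"
  by (simp add: sn_pairing_def cos_sum_odd)

text \<open>Multiplication by a unit permutes the residues modulo 8N; it fixes 0 and, the unit being
  odd, also 4N.\<close>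

lemma cos_sum_unit:
  assumes "coprime m (2 * int N)"
  shows "cos_sum N (m * D) = cos_sum N D"
proof -
  have om: "odd m" using assms by simp
  have "coprime (2 ^ 3) m" using om by (simp only: coprime_power_left_iff) simp
  then have cop: "coprime (8 * int N) m"
    using assms by (simp add: coprime_commute)
  obtain q where q: "m = 2 * q + 1" using om by (rule oddE)
  have "m * D - 4 * int N = m * (D - 4 * int N) + 8 * int N * q" unfolding q by (simp add: algebra_simps)
  then have "8 * int N dvd m * D - 4 * int N \<longleftrightarrow> 8 * int N dvd m * (D - 4 * int N)"
    by (metis dvd_add_left_iff dvd_triv_left)
  then show ?thesis using cop by (simp add: cos_sum_def coprime_dvd_mult_right_iff)
qed

lemma sn_pairing_unit:
  assumes "coprime m (2 * int N)"
  shows "sn_pairing N (m * j) (m * k) = sn_pairing N j k"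
  using cos_sum_unit[OF assms, of "j - k"] cos_sum_unit[OF assms, of "j + k"]
  by (simp add: sn_pairing_def algebra_simps)

lemma sn_pairing_nonneg:
  assumes "N > 0" "0 < j" "j < 4 * int N" "0 < k" "k < 4 * int N"
  shows "sn_pairing N j k \<ge> 0"
  using sn_pairing_eq[OF assms] by simp

text \<open>Both factors change sign under k -> k + 4N, so the product has period 4N; for k between
  0 and 4N neither factor is negative.\<close>

lemma sn_pairing_sgn:
  assumes "N > 0" "0 < j" "j < 4 * int N"
  shows "sn_pairing N j k * sn N k \<ge> 0"
proof -
  define r where "r = k mod (4 * int N)"
  have r: "0 \<le> r" "r < 4 * int N" using assms(1) by (simp_all add: r_def)
  have k: "k = r + 4 * int N * (k div (4 * int N))" by (simp add: r_def)
  have "sn_pairing N j (r + 4 * int N * t) * sn N (r + 4 * int N * t) = sn_pairing N j r * sn N r" for t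
  proof -
    have step: "sn_pairing N j (x + 4 * int N) * sn N (x + 4 * int N) = sn_pairing N j x * sn N x" for x
    proof -
      have "cos_sum N (j - (x + 4 * int N)) = - cos_sum N (j - x)"
        using cos_sum_shift[OF assms(1), of "j - (x + 4 * int N)"] by simp
      moreover have "cos_sum N (j + (x + 4 * int N)) = - cos_sum N (j + x)"
        using cos_sum_shift[OF assms(1), of "j + x"] by (simp add: algebra_simps)
      ultimately show ?thesis using sn_shift_half[OF assms(1), of x] by (simp add: sn_pairing_def field_simps)
    qed
    show ?thesis
    proof (induction t rule: int_induct[of _ 0])
      case (step1 i)
      then show ?case using step[of "r + 4 * int N * i"] by (simp add: algebra_simps)
    next
      case (step2 i)
      then show ?case using step[of "r + 4 * int N * (i - 1)"] by (simp add: algebra_simps)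
    qed simp
  qed
  then have "sn_pairing N j k * sn N k = sn_pairing N j r * sn N r" using k by metis
  moreover have "sn_pairing N j r * sn N r \<ge> 0"
    using sn_pairing_nonneg[of N j r] sn_pos[of r N] assms r by (cases "r = 0") auto
  ultimately show ?thesis by simp
qed

lemma sn_orth_pairing:
  assumes "N > 0"
  shows "(\<Sum>e<2 * N. sn N (j * (2 * int e + 1)) * sn N (k * (2 * int e + 1))) = sn_pairing N j k"
  using sn_orth[OF assms] by (simp add: sn_pairing_def)

text \<open>An odd square is 8p + 1, and multiplying ml = 1 by m gives m - l = 8lp modulo 16. Hence
  the parity of p decides, and it depends only on m modulo 8. The resulting sign is the Jacobi
  symbol of 2 over m.\<close>

lemma inv_mod_16:
  fixes m l :: int
  assumes "[m * l = 1] (mod 16)"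
  shows "[m = l] (mod 8)"
    and "[m = 1] (mod 8) \<or> [m = 7] (mod 8) \<Longrightarrow> [m = l] (mod 16)"
    and "[m = 3] (mod 8) \<Longrightarrow> [m = l + 8] (mod 16)"
proof -
  obtain t where t: "m * l = 1 + 16 * t" using assms by (metis cong_iff_lin cong_sym)
  then have "odd (m * l)" by simp
  then have odds: "odd m" "odd l" by simp_all
  obtain q where q: "m = 2 * q + 1" using odds(1) by (rule oddE)
  have "even (q * (q + 1))" by simp
  then obtain p where p: "q * (q + 1) = 2 * p" by (rule dvdE)
  have m2: "m * m = 8 * p + 1"
  proof -
    have "m * m = 4 * (q * (q + 1)) + 1" unfolding q by (simp add: algebra_simps)
    then show ?thesis unfolding p by simp
  qed
  have *: "l * (m * m) = m + 16 * (t * m)"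
  proof -
    have "l * (m * m) = (m * l) * m" by simp
    then show ?thesis unfolding t by (simp add: algebra_simps)
  qed
  have "m - l = 8 * (l * p - 2 * t * m)" using * unfolding m2 by (simp add: algebra_simps)
  then show "[m = l] (mod 8)" unfolding cong_iff_dvd_diff by simp
  {
    assume "[m = 1] (mod 8) \<or> [m = 7] (mod 8)"
    then have "8 dvd 2 * q \<or> 8 dvd 2 * (q - 3)" unfolding q cong_iff_dvd_diff by simp
    then have "even p"
    proof (elim disjE dvdE)
      fix u assume "2 * q = 8 * u"
      then have "q = 4 * u" by simp
      then have "p = 2 * (u * (4 * u + 1))" using p by simp
      then show ?thesis by simp
    next
      fix u assume "2 * (q - 3) = 8 * u"
      then have "q = 4 * u + 3" by simp
      then have "p = 2 * ((u + 1) * (4 * u + 3))" using p by (simp add: algebra_simps)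
      then show ?thesis by simp
    qed
    then obtain v where "p = 2 * v" by auto
    then have "m - l = 16 * (l * v - t * m)" using * unfolding m2 by (simp add: algebra_simps)
    then show "[m = l] (mod 16)" unfolding cong_iff_dvd_diff by simp
  }
  {
    assume "[m = 3] (mod 8)"
    then have "8 dvd 2 * (q - 1)" unfolding q cong_iff_dvd_diff by simp
    then obtain u where "2 * (q - 1) = 8 * u" by (rule dvdE)
    then have "q = 4 * u + 1" by simp
    then have "p = 2 * (4 * u * u + 3 * u) + 1" using p by (simp add: algebra_simps)
    then have "odd p" by simp
    then have "odd (l * p)" using odds by simp
    then obtain v where "l * p = 2 * v + 1" by (rule oddE)
    then have "m - (l + 8) = 16 * (v - t * m)" using * unfolding m2 by (simp add: algebra_simps)
    then show "[m = l + 8] (mod 16)" unfolding cong_iff_dvd_diff by simp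
  }
qed

section \<open>Matrices commuting with the modular data\<close>

lemma commute_on_mult:
  assumes "finite A" "commute_on A M X" "commute_on A M Y"
  shows "commute_on A M (\<lambda>i j. \<Sum>k\<in>A. X i k * Y k j)"
  unfolding commute_on_def
proof (intro ballI)
  fix i j assume ij: "i \<in> A" "j \<in> A"
  have X: "(\<Sum>u\<in>A. M i u * X u k) = (\<Sum>u\<in>A. X i u * M u k)" if "k \<in> A" for k
    using assms(2) ij(1) that unfolding commute_on_def by blast
  have Y: "(\<Sum>k\<in>A. M u k * Y k j) = (\<Sum>k\<in>A. Y u k * M k j)" if "u \<in> A" for u
    using assms(3) ij(2) that unfolding commute_on_def by blast
  have "(\<Sum>u\<in>A. M i u * (\<Sum>k\<in>A. X u k * Y k j)) = (\<Sum>k\<in>A. (\<Sum>u\<in>A. M i u * X u k) * Y k j)"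
    unfolding sum_distrib_left sum_distrib_right by (subst sum.swap) (simp only: mult.assoc)
  also have "\<dots> = (\<Sum>k\<in>A. (\<Sum>u\<in>A. X i u * M u k) * Y k j)"
    by (intro sum.cong refl) (simp only: X)
  also have "\<dots> = (\<Sum>u\<in>A. X i u * (\<Sum>k\<in>A. M u k * Y k j))"
    unfolding sum_distrib_left sum_distrib_right by (subst sum.swap) (simp only: mult.assoc)
  also have "\<dots> = (\<Sum>u\<in>A. X i u * (\<Sum>k\<in>A. Y u k * M k j))"
    by (intro sum.cong refl) (simp only: Y)
  also have "\<dots> = (\<Sum>k\<in>A. (\<Sum>u\<in>A. X i u * Y u k) * M k j)"
    unfolding sum_distrib_left sum_distrib_right by (subst sum.swap) (simp only: mult.assoc)
  finally show "(\<Sum>u\<in>A. M i u * (\<Sum>k\<in>A. X u k * Y k j)) = (\<Sum>k\<in>A. (\<Sum>u\<in>A. X i u * Y u k) * M k j)" .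
qed

text \<open>Here f and g stand for diagonal matrices; constancy along the support of M says that
  they commute with M. Powers of T are of this kind.\<close>

lemma commute_on_scale:
  assumes X: "commute_on A M X"
    and f: "\<And>i j. i \<in> A \<Longrightarrow> j \<in> A \<Longrightarrow> M i j \<noteq> 0 \<Longrightarrow> f i = f j"
    and g: "\<And>i j. i \<in> A \<Longrightarrow> j \<in> A \<Longrightarrow> M i j \<noteq> 0 \<Longrightarrow> g i = g j"
  shows "commute_on A M (\<lambda>i j. f i * X i j * g j)"
  unfolding commute_on_def
proof (intro ballI)
  fix i j assume ij: "i \<in> A" "j \<in> A"
  have F: "M i u * (f u * X u j * g j) = f i * (M i u * X u j) * g j" if "u \<in> A" for u
    using f[OF ij(1) that] by (cases "M i u = 0") simp_all
  have G: "f i * (X i u * M u j) * g j = f i * X i u * g u * M u j" if "u \<in> A" for u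
    using g[OF that ij(2)] by (cases "M u j = 0") simp_all
  have "(\<Sum>u\<in>A. M i u * (f u * X u j * g j)) = (\<Sum>u\<in>A. f i * (M i u * X u j) * g j)"
    by (intro sum.cong refl F)
  also have "\<dots> = f i * (\<Sum>u\<in>A. M i u * X u j) * g j"
    by (simp only: sum_distrib_left sum_distrib_right)
  also have "\<dots> = f i * (\<Sum>u\<in>A. X i u * M u j) * g j"
    using X ij unfolding commute_on_def by simp
  also have "\<dots> = (\<Sum>u\<in>A. f i * (X i u * M u j) * g j)"
    by (simp only: sum_distrib_left sum_distrib_right)
  also have "\<dots> = (\<Sum>u\<in>A. f i * X i u * g u * M u j)"
    by (intro sum.cong refl G)
  finally show "(\<Sum>u\<in>A. M i u * (f u * X u j * g j)) = (\<Sum>u\<in>A. f i * X i u * g u * M u j)" .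
qed

text \<open>With $N = r + 1$, the weights with even $\lambda_r$ are numbered by the odd $A < 4N$, where
  $A \mapsto 4N - A$ is $J_b$, and those with odd $\lambda_r$ by the even $B$ from $2N$ to $4N$.
  The numbers $2N$ and $4N$ stand for $2\Lambda_0 + \Lambda_r$ and $2\Lambda_1 + \Lambda_r$, which
  are exchanged by $J_b$ and share the angle $2N$; $J_b$ fixes the other even numbers. Up to
  constants, $S$ is $\sin\frac{\pi A C}{4N}$ and $T$ is $\exp\frac{\pi \mathrm{i}\,t}{8N}$ with
  $t$ given by \<open>T_exp\<close>.\<close>
definition Od :: "nat \<Rightarrow> nat set" where
  "Od N = {A. odd A \<and> A < 4 * N}"

definition Ev :: "nat \<Rightarrow> nat set" where
  "Ev N = {B. even B \<and> 2 * N \<le> B \<and> B \<le> 4 * N}"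

definition ang :: "nat \<Rightarrow> nat \<Rightarrow> int" where
  "ang N B = (if B = 4 * N then 2 * int N else int B)"

text \<open>Row 0 of \<open>mixed_sines\<close> has twice the squared norm of the other rows, so the
  minors belonging to it carry a factor 1/2. The index 4N comes from the same row, with J_b
  applied.\<close>

definition wgt :: "nat \<Rightarrow> nat \<Rightarrow> real" where
  "wgt N B = (if B = 2 * N \<or> B = 4 * N then 1 / 2 else 1)"

text \<open>The constant 3N(2N - 1) is the offset between integral and half-integral coordinates
  that is left after the common phase \<open>T_angle\<close> has been split off.\<close>

definition T_exp :: "nat \<Rightarrow> nat \<Rightarrow> int" where
  "T_exp N i = (if odd i then - (int i)\<^sup>2 else 3 * int N * (2 * int N - 1) - (ang N i)\<^sup>2)"

lemma T_exp_Od: "A \<in> Od N \<Longrightarrow> T_exp N A = - (int A)\<^sup>2"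
  by (simp add: T_exp_def Od_def)

lemma T_exp_Ev: "B \<in> Ev N \<Longrightarrow> T_exp N B = 3 * int N * (2 * int N - 1) - (ang N B)\<^sup>2"
  by (simp add: T_exp_def Ev_def)

lemma finite_Od [simp]: "finite (Od N)"
  by (rule finite_subset[of _ "{..<4 * N}"]) (auto simp: Od_def)

lemma finite_Ev [simp]: "finite (Ev N)"
  by (rule finite_subset[of _ "{..4 * N}"]) (auto simp: Ev_def)

lemma Od_Ev_disjoint [simp]: "Od N \<inter> Ev N = {}"
  by (auto simp: Od_def Ev_def)

lemma sum_Od: "(\<Sum>A\<in>Od N. F A) = (\<Sum>e<2 * N. F (2 * e + 1))"
  by (rule sum.reindex_bij_witness[of _ "\<lambda>e. 2 * e + 1" "\<lambda>A. A div 2"]) (auto simp: Od_def elim!: oddE)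

lemma sum_Od_int: "(\<Sum>A\<in>Od N. F (int A)) = (\<Sum>b\<in>{0..<2 * int N}. F (2 * b + 1))"
  by (rule sum.reindex_bij_witness[of _ "\<lambda>b. nat (2 * b + 1)" "\<lambda>A. int (A div 2)"]) (auto simp: Od_def even_nat_iff add.commute elim!: oddE)

lemma Ev_split: "N > 0 \<Longrightarrow> Ev N = insert (2 * N) (insert (4 * N) {B. even B \<and> 2 * N < B \<and> B < 4 * N})"
  by (auto simp: Ev_def)

lemma sum_Ev:
  fixes G :: "nat \<Rightarrow> 'a :: comm_monoid_add"
  assumes "N > 0"
  shows "(\<Sum>B\<in>Ev N. G B) = G (2 * N) + (G (4 * N) + (\<Sum>B | even B \<and> 2 * N < B \<and> B < 4 * N. G B))"
  unfolding Ev_split[OF assms] using assms finite_subset[of "{B. even B \<and> 2 * N < B \<and> B < 4 * N}" "{..4 * N}"]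
  by (subst sum.insert, auto)+

text \<open>Under 2b -> 4N - 2b the even numbers below 4N fold onto those from 2N on, with 0
  contributing nothing. The fixed point 2N is shared by the indices 2N and 4N, whose squared weights
  1/4 + 1/4 provide exactly the half that is due.\<close>

lemma sum_Ev_int:
  fixes F :: "int \<Rightarrow> complex"
  assumes N: "N > 0" and F0: "F 0 = 0" and sym: "\<And>b. F (4 * int N - 2 * b) = F (2 * b)"
  shows "(\<Sum>B\<in>Ev N. (of_real (wgt N B))\<^sup>2 * F (ang N B)) = (\<Sum>b\<in>{0..<2 * int N}. F (2 * b)) / 2"
proof -
  have *: "(\<Sum>B | even B \<and> 2 * N < B \<and> B < 4 * N. F (ang N B)) = (\<Sum>b\<in>{int N<..<2 * int N}. F (2 * b))"
    by (rule sum.reindex_bij_witness[of _ "\<lambda>b. nat (2 * b)" "\<lambda>B. int (B div 2)"]) (auto simp: ang_def even_nat_iff elim!: evenE)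
  have mirror: "(\<Sum>b\<in>{0<..<int N}. F (2 * b)) = (\<Sum>b\<in>{int N<..<2 * int N}. F (2 * b))"
    by (rule sum.reindex_bij_witness[of _ "\<lambda>b. 2 * int N - b" "\<lambda>b. 2 * int N - b"]) (auto simp: sym right_diff_distrib)
  have split: "{0..<2 * int N} = insert 0 (insert (int N) ({0<..<int N} \<union> {int N<..<2 * int N}))"
    using N by auto
  have "(\<Sum>b\<in>{0..<2 * int N}. F (2 * b)) = F (2 * int N) + 2 * (\<Sum>b\<in>{int N<..<2 * int N}. F (2 * b))"
    unfolding split using N by (simp add: F0 sum.union_disjoint mirror)
  moreover have "(\<Sum>B\<in>Ev N. (of_real (wgt N B))\<^sup>2 * F (ang N B)) =
     F (2 * int N) / 2 + (\<Sum>B | even B \<and> 2 * N < B \<and> B < 4 * N. F (ang N B))"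
  proof -
    have "(\<Sum>B | even B \<and> 2 * N < B \<and> B < 4 * N. (of_real (wgt N B))\<^sup>2 * F (ang N B)) = (\<Sum>B | even B \<and> 2 * N < B \<and> B < 4 * N. F (ang N B))"
      by (intro sum.cong) (auto simp: wgt_def)
    then show ?thesis unfolding sum_Ev[OF N] using N by (simp add: wgt_def ang_def power2_eq_square)
  qed
  ultimately show ?thesis by (simp add: * add_divide_distrib)
qed

text \<open>An abstract copy of S indexed by numbers. The constants enter through
  \<open>k1 \<noteq> 0\<close> and \<open>k2\<^sup>2 = 2 * k1\<^sup>2\<close>, the block on
  \<open>Ev\<close> through its zeros and its sign pattern on the pair 2N, 4N.\<close>

locale modular_data =
  fixes N :: nat and S :: "nat \<Rightarrow> nat \<Rightarrow> complex" and k1 k2 :: complex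
  assumes N4: "N \<ge> 4" and k1: "k1 \<noteq> 0" and k2: "k2\<^sup>2 = 2 * k1\<^sup>2"
    and S_sym: "i \<in> Od N \<union> Ev N \<Longrightarrow> j \<in> Od N \<union> Ev N \<Longrightarrow> S i j = S j i"
    and S_oo: "A \<in> Od N \<Longrightarrow> C \<in> Od N \<Longrightarrow> S A C = k1 * of_real (sn N (int A * int C))"
    and S_oe: "A \<in> Od N \<Longrightarrow> B \<in> Ev N \<Longrightarrow> S A B = k2 * of_real (wgt N B * sn N (int A * ang N B))"
    and S_ee: "B \<in> Ev N \<Longrightarrow> B' \<in> Ev N \<Longrightarrow> B \<notin> {2 * N, 4 * N} \<Longrightarrow> S B B' = 0"
    and S_sigma: "S (2 * N) (4 * N) = - S (2 * N) (2 * N)" "S (4 * N) (4 * N) = S (2 * N) (2 * N)"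
begin

abbreviation "I \<equiv> Od N \<union> Ev N"

definition invariant :: "(nat \<Rightarrow> nat \<Rightarrow> nat) \<Rightarrow> bool" where
  "invariant n \<longleftrightarrow> commute_on I (\<lambda>i j. of_nat (n i j)) S \<and>
     (\<forall>i\<in>I. \<forall>j\<in>I. n i j \<noteq> 0 \<longrightarrow> ph N (T_exp N i) = ph N (T_exp N j)) \<and> n 1 1 = 1"

lemma N0: "N > 0" using N4 by simp

lemma k2_nz: "k2 \<noteq> 0" using k1 k2 by auto

lemma sum_I: "(\<Sum>i\<in>I. f i) = (\<Sum>i\<in>Od N. f i) + (\<Sum>i\<in>Ev N. f i)"
  by (rule sum.union_disjoint) simp_all

lemma S_eo: "A \<in> Od N \<Longrightarrow> B \<in> Ev N \<Longrightarrow> S B A = k2 * of_real (wgt N B * sn N (int A * ang N B))"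
  using S_sym[of B A] S_oe by simp

text \<open>Symmetry of S; it supplies the column version of every statement about rows.\<close>

lemma invariant_transpose:
  assumes "invariant n"
  shows "invariant (\<lambda>i j. n j i)"
proof -
  have "commute_on I (\<lambda>i j. of_nat (n j i)) S"
    unfolding commute_on_def
  proof (intro ballI)
    fix i j assume ij: "i \<in> I" "j \<in> I"
    have "(\<Sum>u\<in>I. of_nat (n u i) * S u j) = (\<Sum>u\<in>I. S j u * of_nat (n u i))"
      using S_sym ij by (intro sum.cong refl) (simp only: mult.commute)
    also have "\<dots> = (\<Sum>u\<in>I. of_nat (n j u) * S u i)"
      using assms ij unfolding invariant_def commute_on_def by metis
    also have "\<dots> = (\<Sum>u\<in>I. S i u * of_nat (n j u))"
      using S_sym ij by (intro sum.cong refl) (simp only: mult.commute)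
    finally show "(\<Sum>u\<in>I. of_nat (n u i) * S u j) = (\<Sum>u\<in>I. S i u * of_nat (n j u))" .
  qed
  then show ?thesis using assms unfolding invariant_def by auto
qed

text \<open>A row of the even block is supported on the pair 2N, 4N and takes opposite values there,
  so it annihilates whatever is symmetric in the pair.\<close>

lemma sum_Ev_S_zero:
  assumes "B \<in> Ev N" "G (2 * N) = G (4 * N)"
  shows "(\<Sum>k\<in>Ev N. S B k * G k) = 0"
proof (cases "B \<in> {2 * N, 4 * N}")
  case True
  have "S B k = 0" if "even k" "2 * N < k" "k < 4 * N" for k
  proof -
    have "k \<in> Ev N" "k \<notin> {2 * N, 4 * N}" using that by (auto simp: Ev_def)
    then show ?thesis using S_ee[of k B] S_sym[of B k] assms(1) by simp
  qed
  moreover have "S (4 * N) (2 * N) = S (2 * N) (4 * N)" by (rule S_sym) (auto simp: Ev_def)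
  moreover have "S B (4 * N) = - S B (2 * N)"
    using True S_sigma calculation(2) by (elim insertE emptyE) (simp_all only: minus_minus)
  ultimately show ?thesis unfolding sum_Ev[OF N0] assms(2) by (simp add: sum.neutral)
next
  case False
  then show ?thesis using S_ee[OF assms(1)] by (intro sum.neutral) auto
qed

definition T_shift :: int where "T_shift = 3 * int N * (2 * int N - 1)"

text \<open>The product $T^m S T^l S T^m$. For $ml \equiv 1$ modulo $16N$, completing squares turns its rows
  into rows of $S$ with index multiplied by $m$. This replaces the Galois action on $S$.\<close>
definition W :: "int \<Rightarrow> int \<Rightarrow> nat \<Rightarrow> nat \<Rightarrow> complex" where
  "W m l i j = ph N (m * T_exp N i) * (\<Sum>k\<in>I. S i k * (ph N (l * T_exp N k) * S k j * 1)) * ph N (m * T_exp N j)"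

lemma W_commute:
  assumes "invariant n"
  shows "commute_on I (\<lambda>i j. of_nat (n i j)) (W m l)"
proof -
  have S: "commute_on I (\<lambda>i j. of_nat (n i j)) S" using assms unfolding invariant_def by simp
  have t: "ph N (c * T_exp N i) = ph N (c * T_exp N j)" if "i \<in> I" "j \<in> I" "of_nat (n i j) \<noteq> (0::complex)" for c i j
  proof -
    have "ph N (T_exp N i) = ph N (T_exp N j)" using assms that unfolding invariant_def by simp
    then show ?thesis unfolding ph_eq_iff[OF N0] by (rule cong_scalar_left)
  qed
  \<comment> \<open>The factor 1 in \<open>W\<close> stands for the right diagonal factor g of
    \<open>commute_on_scale\<close>.\<close>
  have "commute_on I (\<lambda>i j. of_nat (n i j)) (\<lambda>k j. ph N (l * T_exp N k) * S k j * 1)"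
    by (rule commute_on_scale[OF S, where f = "\<lambda>k. ph N (l * T_exp N k)" and g = "\<lambda>_. 1"]) (auto intro: t)
  then show ?thesis
    unfolding W_def by (intro commute_on_scale commute_on_mult S t) auto
qed

lemma W_sym:
  assumes "i \<in> I" "j \<in> I"
  shows "W m l i j = W m l j i"
proof -
  have "(\<Sum>k\<in>I. S i k * (ph N (l * T_exp N k) * S k j * 1)) = (\<Sum>k\<in>I. S j k * (ph N (l * T_exp N k) * S k i * 1))"
    using S_sym assms by (intro sum.cong refl) (simp add: mult_ac)
  then show ?thesis unfolding W_def by (simp add: mult_ac)
qed

text \<open>Odd intermediate indices cancel in pairs k, 4N - k: the sines agree, but the exponents
  of T differ by an odd multiple of 8N. Even ones give \<open>sum_sn_gauss\<close> with offset 0;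
  the factor 2 in \<open>k2\<close> cancels the half from folding. Only the intermediate index is
  even, so the constant of T enters with exponent l.\<close>

lemma W_oo:
  assumes "[m * l = 1] (mod (16 * int N))" "odd m" "A \<in> Od N" "C \<in> Od N"
  shows "W m l A C = - \<i> * gauss_sum N l * k1 * ph N (l * T_shift) * (k1 * of_real (sn N (m * int A * int C)))"
proof -
  have AC: "odd (int A)" "odd (int C)" using assms(3,4) by (simp_all add: Od_def)
  have "odd (m * l)"
    using assms(1) by (metis cong_dvd_iff cong_dvd_modulus dvd_mult2 even_numeral odd_one)
  then have ol: "odd l" by simp
  have o: "(\<Sum>k\<in>Od N. S A k * (ph N (l * T_exp N k) * S k C * 1)) = 0"
  proof -
    let ?f = "\<lambda>k. S A k * (ph N (l * T_exp N k) * S k C * 1)"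
    have "?f (4 * N - k) = - ?f k" if k: "k \<in> Od N" for k
    proof -
      have "k > 0" using k by (auto simp: Od_def odd_pos)
      then have k': "4 * N - k \<in> Od N" and le: "k \<le> 4 * N" using k by (auto simp: Od_def)
      have ok: "odd (int k)" using k by (simp add: Od_def)
      have "ph N (l * T_exp N (4 * N - k)) = - ph N (l * T_exp N k)"
      proof -
        obtain t where t: "l * int k = 2 * t + 1" using ol ok by (metis even_mult_iff oddE)
        have "l * T_exp N (4 * N - k) = l * T_exp N k + (8 * int N * (l * int k) - 16 * int N * (l * int N))"
          using k k' le by (simp add: T_exp_def Od_def of_nat_diff power2_eq_square algebra_simps)
        also have "\<dots> = l * T_exp N k + 8 * int N + 16 * int N * (t - l * int N)"
          unfolding t by (simp add: algebra_simps)
        finally have "ph N (l * T_exp N (4 * N - k)) = ph N (l * T_exp N k + 8 * int N)"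
          by (rule ph_eqI[OF N0])
        also have "\<dots> = - ph N (l * T_exp N k)"
        proof -
          have "ph N (8 * int N) = - 1" using N0 by (simp add: ph_def complex_eq_iff)
          then show ?thesis by (simp add: ph_add)
        qed
        finally show ?thesis .
      qed
      moreover have "S A (4 * N - k) = S A k" "S (4 * N - k) C = S k C"
        unfolding S_oo[OF assms(3) k'] S_oo[OF k' assms(4)] S_oo[OF assms(3) k] S_oo[OF k assms(4)]
        using sn_fold[OF N0 AC(1), of "int k"] sn_fold[OF N0 AC(2), of "int k"] le
        by (simp_all add: of_nat_diff mult.commute)
      ultimately show ?thesis by simp
    qed
    moreover have "(\<Sum>k\<in>Od N. ?f k) = (\<Sum>k\<in>Od N. ?f (4 * N - k))"
      by (rule sum.reindex_bij_witness[of _ "\<lambda>k. 4 * N - k" "\<lambda>k. 4 * N - k"]) (auto simp: Od_def odd_pos)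
    ultimately show ?thesis by (simp add: sum_negf)
  qed
  have e: "(\<Sum>k\<in>Ev N. S A k * (ph N (l * T_exp N k) * S k C * 1)) =
     k1\<^sup>2 * ph N (l * T_shift) * sine_gauss N l 0 (int A) (int C)"
  proof -
    let ?F = "\<lambda>x. complex_of_real (sn N (int A * x)) * of_real (sn N (x * int C)) * ph N (- l * x\<^sup>2)"
    have "S A k * (ph N (l * T_exp N k) * S k C * 1) = k2\<^sup>2 * ph N (l * T_shift) * ((of_real (wgt N k))\<^sup>2 * ?F (ang N k))"
      if k: "k \<in> Ev N" for k
    proof -
      have "ph N (l * T_exp N k) = ph N (l * T_shift) * ph N (- l * (ang N k)\<^sup>2)"
        using k by (simp add: T_exp_Ev T_shift_def right_diff_distrib flip: ph_add)
      then show ?thesis using k by (simp add: S_oe S_eo assms power2_eq_square mult_ac)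
    qed
    then have "(\<Sum>k\<in>Ev N. S A k * (ph N (l * T_exp N k) * S k C * 1))
      = k2\<^sup>2 * ph N (l * T_shift) * (\<Sum>k\<in>Ev N. (of_real (wgt N k))\<^sup>2 * ?F (ang N k))"
      by (simp only: sum_distrib_left cong: sum.cong)
    also have "(\<Sum>k\<in>Ev N. (of_real (wgt N k))\<^sup>2 * ?F (ang N k)) = (\<Sum>b\<in>{0..<2 * int N}. ?F (2 * b)) / 2"
    proof (rule sum_Ev_int[OF N0])
      fix b
      have "ph N (- l * (4 * int N - 2 * b)\<^sup>2) = ph N (- l * (2 * b)\<^sup>2)"
        by (rule ph_eqI[OF N0, of _ _ "l * (b - int N)"]) (simp add: power2_eq_square algebra_simps)
      moreover have "sn N (int A * (4 * int N - 2 * b)) = sn N (int A * (2 * b))"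
        "sn N ((4 * int N - 2 * b) * int C) = sn N ((2 * b) * int C)"
        using sn_fold[OF N0 AC(1), of "2 * b"] sn_fold[OF N0 AC(2), of "2 * b"] by (simp_all only: mult.commute)
      ultimately show "?F (4 * int N - 2 * b) = ?F (2 * b)" by (simp only:)
    qed simp
    finally show ?thesis by (simp add: k2 sine_gauss_def)
  qed
  have ev: "even (int A + int C - 0)" using AC by simp
  have tA: "T_exp N A = - (int A)\<^sup>2" "T_exp N C = - (int C)\<^sup>2" using AC by (simp_all add: T_exp_def)
  have "W m l A C = k1\<^sup>2 * ph N (l * T_shift) * (ph N (- m * (int A)\<^sup>2) * sine_gauss N l 0 (int A) (int C) * ph N (- m * (int C)\<^sup>2))"
    unfolding W_def sum_I o e tA by (simp add: mult_ac)
  also have "\<dots> = - \<i> * gauss_sum N l * k1 * ph N (l * T_shift) * (k1 * of_real (sn N (m * int A * int C)))"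
    unfolding sum_sn_gauss[OF N0 assms(1,2) ev] by (simp add: power2_eq_square mult_ac)
  finally show ?thesis .
qed

text \<open>Now the even intermediate indices cancel by \<open>sum_Ev_S_zero\<close> and the odd
  ones give offset 1. The constant of T enters through the outer index, hence with exponent m
  instead of l; comparing this with \<open>W_oo\<close> produces the sign \<chi>.\<close>

lemma W_eo:
  assumes "[m * l = 1] (mod (16 * int N))" "odd m" "B \<in> Ev N" "C \<in> Od N"
  shows "W m l B C = - \<i> * gauss_sum N l * k1 * ph N (m * T_shift) * (k2 * of_real (wgt N B * sn N (m * ang N B * int C)))"
proof -
  have BC: "even (ang N B)" "odd (int C)" using assms(3,4) by (simp_all add: Od_def Ev_def ang_def)
  have e: "(\<Sum>k\<in>Ev N. S B k * (ph N (l * T_exp N k) * S k C * 1)) = 0"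
    by (rule sum_Ev_S_zero[OF assms(3)])
       (use N0 in \<open>simp add: T_exp_def ang_def S_eo assms Ev_def wgt_def\<close>)
  have o: "(\<Sum>k\<in>Od N. S B k * (ph N (l * T_exp N k) * S k C * 1)) =
     k1 * k2 * of_real (wgt N B) * sine_gauss N l 1 (ang N B) (int C)"
  proof -
    let ?F = "\<lambda>x. complex_of_real (sn N (ang N B * x)) * of_real (sn N (x * int C)) * ph N (- l * x\<^sup>2)"
    have "S B k * (ph N (l * T_exp N k) * S k C * 1) = k1 * k2 * of_real (wgt N B) * ?F (int k)"
      if k: "k \<in> Od N" for k
      using k by (simp add: S_oo S_eo assms T_exp_Od mult_ac)
    then have "(\<Sum>k\<in>Od N. S B k * (ph N (l * T_exp N k) * S k C * 1))
      = k1 * k2 * of_real (wgt N B) * (\<Sum>k\<in>Od N. ?F (int k))"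
      by (simp only: sum_distrib_left cong: sum.cong)
    then show ?thesis unfolding sum_Od_int[of ?F] sine_gauss_def .
  qed
  have ev: "even (ang N B + int C - 1)" using BC by simp
  have t: "ph N (m * T_exp N C) = ph N (- m * (int C)\<^sup>2)" "ph N (m * T_exp N B) = ph N (m * T_shift) * ph N (- m * (ang N B)\<^sup>2)"
    using assms(3,4) by (simp_all add: T_exp_Ev T_exp_Od T_shift_def right_diff_distrib flip: ph_add)
  have "W m l B C = k1 * k2 * of_real (wgt N B) * ph N (m * T_shift) * (ph N (- m * (ang N B)\<^sup>2) * sine_gauss N l 1 (ang N B) (int C) * ph N (- m * (int C)\<^sup>2))"
    unfolding W_def sum_I o e t by (simp add: mult_ac)
  also have "\<dots> = - \<i> * gauss_sum N l * k1 * ph N (m * T_shift) * (k2 * of_real (wgt N B * sn N (m * ang N B * int C)))"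
    unfolding sum_sn_gauss[OF N0 assms(1,2) ev] by (simp add: mult_ac)
  finally show ?thesis .
qed

end

section \<open>Sign rules for the entries of an invariant, and the rows of 0 and J_b 0\<close>

context modular_data
begin

lemma Od_bounds: "A \<in> Od N \<Longrightarrow> 0 < int A \<and> int A < 4 * int N \<and> odd (int A)"
  by (auto simp: Od_def odd_pos)

lemma Ev_bounds: "B \<in> Ev N \<Longrightarrow> 2 * int N \<le> ang N B \<and> 0 < ang N B \<and> ang N B < 4 * int N \<and> even (ang N B)"
  using N0 by (auto simp: Ev_def ang_def)

lemma wgt_pos: "wgt N B > 0"
  by (simp add: wgt_def)

text \<open>By \<open>inv_mod_16\<close>, m - l = 8q, and \<open>T_shift\<close> is N times the
  factor 3(2N - 1), which is odd. So the quotient of the two phases is the sign of the parity of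
  q.\<close>

lemma T_shift_sign:
  assumes "[m * l = 1] (mod (16 * int N))"
  obtains \<chi> :: real where "\<chi> = 1 \<or> \<chi> = - 1" "ph N (m * T_shift) = of_real \<chi> * ph N (l * T_shift)"
    "odd N \<Longrightarrow> [m = 1] (mod 8) \<or> [m = 7] (mod 8) \<Longrightarrow> \<chi> = 1"
    "odd N \<Longrightarrow> [m = 3] (mod 8) \<Longrightarrow> \<chi> = - 1"
proof -
  have "[m * l = 1] (mod 16)" using assms by (rule cong_modulus_mult)
  note inv = inv_mod_16[OF this]
  obtain q where q: "m - l = 8 * q" using inv(1) by (auto simp: cong_iff_dvd_diff)
  define \<chi> :: real where "\<chi> = (if even q then 1 else - 1)"
  have p: "ph N (8 * int N * x) = (if even x then 1 else - 1)" for x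
  proof (cases "even x")
    case True
    then obtain y where "x = 2 * y" by auto
    then show ?thesis using ph_period[OF N0, of y] True by (simp add: algebra_simps)
  next
    case False
    then obtain y where y: "x = 2 * y + 1" by (auto elim: oddE)
    have "ph N (8 * int N) = - 1" using N0 by (simp add: ph_def complex_eq_iff)
    moreover have "ph N (8 * int N * x) = ph N (8 * int N)"
      by (rule ph_eqI[OF N0, of _ _ y]) (simp add: y algebra_simps)
    ultimately show ?thesis using False by simp
  qed
  have "m * T_shift = l * T_shift + 8 * int N * (3 * (2 * int N - 1) * q)"
  proof -
    have "m = l + 8 * q" using q by simp
    then show ?thesis by (simp add: T_shift_def algebra_simps)
  qed
  then have "ph N (m * T_shift) = of_real \<chi> * ph N (l * T_shift)"
    by (simp add: ph_add p \<chi>_def)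
  moreover have "\<chi> = 1" if "[m = 1] (mod 8) \<or> [m = 7] (mod 8)"
  proof -
    have "16 dvd 8 * q" using inv(2)[OF that] q by (simp add: cong_iff_dvd_diff)
    then show ?thesis unfolding \<chi>_def by presburger
  qed
  moreover have "\<chi> = - 1" if "[m = 3] (mod 8)"
  proof -
    have "m - (l + 8) = 8 * q - 8" using q by simp
    then have "16 dvd 8 * q - 8" using inv(3)[OF that] by (simp only: cong_iff_dvd_diff)
    then show ?thesis unfolding \<chi>_def by presburger
  qed
  ultimately show ?thesis using that[of \<chi>] by (auto simp: \<chi>_def)
qed

lemma sum_sn_Od: "(\<Sum>E\<in>Od N. sn N (j * int E) * sn N (k * int E)) = sn_pairing N j k"
  using sn_orth_pairing[OF N0, of j k] by (simp add: sum_Od algebra_simps)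

text \<open>Row \<open>a\<close> of $M W = W M$, paired with the sines of frequency \<open>k\<close>; the row of $W$ is a
  multiple of row \<open>c\<close> of $S$.\<close>
lemma row_relation:
  assumes "invariant n" and m: "[m * l = 1] (mod (16 * int N))" "coprime m (2 * int N)"
    and a: "a \<in> Od N"
    and \<chi>: "\<chi> = 1 \<or> \<chi> = - 1" "ph N (m * T_shift) = of_real \<chi> * ph N (l * T_shift)"
  shows "\<exists>c s. c \<in> Od N \<and> (s = 1 \<or> s = (- 1 :: real)) \<and> s * sn N (m * int a) > 0 \<and>
    (\<forall>k. odd k \<longrightarrow> s * (\<Sum>A\<in>Od N. real (n c A) * sn_pairing N (int A) k) = (\<Sum>A\<in>Od N. real (n a A) * sn_pairing N (m * int A) k)) \<and>
    (\<forall>k. even k \<longrightarrow> s * (\<Sum>B\<in>Ev N. real (n c B) * wgt N B * sn_pairing N (ang N B) k) = \<chi> * (\<Sum>B\<in>Ev N. real (n a B) * wgt N B * sn_pairing N (m * ang N B) k))"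
proof -
  have om: "odd m" using m(2) by simp
  have oa: "odd (m * int a)" using om Od_bounds[OF a] by simp
  \<comment> \<open>Up to the sign s, multiplication by m sends the index a to d; this is what the
    Galois automorphism of m does to a row of S.\<close>
  obtain d s where d: "0 < d" "d < 4 * int N" "odd d" "s = 1 \<or> s = - 1" "\<And>x. sn N (m * int a * x) = s * sn N (d * x)"
    using sn_fold_ex[OF N0 oa] by metis
  have spos: "s * sn N (m * int a) > 0" using d(4) d(5)[of 1] sn_pos[OF d(1,2)] by auto
  \<comment> \<open>Passing from d to 4N - d leaves the odd columns of S alone and negates the even
    ones, so a twist \<chi> = -1 is absorbed by applying J_b.\<close>
  define c where "c = (if \<chi> = 1 then nat d else nat (4 * int N - d))"
  have c: "c \<in> Od N" using d(1-3) by (auto simp: c_def Od_def even_nat_iff nat_less_iff)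
  have ic: "int c = (if \<chi> = 1 then d else 4 * int N - d)" using d(1,2) by (simp add: c_def)
  let ?Lo = "\<lambda>E. \<Sum>A\<in>Od N. k1 * of_real (real (n c A) * sn N (int A * int E))"
    and ?Le = "\<lambda>E. \<Sum>B\<in>Ev N. k2 * of_real (real (n c B) * wgt N B * sn N (ang N B * int E))"
    and ?Ro = "\<lambda>E. \<Sum>A\<in>Od N. k1 * of_real (real (n a A) * sn N (m * int A * int E))"
    and ?Re = "\<lambda>E. \<Sum>B\<in>Ev N. k2 * of_real (\<chi> * real (n a B) * wgt N B * sn N (m * ang N B * int E))"
    and ?lo = "\<lambda>k. \<Sum>A\<in>Od N. real (n c A) * sn_pairing N (int A) k"
    and ?le = "\<lambda>k. \<Sum>B\<in>Ev N. real (n c B) * wgt N B * sn_pairing N (ang N B) k"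
    and ?ro = "\<lambda>k. \<Sum>A\<in>Od N. real (n a A) * sn_pairing N (m * int A) k"
    and ?re = "\<lambda>k. \<Sum>B\<in>Ev N. real (n a B) * wgt N B * sn_pairing N (m * ang N B) k"
  define K where "K = - \<i> * gauss_sum N l * k1 * ph N (l * T_shift)"
  have K: "K \<noteq> 0" using gauss_sum_nonzero[OF N0 m(1) om] k1 by (simp add: K_def)
  have Wa: "W m l a u = K * of_real s * S c u" if "u \<in> I" for u
    using that
  proof
    assume A: "u \<in> Od N"
    have "sn N (int c * int u) = sn N (d * int u)"
      using sn_fold[OF N0, of "int u" d] Od_bounds[OF A] by (simp add: ic)
    then show ?thesis unfolding W_oo[OF m(1) om a A] S_oo[OF c A] using d(5) by (simp add: K_def)
  next
    assume B: "u \<in> Ev N"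
    obtain b where b: "ang N u = 2 * b" using Ev_bounds[OF B] by (auto elim: evenE)
    have "sn N (int c * ang N u) = \<chi> * sn N (d * ang N u)"
    proof (cases "\<chi> = 1")
      case False
      have "(4 * int N - d) * ang N u = - (d * ang N u) + 8 * int N * b" unfolding b by (simp add: algebra_simps)
      then have "sn N ((4 * int N - d) * ang N u) = - sn N (d * ang N u)"
        by (simp only: sn_shift[OF N0] sn_uminus)
      then show ?thesis using False \<chi>(1) by (simp add: ic)
    qed (simp add: ic)
    moreover have "W m l a u = W m l u a" by (rule W_sym) (use a B in auto)
    moreover have "sn N (m * ang N u * int a) = s * sn N (d * ang N u)"
      using d(5)[of "ang N u"] by (simp add: mult_ac)
    moreover have "\<chi> * \<chi> = 1" using \<chi>(1) by auto
    ultimately show ?thesis unfolding S_oe[OF c B] using W_eo[OF m(1) om B a]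
      by (simp add: K_def \<chi>(2) mult_ac)
  qed
  \<comment> \<open>Row a of W is a multiple of row c of S, so WM = MW in row a and SM = MS in row c
    can be compared in every odd column E.\<close>
  have eq: "of_real s * ((?Lo E) + (?Le E))
     = (?Ro E) + (?Re E)"
    if E: "E \<in> Od N" for E
  proof -
    have "K * of_real s * (\<Sum>u\<in>I. of_nat (n c u) * S u E) = K * of_real s * (\<Sum>u\<in>I. S c u * of_nat (n u E))"
      using assms(1) c E unfolding invariant_def commute_on_def by simp
    also have "\<dots> = (\<Sum>u\<in>I. W m l a u * of_nat (n u E))"
      unfolding sum_distrib_left by (intro sum.cong refl) (simp add: Wa)
    also have "\<dots> = (\<Sum>u\<in>I. of_nat (n a u) * W m l u E)"
      using W_commute[OF assms(1), of m l] a E unfolding commute_on_def by simp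
    also have "\<dots> = K * ((?Ro E) + (?Re E))"
    proof -
      have "(\<Sum>A\<in>Od N. of_nat (n a A) * W m l A E) = K * (?Ro E)"
        unfolding sum_distrib_left by (intro sum.cong refl) (simp add: W_oo[OF m(1) om _ E] K_def mult_ac)
      moreover have "(\<Sum>B\<in>Ev N. of_nat (n a B) * W m l B E) = K * (?Re E)"
        unfolding sum_distrib_left by (intro sum.cong refl) (simp add: W_eo[OF m(1) om _ E] K_def \<chi>(2) mult_ac)
      ultimately show ?thesis by (simp add: sum_I distrib_left)
    qed
    finally have "of_real s * (\<Sum>u\<in>I. of_nat (n c u) * S u E) = (?Ro E) + (?Re E)"
      using K by simp
    moreover have "(\<Sum>A\<in>Od N. of_nat (n c A) * S A E) = ?Lo E"
      by (intro sum.cong refl) (simp add: S_oo E)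
    moreover have "(\<Sum>B\<in>Ev N. of_nat (n c B) * S B E) = ?Le E"
      by (intro sum.cong refl) (simp add: S_eo E mult.commute[of "int E"])
    ultimately show ?thesis by (simp add: sum_I)
  qed
  \<comment> \<open>Multiplying by the sine of frequency k and summing over the odd columns replaces
    sines by pairings.\<close>
  have test: "of_real s * (k1 * of_real (?lo k) + k2 * of_real (?le k))
    = k1 * of_real (?ro k) + k2 * of_real (\<chi> * (?re k))" for k
  proof -
    have swap: "(\<Sum>E\<in>Od N. (\<Sum>A\<in>X. z * of_real (g A * sn N (h A * int E))) * of_real (sn N (k * int E))) = z * of_real (\<Sum>A\<in>X. g A * sn_pairing N (h A) k)"
      for X :: "nat set" and z :: complex and g h
    proof -
      have "(\<Sum>E\<in>Od N. (\<Sum>A\<in>X. z * of_real (g A * sn N (h A * int E))) * of_real (sn N (k * int E)))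
        = (\<Sum>A\<in>X. \<Sum>E\<in>Od N. z * of_real (g A) * of_real (sn N (h A * int E) * sn N (k * int E)))"
        unfolding sum_distrib_right by (subst sum.swap) (simp add: mult_ac)
      also have "\<dots> = (\<Sum>A\<in>X. z * of_real (g A) * of_real (sn_pairing N (h A) k))"
        by (intro sum.cong refl) (simp only: sum_distrib_left[symmetric] of_real_sum[symmetric] sum_sn_Od)
      finally show ?thesis by (simp add: sum_distrib_left mult_ac)
    qed
    have "(\<Sum>E\<in>Od N. of_real s * ((?Lo E) + (?Le E)) * of_real (sn N (k * int E)))
     = (\<Sum>E\<in>Od N. ((?Ro E) + (?Re E)) * of_real (sn N (k * int E)))"
      by (intro sum.cong refl) (simp only: eq)
    moreover have "(\<Sum>E\<in>Od N. z * (P E + Q E) * t E) = z * ((\<Sum>E\<in>Od N. P E * t E) + (\<Sum>E\<in>Od N. Q E * t E))"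
      "(\<Sum>E\<in>Od N. (P E + Q E) * t E) = (\<Sum>E\<in>Od N. P E * t E) + (\<Sum>E\<in>Od N. Q E * t E)"
      for P Q t and z :: complex
      by (simp_all add: sum_distrib_left sum.distrib algebra_simps)
    ultimately have "of_real s * (k1 * of_real (?lo k) + k2 * of_real (?le k))
      = k1 * of_real (?ro k) + k2 * of_real (\<Sum>B\<in>Ev N. \<chi> * real (n a B) * wgt N B * sn_pairing N (m * ang N B) k)"
      by (simp only: swap)
    then show ?thesis by (simp only: sum_distrib_left mult.assoc)
  qed
  \<comment> \<open>The pairing vanishes between frequencies of different parity, so the parity of k
    isolates one of the two classes.\<close>
  have par: "(\<Sum>B\<in>Ev N. real (n c' B) * wgt N B * sn_pairing N (t * ang N B) k) = 0" if "odd k" for c' t k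
    using that Ev_bounds by (intro sum.neutral ballI) (simp add: sn_pairing_parity)
  have par': "(\<Sum>A\<in>Od N. real (n c' A) * sn_pairing N (t * int A) k) = 0" if "even k" "odd t" for c' t k
    using that Od_bounds by (intro sum.neutral ballI) (simp add: sn_pairing_parity)
  show ?thesis
  proof (intro exI[of _ c] exI[of _ s] conjI allI impI)
    show "c \<in> Od N" "s = 1 \<or> s = - 1" "s * sn N (m * int a) > 0" by fact+
  next
    fix k :: int assume k: "odd k"
    have "s * X = Y" if "of_real s * (k1 * of_real X + k2 * of_real 0) = k1 * of_real Y + k2 * of_real (\<chi> * 0)" for X Y :: real
    proof -
      have "k1 * of_real (s * X) = k1 * of_real Y" using that by (simp add: mult_ac)
      then show ?thesis using k1 by (simp only: mult_cancel_left of_real_eq_iff simp_thms)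
    qed
    from this[OF test[of k, unfolded par[OF k, of c 1, unfolded mult_1] par[OF k, of a m]]]
    show "s * (?lo k) = ?ro k" .
  next
    fix k :: int assume k: "even k"
    have "s * X = \<chi> * Y" if "of_real s * (k1 * of_real 0 + k2 * of_real X) = k1 * of_real 0 + k2 * of_real (\<chi> * Y)" for X Y :: real
    proof -
      have "k2 * of_real (s * X) = k2 * of_real (\<chi> * Y)" using that by (simp add: mult_ac)
      then show ?thesis using k2_nz by (simp only: mult_cancel_left of_real_eq_iff simp_thms)
    qed
    from this[OF test[of k, unfolded par'[OF k odd_one, of c, unfolded mult_1] par'[OF k om, of a]]]
    show "s * (?le k) = \<chi> * (?re k)" .
  qed
qed

text \<open>In a sum of terms of one sign, a nonzero term decides the sign.\<close>
lemma sign_transfer: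
  fixes s :: real
  assumes eq: "s * (\<Sum>A\<in>X. f A * sn_pairing N (h A) k) = \<chi> * (\<Sum>A\<in>X. g A * sn_pairing N (m * h A) k)"
    and X: "finite X" "\<And>A. A \<in> X \<Longrightarrow> 0 < h A \<and> h A < 4 * int N" "\<And>A. f A \<ge> 0" "\<And>A. g A \<ge> 0"
    and k: "k = m * h j" "coprime m (2 * int N)" "j \<in> X" "g j > 0"
    and s: "s = 1 \<or> s = - 1" "\<chi> = 1 \<or> \<chi> = - 1"
  shows "\<chi> * s * sn N k > 0"
proof -
  have hj: "0 < h j" "h j < 4 * int N" using X(2)[OF k(3)] by auto
  have "g j * sn_pairing N (h j) (h j) \<le> (\<Sum>A\<in>X. g A * sn_pairing N (h A) (h j))"
    using X(1,4) k(3) by (rule_tac member_le_sum[of j X "\<lambda>A. g A * sn_pairing N (h A) (h j)"]) (auto intro!: mult_nonneg_nonneg sn_pairing_nonneg N0 simp: X(2) hj)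
  moreover have "g j * sn_pairing N (h j) (h j) > 0" using sn_pairing_eq[OF N0 hj hj] k(4) N0 by simp
  ultimately have "(\<Sum>A\<in>X. g A * sn_pairing N (m * h A) k) > 0" unfolding k(1) sn_pairing_unit[OF k(2)] by simp
  then have pos: "\<chi> * s * (\<Sum>A\<in>X. f A * sn_pairing N (h A) k) > 0" using eq s by (auto simp: mult_less_0_iff zero_less_mult_iff)
  have "(\<Sum>A\<in>X. f A * sn_pairing N (h A) k) * sn N k = (\<Sum>A\<in>X. f A * (sn_pairing N (h A) k * sn N k))"
    by (simp only: sum_distrib_right mult.assoc)
  also have "\<dots> \<ge> 0" using X(2,3) by (intro sum_nonneg mult_nonneg_nonneg sn_pairing_sgn N0) auto
  finally have nn: "(\<Sum>A\<in>X. f A * sn_pairing N (h A) k) * sn N k \<ge> 0" .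
  \<comment> \<open>The inequality \<open>nn\<close> still permits a vanishing sine. That would make
    4N divide k = m h(j), hence h(j) because m is a unit, contrary to 0 < h(j) < 4N.\<close>
  have "sn N k \<noteq> 0"
  proof
    assume z: "sn N k = 0"
    have "4 * int N dvd k"
    proof -
      have "sin (pi * of_int k / (4 * real N)) = 0" using z by (simp add: sn_def)
      then obtain i :: int where "pi * of_int k / (4 * real N) = of_int i * pi" by (auto simp: sin_zero_iff_int2)
      then have "pi * of_int k = pi * of_int (4 * int N * i)" using N0 by (simp add: field_simps)
      then have "real_of_int k = of_int (4 * int N * i)" by (simp only: mult_cancel_left pi_neq_zero simp_thms)
      then have "k = 4 * int N * i" by linarith
      then show ?thesis by simp
    qed
    moreover have "coprime (4 * int N) m"
    proof -
      have "coprime (2 ^ 2) m" using k(2) by (simp only: coprime_power_left_iff) simp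
      then show ?thesis using k(2) by (simp add: coprime_commute)
    qed
    ultimately have "4 * int N dvd h j" unfolding k(1) by (simp add: coprime_dvd_mult_right_iff)
    then show False using hj by (auto dest: zdvd_imp_le)
  qed
  then show ?thesis using pos nn s by (auto simp: zero_less_mult_iff zero_le_mult_iff)
qed

lemma unit_inverse:
  assumes "coprime m (2 * int N)"
  obtains l where "[m * l = 1] (mod (16 * int N))"
proof -
  have "coprime (2 ^ 4) m" using assms by (simp only: coprime_power_left_iff) simp
  then have "coprime m (16 * int N)" using assms by (simp add: coprime_commute)
  then show ?thesis using that cong_solve_coprime_int by blast
qed

text \<open>The parity rule for modular invariants. The row relation, tested at frequency mA, forces
  the sine of mA to have the sign s, which is also the sign of the sine of ma.\<close>

lemma parity_odd:
  assumes "invariant n" "coprime m (2 * int N)" "a \<in> Od N" "A \<in> Od N" "n a A \<noteq> 0"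
  shows "sn N (m * int a) * sn N (m * int A) > 0"
proof -
  obtain l where l: "[m * l = 1] (mod (16 * int N))" using unit_inverse[OF assms(2)] .
  obtain \<chi> :: real where \<chi>: "\<chi> = 1 \<or> \<chi> = - 1" "ph N (m * T_shift) = of_real \<chi> * ph N (l * T_shift)"
    using T_shift_sign[OF l] by metis
  obtain c s where "c \<in> Od N" and s: "s = 1 \<or> s = (- 1 :: real)" "s * sn N (m * int a) > 0"
    and eqo: "\<And>k. odd k \<Longrightarrow> s * (\<Sum>A\<in>Od N. real (n c A) * sn_pairing N (int A) k) = (\<Sum>A\<in>Od N. real (n a A) * sn_pairing N (m * int A) k)"
    and eqe: "\<And>k. even k \<Longrightarrow> s * (\<Sum>B\<in>Ev N. real (n c B) * wgt N B * sn_pairing N (ang N B) k) = \<chi> * (\<Sum>B\<in>Ev N. real (n a B) * wgt N B * sn_pairing N (m * ang N B) k)"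
    using row_relation[OF assms(1) l assms(2,3) \<chi>] by blast
  have "odd (m * int A)" using assms(2) Od_bounds[OF assms(4)] by simp
  then have "s * (\<Sum>x\<in>Od N. real (n c x) * sn_pairing N (int x) (m * int A)) = 1 * (\<Sum>x\<in>Od N. real (n a x) * sn_pairing N (m * int x) (m * int A))"
    unfolding mult_1 by (rule eqo)
  then have "1 * s * sn N (m * int A) > 0"
    using Od_bounds assms(5) s(1) by (intro sign_transfer[OF _ finite_Od _ _ _ refl assms(2,4)]) auto
  then show ?thesis using s by (auto simp: zero_less_mult_iff)
qed

text \<open>As in the odd case, but the relation for even frequencies carries \<chi>, and the sign
  rule inherits it.\<close>

lemma parity_even:
  assumes "invariant n" "coprime m (2 * int N)" "[m * l = 1] (mod (16 * int N))" "a \<in> Od N" "B \<in> Ev N" "n a B \<noteq> 0"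
    and \<chi>: "\<chi> = 1 \<or> \<chi> = - 1" "ph N (m * T_shift) = of_real \<chi> * ph N (l * T_shift)"
  shows "\<chi> * (sn N (m * int a) * sn N (m * ang N B)) > 0"
proof -
  obtain c s where "c \<in> Od N" and s: "s = 1 \<or> s = (- 1 :: real)" "s * sn N (m * int a) > 0"
    and eqo: "\<And>k. odd k \<Longrightarrow> s * (\<Sum>A\<in>Od N. real (n c A) * sn_pairing N (int A) k) = (\<Sum>A\<in>Od N. real (n a A) * sn_pairing N (m * int A) k)"
    and eqe: "\<And>k. even k \<Longrightarrow> s * (\<Sum>B\<in>Ev N. real (n c B) * wgt N B * sn_pairing N (ang N B) k) = \<chi> * (\<Sum>B\<in>Ev N. real (n a B) * wgt N B * sn_pairing N (m * ang N B) k)"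
    using row_relation[OF assms(1,3,2,4) \<chi>] by blast
  have "even (m * ang N B)" using Ev_bounds[OF assms(5)] by simp
  note e = eqe[OF this]
  have "\<chi> * s * sn N (m * ang N B) > 0"
    using Ev_bounds assms(6) s(1) \<chi>(1) wgt_pos less_imp_le[OF wgt_pos]
    by (intro sign_transfer[OF e finite_Ev _ _ _ refl assms(2,5)]) auto
  then show ?thesis using s by (auto simp: zero_less_mult_iff mult_less_0_iff)
qed

text \<open>Here a is 0 or J_b 0. For odd j, T-invariance and the sign rule satisfy
  \<open>parity_rule\<close>, which leaves 1 and 4N - 1; their T exponents differ by an odd multiple
  of 8N and are separated modulo 16N. For even j = 2b or angle 2b the congruence makes N odd and
  excludes b = N, which would force N to divide 1; the rest contradicts
  \<open>parity_rule_spinor\<close>.\<close>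

lemma vacuum_row:
  assumes inv: "invariant n" and a: "a = 1 \<or> a = 4 * N - 1" and j: "j \<in> I" "n a j \<noteq> 0"
  shows "j = a"
proof -
  have aO: "a \<in> Od N" using a N4 by (auto simp: Od_def)
  have ia: "int a = 1 \<or> int a = 4 * int N - 1" using a N4 by auto
  have asq: "8 * int N dvd (int a)\<^sup>2 - 1"
    using ia
  proof
    assume e: "int a = 4 * int N - 1"
    have "(int a)\<^sup>2 - 1 = 8 * int N * (2 * int N - 1)" unfolding e by (simp add: power2_eq_square algebra_simps)
    then show ?thesis by simp
  qed simp
  have sa: "sn N (m * int a) > 0" if "coprime m (2 * int N)" "0 < m" "m < 4 * int N" for m
    using ia
  proof
    assume "int a = 4 * int N - 1"
    moreover have "odd m" using that(1) by simp
    ultimately show ?thesis using sn_fold[OF N0, of m 1] sn_pos[OF that(2,3)] by (simp add: mult.commute)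
  qed (use sn_pos[OF that(2,3)] in simp)
  have "ph N (T_exp N a) = ph N (T_exp N j)" using inv aO j unfolding invariant_def by auto
  then have T: "16 * int N dvd T_exp N j - T_exp N a" unfolding ph_eq_iff[OF N0] by (simp add: cong_iff_dvd_diff dvd_diff_commute)
  then have T8: "8 * int N dvd T_exp N j - T_exp N a" using dvd_trans[of "8 * int N" "16 * int N"] by simp
  from j(1) show ?thesis
  proof
    assume jO: "j \<in> Od N"
    have "8 * int N dvd (int a)\<^sup>2 - (int j)\<^sup>2"
      using T8 by (simp add: T_exp_Od[OF aO] T_exp_Od[OF jO] dvd_diff_commute)
    then have "8 * int N dvd ((int a)\<^sup>2 - 1) - ((int a)\<^sup>2 - (int j)\<^sup>2)" by (rule dvd_diff[OF asq])
    then have sq: "[(int j)\<^sup>2 = 1] (mod (8 * int N))" by (simp add: cong_iff_dvd_diff)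
    have "sn N (m * int j) > 0" if "coprime m (2 * int N)" "0 < m" "m < 4 * int N" for m
      using parity_odd[OF inv that(1) aO jO j(2)] sa[OF that] by (simp add: zero_less_mult_iff)
    then have ij: "int j = 1 \<or> int j = 4 * int N - 1"
      using Od_bounds[OF jO] by (intro parity_rule[OF N4 _ _ _ sq]) auto
    show ?thesis
    proof (rule ccontr)
      assume "j \<noteq> a"
      then have "(int j = 1 \<and> int a = 4 * int N - 1) \<or> (int j = 4 * int N - 1 \<and> int a = 1)"
        using ij ia by auto
      then have "T_exp N j - T_exp N a = 8 * int N * (2 * int N - 1) \<or> T_exp N j - T_exp N a = - (8 * int N * (2 * int N - 1))"
      proof (elim disjE conjE)
        assume e: "int j = 1" "int a = 4 * int N - 1"
        show ?thesis unfolding T_exp_Od[OF aO] T_exp_Od[OF jO] e by (simp add: power2_eq_square algebra_simps)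
      next
        assume e: "int j = 4 * int N - 1" "int a = 1"
        show ?thesis unfolding T_exp_Od[OF aO] T_exp_Od[OF jO] e by (simp add: power2_eq_square algebra_simps)
      qed
      then have "8 * int N * 2 dvd 8 * int N * (2 * int N - 1)" using T by (auto simp: mult_ac)
      then have "2 dvd 2 * int N - 1" using N0 by (subst (asm) dvd_mult_cancel_left) auto
      then show False by simp
    qed
  next
    assume jE: "j \<in> Ev N"
    obtain b where b: "ang N j = 2 * b" using Ev_bounds[OF jE] by (auto elim: evenE)
    have "8 * int N dvd 3 * int N * (2 * int N - 1) - 4 * b\<^sup>2 + (int a)\<^sup>2"
      using T8 by (simp add: T_exp_Od[OF aO] T_exp_Ev[OF jE] b power_mult_distrib)
    then have "8 * int N dvd ((int a)\<^sup>2 - 1) - (3 * int N * (2 * int N - 1) - 4 * b\<^sup>2 + (int a)\<^sup>2)" by (rule dvd_diff[OF asq])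
    then have d: "8 * int N dvd 4 * b\<^sup>2 - (1 + 3 * int N * (2 * int N - 1))" by (simp add: algebra_simps)
    then have sq: "[4 * b\<^sup>2 = 1 + 3 * int N * (2 * int N - 1)] (mod (8 * int N))" by (simp add: cong_iff_dvd_diff)
    have oN: "odd N"
    proof
      assume "even N"
      have "even (4 * b\<^sup>2 - (1 + 3 * int N * (2 * int N - 1)))" by (rule dvd_trans[OF _ d]) simp
      then show False using \<open>even N\<close> by simp
    qed
    have "b \<noteq> int N"
    proof
      assume bN: "b = int N"
      have "int N dvd 4 * b\<^sup>2 - (1 + 3 * int N * (2 * int N - 1))" by (rule dvd_trans[OF _ d]) simp
      moreover have "4 * b\<^sup>2 - (1 + 3 * int N * (2 * int N - 1)) = int N * (4 * int N - 3 * (2 * int N - 1)) - 1"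
        unfolding bN by (simp add: power2_eq_square algebra_simps)
      ultimately have "int N dvd int N * (4 * int N - 3 * (2 * int N - 1)) - (int N * (4 * int N - 3 * (2 * int N - 1)) - 1)"
        by (metis dvd_diff dvd_triv_left)
      then have "int N dvd 1" by simp
      then show False using N4 by simp
    qed
    then have bb: "int N < b" "b < 2 * int N" using Ev_bounds[OF jE] b by auto
    have pe: "\<chi> * sn N (m * (2 * b)) > 0"
      if "coprime m (2 * int N)" "0 < m" "m < 4 * int N" "[m * l = 1] (mod (16 * int N))" "\<chi> = 1 \<or> \<chi> = - 1" "ph N (m * T_shift) = of_real \<chi> * ph N (l * T_shift)" for m l \<chi>
      using parity_even[OF inv that(1,4) aO jE j(2) that(5,6)] sa[OF that(1-3)] that(5) unfolding b
      by (auto simp: zero_less_mult_iff mult_less_0_iff)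
    have False
    proof (rule parity_rule_spinor[OF N4 oN bb sq])
      fix m assume m: "coprime m (2 * int N)" "0 < m" "m < 4 * int N" "[m = 1] (mod 8) \<or> [m = 7] (mod 8)"
      obtain l where l: "[m * l = 1] (mod (16 * int N))" using unit_inverse[OF m(1)] .
      obtain \<chi> where "\<chi> = 1 \<or> \<chi> = - 1" "ph N (m * T_shift) = of_real \<chi> * ph N (l * T_shift)" "\<chi> = 1"
        using T_shift_sign[OF l] oN m(4) by metis
      then show "sn N (m * (2 * b)) > 0" using pe[OF m(1-3) l] by simp
    next
      fix m assume m: "coprime m (2 * int N)" "0 < m" "m < 4 * int N" "[m = 3] (mod 8)"
      obtain l where l: "[m * l = 1] (mod (16 * int N))" using unit_inverse[OF m(1)] .
      obtain \<chi> where "\<chi> = 1 \<or> \<chi> = - 1" "ph N (m * T_shift) = of_real \<chi> * ph N (l * T_shift)" "\<chi> = - 1"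
        using T_shift_sign[OF l] oN m(4) by metis
      then show "sn N (m * (2 * b)) < 0" using pe[OF m(1-3) l, of "- 1"] by simp
    qed
    then show ?thesis ..
  qed
qed

end

section \<open>Quantum dimensions and the determination of all entries\<close>

lemma sn_eq_cases:
  assumes "N > 0" "0 < x" "x < 4 * int N" "0 < y" "y < 4 * int N" "sn N x = sn N y"
  shows "x = y \<or> x + y = 4 * int N"
proof -
  define g where "g z = (if z \<le> 2 * int N then z else 4 * int N - z)" for z
  have g: "sn N (g z) = sn N z" for z
    using sn_fold[OF assms(1), of 1 z] by (simp add: g_def)
  have inj: "u = v" if "0 < u" "u \<le> 2 * int N" "0 < v" "v \<le> 2 * int N" "sn N u = sn N v" for u v
  proof -
    have b: "- (pi / 2) \<le> pi * of_int w / (4 * real N)" "pi * of_int w / (4 * real N) \<le> pi / 2" if "0 < w" "w \<le> 2 * int N" for w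
    proof -
      have "of_int w \<le> 2 * real N" using that by linarith
      then show "pi * of_int w / (4 * real N) \<le> pi / 2" using assms(1) by (simp add: field_simps)
      have "0 \<le> pi * of_int w / (4 * real N)" using that by simp
      then show "- (pi / 2) \<le> pi * of_int w / (4 * real N)" using pi_gt_zero by linarith
    qed
    have "pi * of_int u / (4 * real N) = pi * of_int v / (4 * real N)"
      using sin_inj_pi[OF b(1)[OF that(1,2)] b(2)[OF that(1,2)] b(1)[OF that(3,4)] b(2)[OF that(3,4)]] that(5)
      by (simp add: sn_def)
    then show ?thesis using assms(1) by simp
  qed
  have "g x = g y" using assms g by (intro inj) (auto simp: g_def)
  then show ?thesis by (auto simp: g_def split: if_splits)
qed

context modular_data
begin

abbreviation sw :: "nat \<Rightarrow> nat" where
  "sw \<equiv> transpose (2 * N) (4 * N)"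

lemma one_Od: "1 \<in> Od N" "4 * N - 1 \<in> Od N"
  using N4 by (auto simp: Od_def)

lemma sum_row:
  fixes f :: "nat \<Rightarrow> complex"
  assumes "invariant n" "a = 1 \<or> a = 4 * N - 1"
  shows "(\<Sum>u\<in>I. of_nat (n a u) * f u) = of_nat (n a a) * f a"
proof -
  have "a \<in> I" using assms(2) one_Od by auto
  moreover have "(\<Sum>u\<in>I - {a}. of_nat (n a u) * f u) = 0"
    using vacuum_row[OF assms] by (intro sum.neutral) auto
  ultimately show ?thesis by (subst sum.remove[of _ a]) simp_all
qed

lemma commute_eq:
  assumes "invariant n" "i \<in> I" "j \<in> I"
  shows "(\<Sum>u\<in>I. of_nat (n i u) * S u j) = (\<Sum>u\<in>I. S i u * of_nat (n u j))"
  using assms unfolding invariant_def commute_on_def by simp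

text \<open>Together with \<open>sn_last_even\<close> this compares the rows of J_b 0 and 0: they
  agree on even \<lambda>_r and are opposite on odd \<lambda>_r.\<close>

lemma sn_last_odd:
  assumes "A \<in> Od N"
  shows "sn N (int (4 * N - 1) * int A) = sn N (int A)"
proof -
  have i: "int (4 * N - 1) = 4 * int N - 1" using N0 by simp
  show ?thesis using sn_fold[OF N0, of "int A" 1] Od_bounds[OF assms] by (simp add: i)
qed

lemma sn_last_even:
  assumes "B \<in> Ev N"
  shows "sn N (int (4 * N - 1) * ang N B) = - sn N (ang N B)"
proof -
  have i: "int (4 * N - 1) = 4 * int N - 1" using N0 by simp
  obtain b where b: "ang N B = 2 * b" using Ev_bounds[OF assms] by (auto elim: evenE)
  have "int (4 * N - 1) * ang N B = - ang N B + 8 * int N * b" unfolding i b by (simp add: algebra_simps)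
  then show ?thesis by (simp only: sn_shift[OF N0] sn_uminus)
qed

text \<open>\<open>4 * N - 1\<close> is the number of $J_b 0$.\<close>
lemma n_last:
  assumes inv: "invariant n"
  shows "n (4 * N - 1) (4 * N - 1) = 1"
proof -
  let ?a = "4 * N - 1"
  have n1: "n 1 1 = 1" using inv unfolding invariant_def by simp
  have "of_nat (n ?a ?a) * S ?a 1 = (\<Sum>u\<in>I. of_nat (n ?a u) * S u 1)"
    using sum_row[OF inv] by simp
  also have "\<dots> = (\<Sum>u\<in>I. of_nat (n u 1) * S ?a u)"
    using commute_eq[OF inv, of ?a 1] one_Od by (simp add: mult.commute)
  also have "\<dots> = S ?a 1"
    using sum_row[OF invariant_transpose[OF inv], of 1 "S ?a"] n1 by simp
  finally have "of_nat (n ?a ?a) * S ?a 1 = S ?a 1" .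
  moreover have "S ?a 1 \<noteq> 0"
    using k1 sn_last_odd[OF one_Od(1)] sn_pos[of 1 N] N4 S_oo[OF one_Od(2,1)] by auto
  ultimately show ?thesis by (metis mult_cancel_right mult_1 of_nat_1_eq_iff)
qed

text \<open>In rows 0 and J_b 0 the matrix MS is just S, since M has the single entry 1 there. Thus
  SM = S in these two rows; their sum keeps only even \<lambda>_r in the summation and their
  difference only odd \<lambda>_r.\<close>

lemma vacuum_column_sums:
  assumes inv: "invariant n" and v: "v \<in> I"
  shows "(\<Sum>A\<in>Od N. sn N (int A) * real (n A v)) = (if v \<in> Od N then sn N (int v) else 0)"
    and "(\<Sum>B\<in>Ev N. wgt N B * sn N (ang N B) * real (n B v)) = (if v \<in> Ev N then wgt N v * sn N (ang N v) else 0)"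
proof -
  let ?a = "4 * N - 1"
  define X where "X = (\<Sum>A\<in>Od N. sn N (int A) * real (n A v))"
  define Y where "Y = (\<Sum>B\<in>Ev N. wgt N B * sn N (ang N B) * real (n B v))"
  have n1: "n 1 1 = 1" using inv unfolding invariant_def by simp
  have XO: "(\<Sum>A\<in>Od N. S a A * of_nat (n A v)) = k1 * of_real X" if "a = 1 \<or> a = ?a" for a
  proof -
    have "S a A = k1 * of_real (sn N (int A))" if "A \<in> Od N" for A
      using \<open>a = 1 \<or> a = ?a\<close> S_oo[OF one_Od(1) that] S_oo[OF one_Od(2) that] sn_last_odd[OF that] by auto
    then show ?thesis unfolding X_def of_real_sum sum_distrib_left
      by (intro sum.cong refl) (simp add: mult_ac)
  qed
  have YE: "(\<Sum>B\<in>Ev N. S a B * of_nat (n B v)) = (if a = 1 then 1 else - 1) * k2 * of_real Y" if "a = 1 \<or> a = ?a" for a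
  proof -
    have "S a B = (if a = 1 then 1 else - 1) * k2 * of_real (wgt N B * sn N (ang N B))" if "B \<in> Ev N" for B
      using \<open>a = 1 \<or> a = ?a\<close> S_oe[OF one_Od(1) that] S_oe[OF one_Od(2) that] sn_last_even[OF that] N4 by auto
    then show ?thesis unfolding Y_def of_real_sum sum_distrib_left
      by (intro sum.cong refl) (simp add: mult_ac)
  qed
  have "S 1 v = (\<Sum>u\<in>I. S 1 u * of_nat (n u v))"
    using commute_eq[OF inv _ v, of 1] one_Od sum_row[OF inv, of 1 "\<lambda>u. S u v"] n1 by simp
  then have e1: "S 1 v = k1 * of_real X + k2 * of_real Y"
    unfolding sum_I using XO[of 1] YE[of 1] by simp
  have "S ?a v = (\<Sum>u\<in>I. S ?a u * of_nat (n u v))"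
    using commute_eq[OF inv _ v, of ?a] one_Od sum_row[OF inv, of ?a "\<lambda>u. S u v"] n_last[OF inv] by simp
  then have e2: "S ?a v = k1 * of_real X - k2 * of_real Y"
    unfolding sum_I using XO[of ?a] YE[of ?a] N4 by simp
  have p: "S 1 v + S ?a v = 2 * k1 * of_real X" "S 1 v - S ?a v = 2 * k2 * of_real Y"
    unfolding e1 e2 by simp_all
  from v have XY: "of_real X = complex_of_real (if v \<in> Od N then sn N (int v) else 0) \<and>
    of_real Y = complex_of_real (if v \<in> Ev N then wgt N v * sn N (ang N v) else 0)"
  proof
    assume o: "v \<in> Od N"
    then have "v \<notin> Ev N" using Od_Ev_disjoint by blast
    moreover have "S 1 v = k1 * of_real (sn N (int v))" "S ?a v = k1 * of_real (sn N (int v))"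
      using S_oo[OF one_Od(1) o] S_oo[OF one_Od(2) o] sn_last_odd[OF o] by simp_all
    ultimately show ?thesis using p k1 k2_nz o by simp
  next
    assume e: "v \<in> Ev N"
    then have "v \<notin> Od N" using Od_Ev_disjoint by blast
    moreover have "S 1 v = k2 * of_real (wgt N v * sn N (ang N v))" "S ?a v = - k2 * of_real (wgt N v * sn N (ang N v))"
      using S_oe[OF one_Od(1) e] S_oe[OF one_Od(2) e] sn_last_even[OF e] by simp_all
    ultimately show ?thesis using p k1 k2_nz e by simp
  qed
  show "(\<Sum>A\<in>Od N. sn N (int A) * real (n A v)) = (if v \<in> Od N then sn N (int v) else 0)"
    using XY unfolding X_def of_real_eq_iff by blast
  show "(\<Sum>B\<in>Ev N. wgt N B * sn N (ang N B) * real (n B v)) = (if v \<in> Ev N then wgt N v * sn N (ang N v) else 0)"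
    using XY unfolding Y_def of_real_eq_iff by blast
qed

lemma sn_Od_pos: "A \<in> Od N \<Longrightarrow> sn N (int A) > 0"
  using Od_bounds by (intro sn_pos) auto

lemma sn_Ev_pos: "B \<in> Ev N \<Longrightarrow> wgt N B * sn N (ang N B) > 0"
  using Ev_bounds wgt_pos by (intro mult_pos_pos sn_pos) auto

text \<open>The preceding sums vanish when v lies in the other class, and their terms are
  nonnegative with positive coefficients.\<close>

lemma block_zero:
  assumes inv: "invariant n" and "A \<in> Od N" "B \<in> Ev N"
  shows "n A B = 0" "n B A = 0"
proof -
  have "A \<notin> Ev N" "B \<notin> Od N" using Od_Ev_disjoint assms(2,3) by blast+
  then have "(\<Sum>A\<in>Od N. sn N (int A) * real (n A B)) = 0" "(\<Sum>B\<in>Ev N. wgt N B * sn N (ang N B) * real (n B A)) = 0"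
    using vacuum_column_sums(1)[OF inv, of B] vacuum_column_sums(2)[OF inv, of A] assms by simp_all
  then have "sn N (int A) * real (n A B) = 0" "wgt N B * sn N (ang N B) * real (n B A) = 0"
    using assms(2,3) less_imp_le[OF sn_Od_pos] less_imp_le[OF sn_Ev_pos]
    by (simp_all add: sum_nonneg_eq_0_iff)
  then show "n A B = 0" "n B A = 0" using sn_Od_pos[OF assms(2)] sn_Ev_pos[OF assms(3)] by auto
qed

lemma sn_le:
  assumes inv: "invariant n" and "A \<in> Od N" "C \<in> Od N"
  shows "sn N (int A) * real (n A C) \<le> sn N (int C)"
proof -
  have "sn N (int A) * real (n A C) \<le> (\<Sum>A\<in>Od N. sn N (int A) * real (n A C))"
    using assms(2) less_imp_le[OF sn_Od_pos] by (intro member_le_sum) auto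
  then show ?thesis using vacuum_column_sums(1)[OF inv, of C] assms(3) by simp
qed

text \<open>A nonzero entry forces $\sin\frac{\pi A}{4N} \le \sin\frac{\pi C}{4N}$ through its column and
  the converse through its row.\<close>
lemma odd_block:
  assumes inv: "invariant n" and A: "A \<in> Od N" and C: "C \<in> Od N"
  shows "n A C = (if A = C then 1 else 0)"
proof -
  have AC: "A = C" if n: "n A C \<noteq> 0" and A: "A \<in> Od N" and C: "C \<in> Od N" for A C
  proof -
    have "sn N (int A) * 1 \<le> sn N (int A) * real (n A C)"
      using n less_imp_le[OF sn_Od_pos[OF A]] by (intro mult_left_mono) auto
    then have "sn N (int A) \<le> sn N (int C)" using sn_le[OF inv A C] by simp
    moreover have "sn N (int C) * 1 \<le> sn N (int C) * real (n A C)"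
      using n less_imp_le[OF sn_Od_pos[OF C]] by (intro mult_left_mono) auto
    then have "sn N (int C) \<le> sn N (int A)" using sn_le[OF invariant_transpose[OF inv] C A] by simp
    ultimately have "int A = int C \<or> int A + int C = 4 * int N"
      using Od_bounds[OF A] Od_bounds[OF C] by (intro sn_eq_cases[OF N0]) auto
    then show ?thesis
    proof
      assume "int A + int C = 4 * int N"
      then have C': "int C = 4 * int N - int A" by simp
      \<comment> \<open>Equal sines leave only the J_b image. It is excluded by T, because the
        exponents differ by 8N(2N - A) with 2N - A odd.\<close>
      have "ph N (T_exp N A) = ph N (T_exp N C)" using inv n A C unfolding invariant_def by auto
      then have "16 * int N dvd T_exp N A - T_exp N C" unfolding ph_eq_iff[OF N0] by (simp add: cong_iff_dvd_diff)
      also have "T_exp N A - T_exp N C = 8 * int N * (2 * int N - int A)"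
        unfolding T_exp_Od[OF A] T_exp_Od[OF C] C' by (simp add: power2_eq_square algebra_simps)
      finally have "8 * int N * 2 dvd 8 * int N * (2 * int N - int A)" by (simp add: mult_ac)
      then have "2 dvd 2 * int N - int A" using N0 by (subst (asm) dvd_mult_cancel_left) auto
      then show ?thesis using Od_bounds[OF A] by simp
    qed simp
  qed
  show ?thesis
  proof (cases "A = C")
    case True
    have "(\<Sum>A\<in>Od N. sn N (int A) * real (n A C)) = sn N (int C) * real (n C C)"
    proof -
      have "(\<Sum>A\<in>Od N - {C}. sn N (int A) * real (n A C)) = 0"
        using AC C by (intro sum.neutral) auto
      then show ?thesis using C by (subst sum.remove[of _ C]) simp_all
    qed
    then have "sn N (int C) * real (n C C) = sn N (int C)" using vacuum_column_sums(1)[OF inv, of C] C by simp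
    then show ?thesis using sn_Od_pos[OF C] True by simp
  next
    case False
    then show ?thesis using AC[OF _ A C] by auto
  qed
qed

text \<open>At the common angle 2N the two cases of \<open>sn_pairing_eq\<close> coincide and double
  the value; the weight 1/2 undoes this.\<close>

lemma sn_pairing_ang:
  assumes "B \<in> Ev N" "B' \<in> Ev N"
  shows "wgt N B * sn_pairing N (ang N B) (ang N B') = (if ang N B = ang N B' then real N else 0)"
proof -
  have "sn_pairing N (ang N B) (ang N B') = (if ang N B = ang N B' then real N else 0) + (if ang N B + ang N B' = 4 * int N then real N else 0)"
    using Ev_bounds[OF assms(1)] Ev_bounds[OF assms(2)] N0 by (intro sn_pairing_eq) auto
  moreover have "ang N B + ang N B' = 4 * int N \<longleftrightarrow> ang N B = 2 * int N \<and> ang N B' = 2 * int N"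
    using Ev_bounds[OF assms(1)] Ev_bounds[OF assms(2)] by auto
  moreover have "wgt N B = (if ang N B = 2 * int N then 1 / 2 else 1)"
    using N0 by (auto simp: wgt_def ang_def)
  ultimately show ?thesis by auto
qed

text \<open>M is the identity on \<open>Od\<close>, so MS = SM in an odd row C expands the sine of v
  in the sines of the entries of its column. Orthogonality over C then isolates one angle; the
  indices 2N and 4N share theirs, so only their sum is determined.\<close>

lemma even_columns:
  assumes inv: "invariant n" and v: "v \<in> Ev N" and w: "w \<in> Ev N"
  shows "(\<Sum>B\<in>Ev N. (if ang N B = ang N w then n B v else 0)) = (if ang N v = ang N w then 1 else 0)"
proof -
  have eq: "wgt N v * sn N (ang N v * int C) = (\<Sum>B\<in>Ev N. real (n B v) * wgt N B * sn N (ang N B * int C))" if C: "C \<in> Od N" for C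
  proof -
    have "(\<Sum>u\<in>I. of_nat (n C u) * S u v) = S C v"
    proof -
      have "(\<Sum>u\<in>Od N. of_nat (n C u) * S u v) = (\<Sum>u\<in>Od N. if u = C then S C v else 0)"
        using odd_block[OF inv C] by (intro sum.cong refl) auto
      moreover have "(\<Sum>u\<in>Ev N. of_nat (n C u) * S u v) = 0"
        using block_zero(1)[OF inv C] by (intro sum.neutral) simp
      ultimately show ?thesis unfolding sum_I using C by simp
    qed
    then have "S C v = (\<Sum>u\<in>I. S C u * of_nat (n u v))" using commute_eq[OF inv, of C v] C v by simp
    also have "\<dots> = (\<Sum>B\<in>Ev N. S C B * of_nat (n B v))"
      unfolding sum_I using block_zero(1)[OF inv _ v] by simp
    also have "\<dots> = k2 * of_real (\<Sum>B\<in>Ev N. real (n B v) * wgt N B * sn N (ang N B * int C))"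
      unfolding of_real_sum sum_distrib_left by (intro sum.cong refl) (simp add: S_oe C mult_ac)
    finally have "k2 * of_real (wgt N v * sn N (ang N v * int C)) = k2 * of_real (\<Sum>B\<in>Ev N. real (n B v) * wgt N B * sn N (ang N B * int C))"
      by (simp add: S_oe C v mult.commute[of "int C"])
    then show ?thesis using k2_nz by (simp only: mult_cancel_left of_real_eq_iff simp_thms)
  qed
  have "wgt N v * sn_pairing N (ang N v) (ang N w) = (\<Sum>C\<in>Od N. (wgt N v * sn N (ang N v * int C)) * sn N (ang N w * int C))"
    unfolding sum_sn_Od[symmetric] sum_distrib_left by (simp only: mult.assoc)
  also have "\<dots> = (\<Sum>C\<in>Od N. (\<Sum>B\<in>Ev N. real (n B v) * wgt N B * sn N (ang N B * int C)) * sn N (ang N w * int C))"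
    by (intro sum.cong refl) (simp only: eq)
  also have "\<dots> = (\<Sum>B\<in>Ev N. real (n B v) * (wgt N B * sn_pairing N (ang N B) (ang N w)))"
    unfolding sum_sn_Od[symmetric] sum_distrib_left sum_distrib_right
    by (subst sum.swap) (simp only: mult.assoc)
  also have "\<dots> = real N * real (\<Sum>B\<in>Ev N. (if ang N B = ang N w then n B v else 0))"
    unfolding of_nat_sum sum_distrib_left by (intro sum.cong refl) (simp add: sn_pairing_ang w)
  finally have "real N * real (\<Sum>B\<in>Ev N. (if ang N B = ang N w then n B v else 0)) = (if ang N v = ang N w then real N else 0)"
    by (simp only: sn_pairing_ang v w)
  then show ?thesis using N0 by (auto split: if_splits simp del: of_nat_sum)
qed

lemma spinor_column:
  assumes inv: "invariant n" and v: "v \<in> Ev N"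
  shows "n (2 * N) v + n (4 * N) v = (if v = 2 * N \<or> v = 4 * N then 1 else 0)"
    and "w \<in> Ev N \<Longrightarrow> w \<noteq> 2 * N \<Longrightarrow> w \<noteq> 4 * N \<Longrightarrow> n w v = (if w = v then 1 else 0)"
proof -
  have E: "2 * N \<in> Ev N" "4 * N \<in> Ev N" by (simp_all add: Ev_def)
  have "(\<Sum>B\<in>Ev N. (if ang N B = ang N (2 * N) then n B v else 0)) = n (2 * N) v + n (4 * N) v"
    unfolding sum_Ev[OF N0] using N0 by (auto simp: ang_def intro!: sum.neutral)
  then show "n (2 * N) v + n (4 * N) v = (if v = 2 * N \<or> v = 4 * N then 1 else 0)"
    using even_columns[OF inv v E(1)] N0 by (auto simp: ang_def split: if_splits)
  assume w: "w \<in> Ev N" "w \<noteq> 2 * N" "w \<noteq> 4 * N"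
  then have a: "ang N B = ang N w \<longleftrightarrow> B = w" for B by (auto simp: ang_def)
  show "n w v = (if w = v then 1 else 0)"
    using even_columns[OF inv v w(1)] w(1) unfolding a by (auto split: if_splits)
qed

text \<open>All entries off the pair 2N, 4N are forced. On the pair, row and column sums equal 1, so
  the block is one of the two permutation matrices of size 2.\<close>

theorem classification:
  assumes inv: "invariant n"
  shows "(\<forall>i\<in>I. \<forall>j\<in>I. n i j = (if i = j then 1 else 0)) \<or> (\<forall>i\<in>I. \<forall>j\<in>I. n i j = (if sw i = j then 1 else 0))"
proof -
  have E: "2 * N \<in> Ev N" "4 * N \<in> Ev N" by (simp_all add: Ev_def)
  note col = spinor_column[OF inv] and row = spinor_column[OF invariant_transpose[OF inv]]
  have tot: "n (2 * N) (2 * N) + n (4 * N) (2 * N) = 1" "n (2 * N) (4 * N) + n (4 * N) (4 * N) = 1"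
    "n (2 * N) (2 * N) + n (2 * N) (4 * N) = 1"
    using col(1)[OF E(1)] col(1)[OF E(2)] row(1)[OF E(1)] by simp_all
  have swO: "sw i = i" if "i \<in> Od N" for i
    using that by (intro transpose_apply_other) (auto simp: Od_def)
  have OO: "i \<notin> Ev N" if "i \<in> Od N" for i using that Od_Ev_disjoint by blast
  have other: "n i j = (if i = j then 1 else 0) \<and> n i j = (if sw i = j then 1 else 0)"
    if ij: "i \<in> I" "j \<in> I" "\<not> (i \<in> {2 * N, 4 * N} \<and> j \<in> {2 * N, 4 * N})" for i j
  proof (cases "i \<in> Od N \<or> j \<in> Od N")
    case True
    have "sw i = j \<longleftrightarrow> i = j" using True swO[of i] swO[of j] by (metis transpose_involutory)
    moreover have "n i j = (if i = j then 1 else 0)"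
      using True ij(1,2) odd_block[OF inv, of i j] block_zero[OF inv, of i j] block_zero[OF inv, of j i] OO by auto
    ultimately show ?thesis by simp
  next
    case False
    then have e: "i \<in> Ev N" "j \<in> Ev N" using ij by auto
    show ?thesis
    proof (cases "i \<in> {2 * N, 4 * N}")
      case True
      then have "j \<noteq> 2 * N" "j \<noteq> 4 * N" using ij(3) by auto
      then show ?thesis using row(2)[OF e(1) e(2)] True by auto
    next
      case False
      then show ?thesis using col(2)[OF e(2) e(1)] by auto
    qed
  qed
  have ne: "2 * N \<noteq> 4 * N" using N0 by simp
  show ?thesis
  proof (cases "n (2 * N) (2 * N) = 1")
    case True
    then have "n (4 * N) (2 * N) = 0" "n (2 * N) (4 * N) = 0" "n (4 * N) (4 * N) = 1" using tot by auto
    then have "n i j = (if i = j then 1 else 0)" if "i \<in> I" "j \<in> I" for i j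
      using other[OF that] True ne by (cases "i \<in> {2 * N, 4 * N} \<and> j \<in> {2 * N, 4 * N}") auto
    then show ?thesis by blast
  next
    case False
    then have "n (4 * N) (2 * N) = 1" "n (2 * N) (4 * N) = 1" "n (4 * N) (4 * N) = 0" "n (2 * N) (2 * N) = 0" using tot by auto
    then have "n i j = (if sw i = j then 1 else 0)" if "i \<in> I" "j \<in> I" for i j
      using other[OF that] ne by (cases "i \<in> {2 * N, 4 * N} \<and> j \<in> {2 * N, 4 * N}") auto
    then show ?thesis by blast
  qed
qed

end

section \<open>The Weyl group\<close>

text \<open>The matrix sends x to the vector with coordinates s_i x_{p(i)}. With this convention
  products compose permutations in reverse order.\<close>

definition signed_perm :: "nat \<Rightarrow> (nat \<Rightarrow> nat) \<Rightarrow> (nat \<Rightarrow> real) \<Rightarrow> real mat" where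
  "signed_perm r p s = mat r r (\<lambda>(i, j). if j = p i then s i else 0)"

lemma signed_perm_mult:
  assumes p: "p permutes {0..<r}"
  shows "signed_perm r p s * signed_perm r q t = signed_perm r (q \<circ> p) (\<lambda>i. s i * t (p i))"
proof (rule eq_matI)
  fix i j assume "i < dim_row (signed_perm r (q \<circ> p) (\<lambda>i. s i * t (p i)))" "j < dim_col (signed_perm r (q \<circ> p) (\<lambda>i. s i * t (p i)))"
  then have ij: "i < r" "j < r" by (simp_all add: signed_perm_def)
  have pi: "p i < r" using permutes_in_image[OF p, of i] ij by simp
  have "(signed_perm r p s * signed_perm r q t) $$ (i, j) =
    (\<Sum>k = 0..<r. (if k = p i then s i else 0) * (if j = q k then t k else 0))"
    using ij by (simp add: signed_perm_def scalar_prod_def)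
  also have "\<dots> = (\<Sum>k = 0..<r. if k = p i then s i * (if j = q (p i) then t (p i) else 0) else 0)"
    by (intro sum.cong) auto
  also have "\<dots> = s i * (if j = q (p i) then t (p i) else 0)" using pi by simp
  finally show "(signed_perm r p s * signed_perm r q t) $$ (i, j) = signed_perm r (q \<circ> p) (\<lambda>i. s i * t (p i)) $$ (i, j)"
    using ij by (simp add: signed_perm_def)
qed (simp_all add: signed_perm_def)

lemma det_signed_perm:
  assumes p: "p permutes {0..<r}"
  shows "det (signed_perm r p s) = signof p * (\<Prod>i = 0..<r. s i)"
proof -
  have "det (signed_perm r p s) = (\<Sum>q\<in>{q. q permutes {0..<r}}. signof q * (\<Prod>i = 0..<r. signed_perm r p s $$ (i, q i)))"
    by (rule det_def') (simp add: signed_perm_def)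
  also have "\<dots> = (\<Sum>q\<in>{q. q permutes {0..<r}}. if q = p then signof p * (\<Prod>i = 0..<r. s i) else 0)"
  proof (intro sum.cong refl)
    fix q assume "q \<in> {q. q permutes {0..<r}}"
    then have q: "q permutes {0..<r}" by simp
    have e: "signed_perm r p s $$ (i, q i) = (if q i = p i then s i else 0)" if "i \<in> {0..<r}" for i
      using that permutes_in_image[OF q, of i] by (simp add: signed_perm_def)
    show "signof q * (\<Prod>i = 0..<r. signed_perm r p s $$ (i, q i)) = (if q = p then signof p * (\<Prod>i = 0..<r. s i) else 0)"
    proof (cases "q = p")
      case True
      have "(\<Prod>i = 0..<r. signed_perm r p s $$ (i, q i)) = (\<Prod>i = 0..<r. s i)"
        unfolding True by (intro prod.cong refl) (simp add: e[unfolded True])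
      then show ?thesis using True by simp
    next
      case False
      then obtain i where i: "q i \<noteq> p i" by auto
      then have "i \<in> {0..<r}" using p q unfolding permutes_def by metis
      then have "(\<Prod>i = 0..<r. signed_perm r p s $$ (i, q i)) = 0"
        using i e by (intro prod_zero) auto
      then show ?thesis using False by simp
    qed
  qed
  also have "\<dots> = signof p * (\<Prod>i = 0..<r. s i)"
    using p by (simp add: finite_permutations)
  finally show ?thesis .
qed

section \<open>The Weyl group of B_r as signed permutations, and its alternating sum\<close>

context
  fixes r :: nat
begin

lemma unit_diff_scalar [simp]:
  assumes "a < r" "b < r" "a \<noteq> b"
  shows "(unit_vec r a - unit_vec r b) \<bullet> (unit_vec r a - unit_vec r b) = (2 :: real)"
    "(unit_vec r a + unit_vec r b) \<bullet> (unit_vec r a + unit_vec r b) = (2 :: real)"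
  using assms
  by (simp_all add: scalar_prod_minus_distrib[of _ r] scalar_prod_add_distrib[of _ r])

lemma coroot_diff:
  assumes "a < r" "b < r" "a \<noteq> b"
  shows "coroot (unit_vec r a - unit_vec r b) = unit_vec r a - unit_vec r b"
    "coroot (unit_vec r a + unit_vec r b) = unit_vec r a + unit_vec r b"
  using assms by (simp_all add: coroot_def)

lemma coroot_unit:
  assumes "a < r"
  shows "coroot (unit_vec r a) = 2 \<cdot>\<^sub>v unit_vec r a"
  using assms by (simp add: coroot_def)

lemma coroot_uminus:
  assumes "v \<in> carrier_vec r"
  shows "coroot (- v) = - coroot v"
proof -
  have "(- v) \<bullet> (- v) = v \<bullet> v" using assms by simp
  then show ?thesis unfolding coroot_def by (intro eq_vecI) auto
qed

lemma pos_roots_carrier: "\<alpha> \<in> pos_roots r \<Longrightarrow> \<alpha> \<in> carrier_vec r"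
  by (auto simp: pos_roots_def)

lemma roots_cases:
  assumes "\<alpha> \<in> roots r"
  obtains (diff) a b where "a < r" "b < r" "a \<noteq> b" "\<alpha> = unit_vec r a - unit_vec r b"
  | (plus) a b where "a < r" "b < r" "a \<noteq> b" "\<alpha> = unit_vec r a + unit_vec r b \<or> \<alpha> = - (unit_vec r a + unit_vec r b)"
  | (unit) a where "a < r" "\<alpha> = unit_vec r a \<or> \<alpha> = - unit_vec r a"
proof -
  obtain \<beta> where \<beta>: "\<beta> \<in> pos_roots r" "\<alpha> = \<beta> \<or> \<alpha> = - \<beta>"
    using assms unfolding roots_def by blast
  have "(\<exists>i j. \<beta> = unit_vec r i - unit_vec r j \<and> i < j \<and> j < r) \<or>
    (\<exists>i j. \<beta> = unit_vec r i + unit_vec r j \<and> i < j \<and> j < r) \<or> (\<exists>i. \<beta> = unit_vec r i \<and> i < r)"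
    using \<beta>(1) unfolding pos_roots_def by blast
  then show ?thesis
  proof (elim disjE exE conjE)
    fix i j assume ij: "\<beta> = unit_vec r i - unit_vec r j" "i < j" "j < r"
    have "- \<beta> = unit_vec r j - unit_vec r i"
      unfolding ij(1) by (intro eq_vecI) auto
    then show ?thesis using diff[of i j] diff[of j i] \<beta>(2) ij by auto
  next
    fix i j assume ij: "\<beta> = unit_vec r i + unit_vec r j" "i < j" "j < r"
    show ?thesis by (rule plus[of i j]) (use \<beta>(2) ij in auto)
  next
    fix i assume i: "\<beta> = unit_vec r i" "i < r"
    show ?thesis by (rule unit[of i]) (use \<beta>(2) i in auto)
  qed
qed

lemma diff_root:
  assumes "a < r" "b < r" "a \<noteq> b"
  shows "unit_vec r a - unit_vec r b \<in> roots r"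
proof (cases "a < b")
  case True
  then show ?thesis using assms by (auto simp: roots_def pos_roots_def)
next
  case False
  have "unit_vec r a - unit_vec r b = - (unit_vec r b - (unit_vec r a :: real vec))"
    by (intro eq_vecI) auto
  moreover have "b < a" using assms(3) False by simp
  then have "unit_vec r b - (unit_vec r a :: real vec) \<in> pos_roots r"
    unfolding pos_roots_def using assms(1) by blast
  ultimately show ?thesis by (auto simp: roots_def)
qed

lemma unit_root:
  assumes "a < r"
  shows "unit_vec r a \<in> roots r" "- unit_vec r a \<in> roots r"
  using assms by (auto simp: roots_def pos_roots_def)

lemma reflection_uminus:
  assumes "\<alpha> \<in> carrier_vec r"
  shows "reflection r (- \<alpha>) = reflection r \<alpha>"
  using assms unfolding reflection_def coroot_uminus[OF assms] coroot_def
  by (intro eq_matI) auto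

lemma reflection_diff:
  assumes "a < r" "b < r" "a \<noteq> b"
  shows "reflection r (unit_vec r a - unit_vec r b) = signed_perm r (Transposition.transpose a b) (\<lambda>_. 1)"
  unfolding reflection_def coroot_diff[OF assms] signed_perm_def
  using assms by (intro eq_matI) (auto simp: Transposition.transpose_def)

lemma reflection_plus:
  assumes "a < r" "b < r" "a \<noteq> b"
  shows "reflection r (unit_vec r a + unit_vec r b) = signed_perm r (Transposition.transpose a b) (\<lambda>i. if i = a \<or> i = b then - 1 else 1)"
  unfolding reflection_def coroot_diff[OF assms] signed_perm_def
  using assms by (intro eq_matI) (auto simp: Transposition.transpose_def)

lemma reflection_unit:
  assumes "a < r"
  shows "reflection r (unit_vec r a) = signed_perm r id (\<lambda>i. if i = a then - 1 else 1)"
  unfolding reflection_def coroot_unit[OF assms] signed_perm_def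
  using assms by (intro eq_matI) auto

text \<open>Reflections in long roots are transpositions, possibly with two sign changes; those in
  short roots are single sign changes. Conversely, short roots build every diagonal sign matrix, and
  the roots e_a - e_b then add transpositions one at a time.\<close>

lemma weyl_group_eq:
  "weyl_group r = {signed_perm r p s | p s. p permutes {0..<r} \<and> (\<forall>i. s i = 1 \<or> s i = - 1)}"
    (is "_ = ?W")
proof (intro equalityI subsetI)
  fix w assume "w \<in> weyl_group r"
  then show "w \<in> ?W"
  proof induction
    case one
    have "1\<^sub>m r = signed_perm r id (\<lambda>_. 1)"
      unfolding signed_perm_def by (intro eq_matI) auto
    then show ?case using permutes_id by blast
  next
    case (step w \<alpha>)
    then obtain q t where w: "w = signed_perm r q t" "q permutes {0..<r}" "\<And>i. t i = 1 \<or> t i = - 1" by blast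
    have "\<exists>p s. reflection r \<alpha> = signed_perm r p s \<and> p permutes {0..<r} \<and> (\<forall>i. s i = 1 \<or> s i = - 1)"
      using step(2)
    proof (cases rule: roots_cases)
      case (diff a b)
      then show ?thesis using reflection_diff[of a b] permutes_swap_id[of a "{0..<r}" b] by auto
    next
      case (plus a b)
      then have "reflection r \<alpha> = signed_perm r (Transposition.transpose a b) (\<lambda>i. if i = a \<or> i = b then - 1 else 1)"
        using reflection_plus[of a b] reflection_uminus[of "unit_vec r a + unit_vec r b"] by auto
      then show ?thesis using permutes_swap_id[of a "{0..<r}" b] plus
        by (intro exI[of _ "Transposition.transpose a b"] exI[of _ "\<lambda>i. if i = a \<or> i = b then - 1 else 1"]) auto
    next
      case (unit a)
      then have "reflection r \<alpha> = signed_perm r id (\<lambda>i. if i = a then - 1 else 1)"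
        using reflection_unit[of a] reflection_uminus[of "unit_vec r a"] by auto
      then show ?thesis using permutes_id
        by (intro exI[of _ id] exI[of _ "\<lambda>i. if i = a then - 1 else 1"]) auto
    qed
    then obtain p s where p: "reflection r \<alpha> = signed_perm r p s" "p permutes {0..<r}" "\<And>i. s i = 1 \<or> s i = - 1" by blast
    have "reflection r \<alpha> * w = signed_perm r (q \<circ> p) (\<lambda>i. s i * t (p i))"
      unfolding p(1) w(1) by (rule signed_perm_mult[OF p(2)])
    moreover have "s i * t (p i) = 1 \<or> s i * t (p i) = - 1" for i using p(3)[of i] w(3)[of "p i"] by auto
    ultimately show ?case using permutes_compose[OF p(2) w(2)] by blast
  qed
next
  fix w assume "w \<in> ?W"
  then obtain p s where w: "w = signed_perm r p s" "p permutes {0..<r}" "\<And>i. s i = 1 \<or> s i = - 1" by blast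
  have diag: "signed_perm r id (\<lambda>i. if i \<in> A then - 1 else 1) \<in> weyl_group r" if "finite A" "A \<subseteq> {0..<r}" for A
    using that
  proof induction
    case empty
    have "1\<^sub>m r = signed_perm r id (\<lambda>_. 1)"
      unfolding signed_perm_def by (intro eq_matI) auto
    then show ?case using weyl_group.one[of r] by (simp only: empty_iff if_False)
  next
    case (insert a A)
    have "reflection r (unit_vec r a) * signed_perm r id (\<lambda>i. if i \<in> A then - 1 else 1) \<in> weyl_group r"
      using insert by (intro weyl_group.step unit_root) (auto simp: id_def)
    also have "reflection r (unit_vec r a) * signed_perm r id (\<lambda>i. if i \<in> A then - 1 else 1) =
      signed_perm r (id \<circ> id) (\<lambda>i. (if i = a then - 1 else 1) * (if id i \<in> A then - 1 else 1))"
      using insert.prems by (subst reflection_unit) (simp, rule signed_perm_mult[OF permutes_id])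
    also have "\<dots> = signed_perm r id (\<lambda>i. if i \<in> insert a A then - 1 else 1)"
      using insert(2) unfolding signed_perm_def by (intro eq_matI) auto
    finally show ?case .
  qed
  have "signed_perm r p s \<in> weyl_group r" if "\<And>i. s i = 1 \<or> s i = - 1" for s
    using finite_atLeastLessThan w(2) that
  proof (induction arbitrary: s rule: permutes_rev_induct)
    case id
    have s1: "s i = 1" if "s i \<noteq> - 1" for i using id[of i] that by simp
    have "signed_perm r id s = signed_perm r id (\<lambda>i. if i \<in> {i\<in>{0..<r}. s i = - 1} then - 1 else 1)"
      unfolding signed_perm_def by (intro eq_matI) (auto intro: s1)
    also have "\<dots> \<in> weyl_group r" by (rule diag) auto
    finally show ?case by (simp add: id_def)
  next
    case (swap a b q)
    let ?t = "Transposition.transpose a b"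
    have t: "?t permutes {0..<r}" using swap by (intro permutes_swap_id) auto
    have "reflection r (unit_vec r a - unit_vec r b) * signed_perm r q (s \<circ> ?t) \<in> weyl_group r"
      using swap by (intro weyl_group.step diff_root) auto
    also have "reflection r (unit_vec r a - unit_vec r b) * signed_perm r q (s \<circ> ?t) = signed_perm r (q \<circ> ?t) (\<lambda>i. 1 * (s \<circ> ?t) (?t i))"
      using swap.hyps by (subst reflection_diff) (simp, simp, simp, rule signed_perm_mult[OF t])
    also have "\<dots> = signed_perm r (q \<circ> ?t) s" by simp
    finally show ?case .
  qed
  then show "w \<in> weyl_group r" using w by blast
qed

text \<open>Values outside the index range are fixed to be undefined, so that pairs of a permutation
  and a sign function parametrise the group without repetition.\<close>

definition signs :: "(nat \<Rightarrow> real) set" where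
  "signs = PiE {0..<r} (\<lambda>_. {1, - 1})"

lemma weyl_group_bij:
  "bij_betw (\<lambda>(p, s). signed_perm r p s) ({p. p permutes {0..<r}} \<times> signs) (weyl_group r)"
  unfolding bij_betw_def
proof
  show "inj_on (\<lambda>(p, s). signed_perm r p s) ({p. p permutes {0..<r}} \<times> signs)"
  proof (rule inj_onI, clarify)
    fix p s q t assume p: "p permutes {0..<r}" "s \<in> signs" and q: "q permutes {0..<r}" "t \<in> signs"
      and eq: "signed_perm r p s = signed_perm r q t"
    have s01: "s i = 1 \<or> s i = - 1" "t i = 1 \<or> t i = - 1" if "i < r" for i
      using that p(2) q(2) by (auto simp: signs_def PiE_iff)
    have "p i = q i \<and> s i = t i" if i: "i < r" for i
    proof -
      have "p i < r" using permutes_in_image[OF p(1), of i] i by simp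
      then have "signed_perm r p s $$ (i, p i) = s i" "signed_perm r q t $$ (i, p i) = (if p i = q i then t i else 0)"
        using i by (simp_all add: signed_perm_def)
      then show ?thesis using eq s01[OF i] by (auto split: if_splits)
    qed
    moreover have "p i = q i" if "\<not> i < r" for i using p(1) q(1) that by (simp add: permutes_def)
    moreover have "s i = t i" if "\<not> i < r" for i
    proof -
      have "s i = undefined" by (rule PiE_arb[OF p(2)[unfolded signs_def]]) (simp add: that)
      moreover have "t i = undefined" by (rule PiE_arb[OF q(2)[unfolded signs_def]]) (simp add: that)
      ultimately show ?thesis by simp
    qed
    ultimately have "p i = q i" "s i = t i" for i by (cases "i < r"; simp)+
    then show "p = q \<and> s = t" by auto
  qed
  show "(\<lambda>(p, s). signed_perm r p s) ` ({p. p permutes {0..<r}} \<times> signs) = weyl_group r"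
  proof (intro equalityI subsetI)
    fix w assume "w \<in> (\<lambda>(p, s). signed_perm r p s) ` ({p. p permutes {0..<r}} \<times> signs)"
    then obtain p s where w: "w = signed_perm r p s" "p permutes {0..<r}" "s \<in> signs" by auto
    have "w = signed_perm r p (\<lambda>i. if i < r then s i else 1)"
      unfolding w(1) signed_perm_def by (intro eq_matI) auto
    moreover have "(if i < r then s i else 1) = 1 \<or> (if i < r then s i else 1) = - 1" for i
      using w(3) by (auto simp: signs_def PiE_iff)
    ultimately show "w \<in> weyl_group r" unfolding weyl_group_eq using w(2) by blast
  next
    fix w assume "w \<in> weyl_group r"
    then obtain p s where w: "w = signed_perm r p s" "p permutes {0..<r}" "\<And>i. s i = 1 \<or> s i = - 1"
      unfolding weyl_group_eq by blast
    have "w = signed_perm r p (restrict s {0..<r})"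
      unfolding w(1) signed_perm_def by (intro eq_matI) auto
    moreover have "restrict s {0..<r} \<in> signs" using w(3) by (auto simp: signs_def)
    ultimately show "w \<in> (\<lambda>(p, s). signed_perm r p s) ` ({p. p permutes {0..<r}} \<times> signs)"
      using w(2) by force
  qed
qed

lemma signed_perm_scalar:
  assumes p: "p permutes {0..<r}" and "x \<in> carrier_vec r" "y \<in> carrier_vec r"
  shows "(signed_perm r p s *\<^sub>v x) \<bullet> y = (\<Sum>i = 0..<r. s i * x $ p i * y $ i)"
proof -
  have "(signed_perm r p s *\<^sub>v x) $ i = s i * x $ p i" if i: "i < r" for i
  proof -
    have pi: "p i < r" using permutes_in_image[OF p, of i] i by simp
    have "(signed_perm r p s *\<^sub>v x) $ i = (\<Sum>k = 0..<r. (if k = p i then s i else 0) * x $ k)"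
      using i assms(2) by (simp add: signed_perm_def scalar_prod_def)
    also have "\<dots> = (\<Sum>k = 0..<r. if k = p i then s i * x $ p i else 0)"
      by (intro sum.cong) auto
    finally show ?thesis using pi by simp
  qed
  then show ?thesis using assms(3) by (simp add: scalar_prod_def)
qed

text \<open>The sign changes turn every exponential into a sine, and the permutations assemble the
  sines into a determinant.\<close>
lemma weyl_sum:
  fixes c :: real
  assumes x: "x \<in> carrier_vec r" and y: "y \<in> carrier_vec r"
  shows "(\<Sum>w\<in>weyl_group r. of_real (det w) * exp (- (\<i> * of_real c) * of_real ((w *\<^sub>v x) \<bullet> y)))
    = (- 2 * \<i>) ^ r * of_real (det (mat r r (\<lambda>(i, j). sin (c * (x $ j * y $ i)))))"
proof -
  let ?e = "\<lambda>p i (s :: real). complex_of_real s * exp (- (\<i> * of_real c) * of_real (s * x $ p i * y $ i))"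
  have summand: "of_real (det (signed_perm r p s)) * exp (- (\<i> * of_real c) * of_real ((signed_perm r p s *\<^sub>v x) \<bullet> y))
    = of_real (signof p) * (\<Prod>i = 0..<r. ?e p i (s i))" if p: "p permutes {0..<r}" for p s
  proof -
    have "exp (- (\<i> * of_real c) * of_real (\<Sum>i = 0..<r. s i * x $ p i * y $ i)) = (\<Prod>i = 0..<r. exp (- (\<i> * of_real c) * of_real (s i * x $ p i * y $ i)))"
      unfolding of_real_sum sum_distrib_left by (rule exp_sum) simp
    then show ?thesis unfolding det_signed_perm[OF p] signed_perm_scalar[OF p x y]
      by (simp add: prod.distrib mult.assoc)
  qed
  have sines: "(\<Sum>s\<in>{1, - 1}. ?e p i s) = (- 2 * \<i>) * of_real (sin (c * (x $ p i * y $ i)))" for p i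
  proof -
    have "exp (- (\<i> * of_real c) * of_real (s * x $ p i * y $ i)) = cis (- (c * (s * x $ p i * y $ i)))" for s
      by (simp add: cis_conv_exp mult_ac)
    then have e: "?e p i s = of_real s * cis (- (c * (s * x $ p i * y $ i)))" for s by (simp only:)
    have "(\<Sum>s\<in>{1, - 1}. ?e p i s) = cis (- (c * (x $ p i * y $ i))) - cis (c * (x $ p i * y $ i))"
      unfolding e by simp
    also have "\<dots> = (- 2 * \<i>) * of_real (sin (c * (x $ p i * y $ i)))"
      by (simp add: complex_eq_iff)
    finally show ?thesis .
  qed
  have "(\<Sum>w\<in>weyl_group r. of_real (det w) * exp (- (\<i> * of_real c) * of_real ((w *\<^sub>v x) \<bullet> y)))
    = (\<Sum>(p, s)\<in>{p. p permutes {0..<r}} \<times> signs. of_real (det (signed_perm r p s)) * exp (- (\<i> * of_real c) * of_real ((signed_perm r p s *\<^sub>v x) \<bullet> y)))"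
    by (subst sum.reindex_bij_betw[OF weyl_group_bij, symmetric]) (simp add: case_prod_beta)
  also have "\<dots> = (\<Sum>p | p permutes {0..<r}. \<Sum>s\<in>signs. of_real (signof p) * (\<Prod>i = 0..<r. ?e p i (s i)))"
    by (subst sum.cartesian_product[symmetric]) (intro sum.cong refl, simp only: summand mem_Collect_eq)
  also have "\<dots> = (\<Sum>p | p permutes {0..<r}. of_real (signof p) * (\<Prod>i = 0..<r. \<Sum>s\<in>{1, - 1}. ?e p i s))"
    unfolding sum_distrib_left[symmetric] signs_def
    by (intro sum.cong refl arg_cong2[of _ _ _ _ "(*)"] prod_sum_PiE[symmetric]) auto
  also have "\<dots> = (\<Sum>p | p permutes {0..<r}. (- 2 * \<i>) ^ r * of_real (signof p * (\<Prod>i = 0..<r. sin (c * (x $ p i * y $ i)))))"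
    unfolding sines by (simp only: prod.distrib prod_constant card_atLeastLessThan diff_zero of_real_prod of_real_mult mult.left_commute power_mult_distrib)
  also have "\<dots> = (- 2 * \<i>) ^ r * of_real (\<Sum>p | p permutes {0..<r}. signof p * (\<Prod>i = 0..<r. sin (c * (x $ p i * y $ i))))"
    by (simp only: of_real_sum sum_distrib_left)
  also have "(\<Sum>p | p permutes {0..<r}. signof p * (\<Prod>i = 0..<r. sin (c * (x $ p i * y $ i)))) = det (mat r r (\<lambda>(i, j). sin (c * (x $ j * y $ i))))"
    unfolding det_def'[of "mat r r (\<lambda>(i, j). sin (c * (x $ j * y $ i)))" r, OF mat_carrier]
    by (intro sum.cong refl arg_cong2[of _ _ _ _ "(*)"] prod.cong) (auto dest: permutes_in_image)
  finally show ?thesis .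
qed

end

section \<open>Finiteness of P modulo the coroot lattice\<close>

context
  fixes r :: nat
begin

lemma coroot_lattice_carrier: "x \<in> coroot_lattice r \<Longrightarrow> x \<in> carrier_vec r"
proof (induction rule: coroot_lattice.induct)
  case (add x \<alpha>)
  have "\<alpha> \<in> carrier_vec r" using add(2) by (cases rule: roots_cases) auto
  then show ?case using add by (simp add: coroot_def)
qed simp

lemma coroot_in_lattice:
  assumes "\<alpha> \<in> roots r"
  shows "coroot \<alpha> \<in> coroot_lattice r"
proof -
  have "\<alpha> \<in> carrier_vec r" using assms by (cases rule: roots_cases) auto
  then have "0\<^sub>v r + coroot \<alpha> = coroot \<alpha>" by (simp add: coroot_def)
  then show ?thesis using coroot_lattice.add[OF coroot_lattice.zero assms] by simp
qed

lemma coroot_lattice_add: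
  assumes "x \<in> coroot_lattice r" "y \<in> coroot_lattice r"
  shows "x + y \<in> coroot_lattice r"
  using assms(2)
proof (induction rule: coroot_lattice.induct)
  case zero
  then show ?case using assms(1) coroot_lattice_carrier by simp
next
  case (add y \<alpha>)
  have "\<alpha> \<in> carrier_vec r" using add(2) by (cases rule: roots_cases) auto
  then have "x + (y + coroot \<alpha>) = (x + y) + coroot \<alpha>"
    using coroot_lattice_carrier assms(1) add(1) by (intro assoc_add_vec[symmetric]) (auto simp: coroot_def)
  then show ?case using coroot_lattice.add[OF add(3,2)] by simp
qed

lemma uminus_root:
  assumes "\<alpha> \<in> roots r"
  shows "- \<alpha> \<in> roots r"
  using assms pos_roots_carrier[of _ r] by (auto simp: roots_def)

lemma coroot_lattice_uminus:
  assumes "x \<in> coroot_lattice r"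
  shows "- x \<in> coroot_lattice r"
  using assms
proof (induction rule: coroot_lattice.induct)
  case zero
  have "- 0\<^sub>v r = (0\<^sub>v r :: real vec)" by (intro eq_vecI) auto
  then show ?case using coroot_lattice.zero[of r] by simp
next
  case (add x \<alpha>)
  have c: "\<alpha> \<in> carrier_vec r" using add(2) by (cases rule: roots_cases) auto
  have "- (x + coroot \<alpha>) = - x + coroot (- \<alpha>)"
    unfolding coroot_uminus[OF c] using coroot_lattice_carrier[OF add(1)] c by (intro eq_vecI) (auto simp: coroot_def)
  then show ?case using coroot_lattice.add[OF add(3) uminus_root[OF add(2)]] by simp
qed

lemma coroot_lattice_smult:
  assumes "x \<in> coroot_lattice r"
  shows "of_int k \<cdot>\<^sub>v x \<in> coroot_lattice r"
proof -
  have c: "x \<in> carrier_vec r" by (rule coroot_lattice_carrier[OF assms])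
  have n: "of_nat m \<cdot>\<^sub>v x \<in> coroot_lattice r" for m
  proof (induction m)
    case 0
    have "of_nat 0 \<cdot>\<^sub>v x = 0\<^sub>v r" using c by (intro eq_vecI) auto
    then show ?case using coroot_lattice.zero[of r] by simp
  next
    case (Suc m)
    have "of_nat (Suc m) \<cdot>\<^sub>v x = of_nat m \<cdot>\<^sub>v x + x" using c by (intro eq_vecI) (auto simp: algebra_simps)
    then show ?case using coroot_lattice_add[OF Suc assms] by simp
  qed
  show ?thesis
  proof (cases "k \<ge> 0")
    case True
    then show ?thesis using n[of "nat k"] by simp
  next
    case False
    have "of_int k \<cdot>\<^sub>v x = - (of_nat (nat (- k)) \<cdot>\<^sub>v x)" using c False by (intro eq_vecI) auto
    then show ?thesis using coroot_lattice_uminus[OF n] by simp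
  qed
qed

text \<open>Coroots e_m - e_0 install the coordinates one after the other at the expense of
  coordinate 0; the deficit accumulated there is even and is repaired by the short coroot
  2e_0.\<close>

lemma even_sum_in_coroot_lattice:
  assumes r: "r \<ge> 2" and even: "even (\<Sum>i<r. d i)"
  shows "vec r (\<lambda>i. of_int (d i)) \<in> coroot_lattice r"
proof -
  have "vec r (\<lambda>i. (if i < m then of_int (d i) else 0) - (if i = 0 then of_int (\<Sum>i<m. d i) else 0)) \<in> coroot_lattice r"
    (is "?u m \<in> _") if "m \<le> r" for m
    using that
  proof (induction m)
    case 0
    have "?u 0 = 0\<^sub>v r" by (intro eq_vecI) auto
    then show ?case using coroot_lattice.zero[of r] by simp
  next
    case (Suc m)
    show ?case
    proof (cases "m = 0")
      case True
      have "?u (Suc m) = 0\<^sub>v r" using True by (intro eq_vecI) auto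
      then show ?thesis using coroot_lattice.zero[of r] by simp
    next
      case False
      then have m: "m < r" "0 < r" "m \<noteq> 0" using Suc by auto
      have "unit_vec r m - unit_vec r 0 \<in> coroot_lattice r"
        using coroot_in_lattice[OF diff_root[OF m]] coroot_diff(1)[OF m] by simp
      then have "?u m + of_int (d m) \<cdot>\<^sub>v (unit_vec r m - unit_vec r 0) \<in> coroot_lattice r"
        using Suc by (intro coroot_lattice_add coroot_lattice_smult) auto
      also have "?u m + of_int (d m) \<cdot>\<^sub>v (unit_vec r m - unit_vec r 0) = ?u (Suc m)"
        using m by (intro eq_vecI) (auto simp: less_Suc_eq)
      finally show ?thesis .
    qed
  qed
  from this[of r] have u: "?u r \<in> coroot_lattice r" by simp
  obtain k where k: "(\<Sum>i<r. d i) = 2 * k" using even by auto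
  have "2 \<cdot>\<^sub>v unit_vec r 0 \<in> coroot_lattice r"
    using coroot_in_lattice[OF unit_root(1)[of 0 r]] coroot_unit[of 0 r] r by simp
  then have "?u r + of_int k \<cdot>\<^sub>v (2 \<cdot>\<^sub>v unit_vec r 0) \<in> coroot_lattice r"
    by (intro coroot_lattice_add u coroot_lattice_smult)
  also have "?u r + of_int k \<cdot>\<^sub>v (2 \<cdot>\<^sub>v unit_vec r 0) = vec r (\<lambda>i. of_int (d i))"
    unfolding k by (intro eq_vecI) auto
  finally show ?thesis .
qed

lemma weight_lattice_Ints:
  assumes r: "r \<ge> 2" and x: "x \<in> weight_lattice r"
  shows "2 * x $ 0 \<in> \<int>" and "i < r \<Longrightarrow> x $ i - x $ 0 \<in> \<int>"
proof -
  have c: "x \<in> carrier_vec r" using x by (simp add: weight_lattice_def)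
  have "x \<bullet> coroot (unit_vec r 0) \<in> \<int>" using x unit_root(1)[of 0 r] r by (simp add: weight_lattice_def)
  then show "2 * x $ 0 \<in> \<int>" using r c by (simp add: coroot_unit)
  show "x $ i - x $ 0 \<in> \<int>" if i: "i < r"
  proof (cases "i = 0")
    case False
    have "x \<bullet> coroot (unit_vec r i - unit_vec r 0) \<in> \<int>" using x diff_root[of i r 0] i r False by (simp add: weight_lattice_def)
    then show ?thesis using r c i False by (simp add: coroot_diff scalar_prod_minus_distrib[of _ r])
  qed simp
qed

text \<open>Two bits determine the coset of a weight: whether its coordinates are integral, and the
  parity of the sum of their floors. So there are at most four cosets; what matters later is that
  their number, a factor of S, is not zero.\<close>

lemma weight_coroot_quotient_finite:
  assumes r: "r \<ge> 2"
  shows "finite (weight_coroot_quotient r)" "weight_coroot_quotient r \<noteq> {}"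
proof -
  let ?P = "weight_lattice r" and ?R = "{(x, y). x \<in> weight_lattice r \<and> y \<in> weight_lattice r \<and> x - y \<in> coroot_lattice r}"
  define f where "f x = (x $ 0 \<in> \<int>, even (\<Sum>i<r. \<lfloor>x $ i\<rfloor>))" for x :: "real vec"
  have key: "?R `` {x} = ?R `` {y}" if x: "x \<in> ?P" and y: "y \<in> ?P" and fxy: "f x = f y" for x y
  proof -
    have cx: "x \<in> carrier_vec r" and cy: "y \<in> carrier_vec r" using x y by (simp_all add: weight_lattice_def)
    have half: "z $ 0 = of_int \<lfloor>z $ 0\<rfloor> + (if z $ 0 \<in> \<int> then 0 else 1 / 2)" if zP: "z \<in> ?P" for z
    proof -
      obtain k where k: "2 * z $ 0 = of_int k" using weight_lattice_Ints(1)[OF r zP] by (auto elim: Ints_cases)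
      show ?thesis
      proof (cases "even k")
        case True
        then obtain q where "k = 2 * q" by auto
        then have "z $ 0 = of_int q" using k by simp
        then show ?thesis by simp
      next
        case False
        then obtain q where "k = 2 * q + 1" by (auto elim: oddE)
        then have z: "z $ 0 = of_int q + 1 / 2" using k by simp
        have fl: "\<lfloor>z $ 0\<rfloor> = q" unfolding z by linarith
        have "z $ 0 \<notin> \<int>" using z fl by (auto elim!: Ints_cases)
        then show ?thesis using z fl by simp
      qed
    qed
    have coord: "z $ i = of_int \<lfloor>z $ i\<rfloor> + (if z $ 0 \<in> \<int> then 0 else 1 / 2)" if z: "z \<in> ?P" and i: "i < r" for z i
    proof -
      obtain k where "z $ i - z $ 0 = of_int k" using weight_lattice_Ints(2)[OF r z i] by (auto elim: Ints_cases)
      then have e: "z $ i = of_int (\<lfloor>z $ 0\<rfloor> + k) + (if z $ 0 \<in> \<int> then 0 else 1 / 2)" using half[OF z] by simp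
      have "\<lfloor>z $ i\<rfloor> = \<lfloor>z $ 0\<rfloor> + k" unfolding e by (auto simp: floor_add) 
      then show ?thesis using e by simp
    qed
    have "x - y = vec r (\<lambda>i. of_int (\<lfloor>x $ i\<rfloor> - \<lfloor>y $ i\<rfloor>))"
    proof (rule eq_vecI)
      fix i assume "i < dim_vec (vec r (\<lambda>i. real_of_int (\<lfloor>x $ i\<rfloor> - \<lfloor>y $ i\<rfloor>)))"
      then have i: "i < r" by simp
      have "x $ 0 \<in> \<int> \<longleftrightarrow> y $ 0 \<in> \<int>" using fxy by (simp add: f_def)
      then have "x $ i - y $ i = of_int (\<lfloor>x $ i\<rfloor> - \<lfloor>y $ i\<rfloor>)" using coord[OF x i] coord[OF y i] by simp
      then show "(x - y) $ i = vec r (\<lambda>i. real_of_int (\<lfloor>x $ i\<rfloor> - \<lfloor>y $ i\<rfloor>)) $ i"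
        using i cx cy by simp
    qed (use cx cy in simp)
    moreover have "even (\<Sum>i<r. \<lfloor>x $ i\<rfloor> - \<lfloor>y $ i\<rfloor>)"
      using fxy by (simp add: f_def sum_subtractf)
    ultimately have xy: "x - y \<in> coroot_lattice r" using even_sum_in_coroot_lattice[OF r] by metis
    have "x - z \<in> coroot_lattice r \<longleftrightarrow> y - z \<in> coroot_lattice r" if z: "z \<in> carrier_vec r" for z
    proof
      assume "x - z \<in> coroot_lattice r"
      then have "- (x - y) + (x - z) \<in> coroot_lattice r" using xy by (intro coroot_lattice_add coroot_lattice_uminus)
      also have "- (x - y) + (x - z) = y - z" using cx cy z by (intro eq_vecI) auto
      finally show "y - z \<in> coroot_lattice r" .
    next
      assume "y - z \<in> coroot_lattice r"
      then have "(x - y) + (y - z) \<in> coroot_lattice r" using xy by (intro coroot_lattice_add)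
      also have "(x - y) + (y - z) = x - z" using cx cy z by (intro eq_vecI) auto
      finally show "x - z \<in> coroot_lattice r" .
    qed
    then show ?thesis using x y by (auto simp: weight_lattice_def)
  qed
  define G where "G v = ?R `` {SOME x. x \<in> ?P \<and> f x = v}" for v
  have "weight_coroot_quotient r \<subseteq> range G"
  proof
    fix X assume "X \<in> weight_coroot_quotient r"
    then obtain x where x: "x \<in> ?P" "X = ?R `` {x}"
      unfolding weight_coroot_quotient_def by (rule quotientE)
    define y where "y = (SOME z. z \<in> ?P \<and> f z = f x)"
    have y: "y \<in> ?P \<and> f y = f x"
      unfolding y_def by (rule someI[of _ x]) (use x in simp)
    then have "?R `` {x} = ?R `` {y}" using key[OF x(1), of y] by (simp only: simp_thms)
    then have "X = G (f x)" unfolding x(2) G_def y_def[symmetric] .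
    then show "X \<in> range G" by (simp only: rangeI)
  qed
  then show "finite (weight_coroot_quotient r)" by (rule finite_subset) (rule finite_imageI, rule finite)
  have "0\<^sub>v r \<in> ?P"
  proof -
    have "(0\<^sub>v r :: real vec) \<bullet> coroot \<alpha> = 0" if "\<alpha> \<in> roots r" for \<alpha>
    proof -
      have "\<alpha> \<in> carrier_vec r" using that by (cases rule: roots_cases) auto
      then show ?thesis by (simp add: coroot_def)
    qed
    then show ?thesis by (simp add: weight_lattice_def)
  qed
  then have "?R `` {0\<^sub>v r} \<in> weight_coroot_quotient r"
    unfolding weight_coroot_quotient_def by (rule quotientI)
  then show "weight_coroot_quotient r \<noteq> {}" by blast
qed

end

section \<open>Minors of sine matrices\<close>

lemma det_scale_rows_cols:
  fixes f :: "nat \<Rightarrow> 'a :: comm_ring_1"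
  shows "det (mat n n (\<lambda>(i, j). f i * g j * A i j)) = prod f {0..<n} * prod g {0..<n} * det (mat n n (\<lambda>(i, j). A i j))"
proof -
  have "signof p * (\<Prod>i = 0..<n. f i * g (p i) * A i (p i)) = prod f {0..<n} * prod g {0..<n} * (signof p * (\<Prod>i = 0..<n. A i (p i)))"
    if p: "p permutes {0..<n}" for p
  proof -
    have "(\<Prod>i = 0..<n. g (p i)) = prod g {0..<n}" using prod.permute[OF p, of g] by (simp add: o_def)
    then show ?thesis by (simp add: prod.distrib mult_ac)
  qed
  moreover have "(\<Prod>i = 0..<n. mat n n (\<lambda>(i, j). B i j) $$ (i, p i)) = (\<Prod>i = 0..<n. B i (p i))" if "p permutes {0..<n}" for p and B :: "nat \<Rightarrow> nat \<Rightarrow> 'a"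
    using that by (intro prod.cong refl) (auto dest: permutes_in_image)
  ultimately show ?thesis
    by (simp add: det_def'[of _ n] sum_distrib_left)
qed

text \<open>If the product of A with its transpose is a diagonal matrix D, multiplying it from the
  left by the adjugate gives adj(A) D = det(A) A^T. An entry of this is a minor on one side and an
  entry of A on the other.\<close>

lemma orthogonal_rows_minor:
  fixes A :: "'a :: comm_ring_1 mat"
  assumes A: "A \<in> carrier_mat n n" and orth: "A * transpose_mat A = mat n n (\<lambda>(i, j). if i = j then d i else 0)"
    and ij: "i < n" "j < n"
  shows "(- 1) ^ (i + j) * det (mat_delete A i j) * d i = det A * A $$ (i, j)"
    and "det A * det A = prod d {0..<n}"
proof -
  have adj: "adj_mat A \<in> carrier_mat n n" "adj_mat A * A = det A \<cdot>\<^sub>m 1\<^sub>m n" using adj_mat[OF A] by auto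
  have "adj_mat A * (A * transpose_mat A) = det A \<cdot>\<^sub>m transpose_mat A"
    using adj A by (subst assoc_mult_mat[symmetric, of _ n n _ n _ n]) auto
  then have "(adj_mat A * mat n n (\<lambda>(i, j). if i = j then d i else 0)) $$ (j, i) = det A * A $$ (i, j)"
    using orth ij A by simp
  moreover have "(adj_mat A * mat n n (\<lambda>(i, j). if i = j then d i else 0)) $$ (j, i) = (\<Sum>k = 0..<n. adj_mat A $$ (j, k) * (if k = i then d k else 0))"
    using adj(1) ij by (simp add: scalar_prod_def)
  moreover have "\<dots> = adj_mat A $$ (j, i) * d i"
    using ij by (simp add: if_distrib[of "(*) _"] cong: if_cong)
  moreover have "adj_mat A $$ (j, i) = (- 1) ^ (i + j) * det (mat_delete A i j)"
    using A ij by (simp add: adj_mat_def cofactor_def)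
  ultimately show "(- 1) ^ (i + j) * det (mat_delete A i j) * d i = det A * A $$ (i, j)" by simp
  have "det (mat n n (\<lambda>(i, j). if i = j then d i else 0)) = prod_list (diag_mat (mat n n (\<lambda>(i, j). if i = j then d i else 0)))"
    by (rule det_upper_triangular[of _ n]) auto
  also have "diag_mat (mat n n (\<lambda>(i, j). if i = j then d i else 0)) = map d [0..<n]"
    by (simp add: diag_mat_def)
  also have "prod_list (map d [0..<n]) = prod d {0..<n}"
    using prod.distinct_set_conv_list[of "[0..<n]" d] by simp
  finally show "det A * det A = prod d {0..<n}"
    using det_mult[OF A, of "transpose_mat A"] det_transpose[OF A] A orth by simp
qed

text \<open>The two sine matrices whose maximal minors are the entries of the $S$-matrix; the arguments
  $N - \frac12 - q$ and $N - p$ decrease, as do the coordinates of a dominant weight.\<close>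
definition half_sines :: "nat \<Rightarrow> real mat" where
  "half_sines N = mat N N (\<lambda>(p, q). sin (pi / real N * ((real N - 1 / 2 - real q) * (real N - 1 / 2 - real p))))"

definition mixed_sines :: "nat \<Rightarrow> real mat" where
  "mixed_sines N = mat N N (\<lambda>(p, q). sin (pi / real N * ((real N - 1 / 2 - real q) * (real N - real p))))"

lemma sum_cos_half:
  fixes D :: int
  assumes "N > 0"
  shows "(\<Sum>q = 0..<N. cos (pi / real N * ((real N - 1 / 2 - real q) * of_int D))) =
    (if 4 * int N dvd D then real N else if 4 * int N dvd D - 2 * int N then - real N else 0)"
proof -
  have "(\<Sum>q = 0..<N. cos (pi / real N * ((real N - 1 / 2 - real q) * of_int D))) = (\<Sum>e = 0..<N. cos (real (2 * e + 1) * (pi * of_int D / (2 * real N) * 1)))"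
  proof (rule sum.reindex_bij_witness[of _ "\<lambda>e. N - 1 - e" "\<lambda>q. N - 1 - q"])
    fix q assume "q \<in> {0..<N}"
    define e where "e = N - 1 - q"
    have e: "real N = real q + 1 + real e" using \<open>q \<in> {0..<N}\<close> by (simp add: e_def)
    have "real (2 * (N - 1 - q) + 1) * (pi * of_int D / (2 * real N) * 1) = pi / real N * ((real N - 1 / 2 - real q) * of_int D)"
      unfolding e_def[symmetric] by (simp add: e field_simps)
    then show "cos (real (2 * (N - 1 - q) + 1) * (pi * of_int D / (2 * real N) * 1)) = cos (pi / real N * ((real N - 1 / 2 - real q) * of_int D))"
      by (simp only:)
  qed auto
  also have "\<dots> = (\<Sum>e<N. cos (real (2 * e + 1) * (pi * of_int D / (2 * real N))))"
    by (simp only: mult_1_right atLeast0LessThan)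
  also have "\<dots> = (if 4 * int N dvd D then real N else if 4 * int N dvd D - 2 * int N then - real N else 0)"
    by (rule sum_cos_odd[OF assms])
  finally show ?thesis .
qed

lemma sum_sin_half:
  fixes u v :: real and D D' :: int
  assumes "N > 0" "u - v = of_int D" "u + v = of_int D'" "- int N < D" "D < int N" "0 < D'" "D' \<le> 2 * int N"
  shows "(\<Sum>q = 0..<N. sin (pi / real N * ((real N - 1 / 2 - real q) * u)) * sin (pi / real N * ((real N - 1 / 2 - real q) * v))) =
    (if D = 0 then real N / 2 else 0) + (if D' = 2 * int N then real N / 2 else 0)"
proof -
  have "sin (pi / real N * (a * u)) * sin (pi / real N * (a * v)) = (cos (pi / real N * (a * of_int D)) - cos (pi / real N * (a * of_int D'))) / 2" for a
    unfolding assms(2,3)[symmetric] sin_times_sin by (simp add: algebra_simps)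
  then have "(\<Sum>q = 0..<N. sin (pi / real N * ((real N - 1 / 2 - real q) * u)) * sin (pi / real N * ((real N - 1 / 2 - real q) * v)))
    = ((\<Sum>q = 0..<N. cos (pi / real N * ((real N - 1 / 2 - real q) * of_int D))) - (\<Sum>q = 0..<N. cos (pi / real N * ((real N - 1 / 2 - real q) * of_int D')))) / 2"
    by (simp only: sum_divide_distrib[symmetric] sum_subtractf)
  moreover have "4 * int N dvd D \<longleftrightarrow> D = 0"
    using assms(4,5) dvd_imp_le_int[of D "4 * int N"] by fastforce
  moreover have "\<not> 4 * int N dvd D - 2 * int N"
    using assms(1,4,5) dvd_imp_le_int[of "D - 2 * int N" "4 * int N"] by fastforce
  moreover have "\<not> 4 * int N dvd D'"
    using assms(6,7) zdvd_imp_le[of "4 * int N" D'] by fastforce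
  moreover have "4 * int N dvd D' - 2 * int N \<longleftrightarrow> D' = 2 * int N"
    using assms(6,7) dvd_imp_le_int[of "D' - 2 * int N" "4 * int N"] by fastforce
  ultimately show ?thesis unfolding sum_cos_half[OF assms(1)] by (cases "D = 0"; cases "D' = 2 * int N") simp_all
qed

lemma half_sines_orth:
  assumes "N > 0"
  shows "half_sines N * transpose_mat (half_sines N) = mat N N (\<lambda>(i, j). if i = j then real N / 2 else 0)"
    (is "_ = ?D")
proof (rule eq_matI)
  fix p p' assume "p < dim_row ?D" "p' < dim_col ?D"
  then have p: "p < N" "p' < N" by simp_all
  have "(half_sines N * transpose_mat (half_sines N)) $$ (p, p') = (\<Sum>q = 0..<N. sin (pi / real N * ((real N - 1 / 2 - real q) * (real N - 1 / 2 - real p))) * sin (pi / real N * ((real N - 1 / 2 - real q) * (real N - 1 / 2 - real p'))))"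
    using p by (simp add: half_sines_def scalar_prod_def)
  also have "\<dots> = (if int p' - int p = 0 then real N / 2 else 0) + (if 2 * int N - 1 - int p - int p' = 2 * int N then real N / 2 else 0)"
    using p by (intro sum_sin_half[OF assms]) auto
  finally show "(half_sines N * transpose_mat (half_sines N)) $$ (p, p') = ?D $$ (p, p')"
    using p by auto
qed (simp_all add: half_sines_def)

text \<open>Row 0 has the argument N, where all sines are sines of half-integral multiples of \<pi>,
  hence 1 or -1: squared norm N instead of N/2.\<close>

lemma mixed_sines_orth:
  assumes "N > 0"
  shows "mixed_sines N * transpose_mat (mixed_sines N) = mat N N (\<lambda>(i, j). if i = j then (if i = 0 then real N else real N / 2) else 0)"
    (is "_ = ?D")
proof (rule eq_matI)
  fix p p' assume "p < dim_row ?D" "p' < dim_col ?D"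
  then have p: "p < N" "p' < N" by simp_all
  have "(mixed_sines N * transpose_mat (mixed_sines N)) $$ (p, p') = (\<Sum>q = 0..<N. sin (pi / real N * ((real N - 1 / 2 - real q) * (real N - real p))) * sin (pi / real N * ((real N - 1 / 2 - real q) * (real N - real p'))))"
    using p by (simp add: mixed_sines_def scalar_prod_def)
  also have "\<dots> = (if int p' - int p = 0 then real N / 2 else 0) + (if 2 * int N - int p - int p' = 2 * int N then real N / 2 else 0)"
    using p by (intro sum_sin_half[OF assms]) auto
  finally show "(mixed_sines N * transpose_mat (mixed_sines N)) $$ (p, p') = ?D $$ (p, p')"
    using p by auto
qed (simp_all add: mixed_sines_def)

lemma sin_pi_nat_plus: "sin (pi * real m + x) = (- 1) ^ m * sin x"
  by (induction m) (simp_all add: algebra_simps sin_add flip: add.assoc)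

text \<open>Expanding (N - k - 1/2)(N - i - 1/2) splits off multiples of \<pi>. The sign they
  produce cancels the cofactor sign up to one independent of i and k.\<close>

lemma half_sines_minor:
  assumes "N > 0" "i < N" "k < N"
  shows "det (mat_delete (half_sines N) i k) = (- 1) ^ (N + 1) * (2 / real N) * det (half_sines N) * sn N (int (2 * i + 1) * int (2 * k + 1))"
proof -
  have c: "half_sines N \<in> carrier_mat N N" by (simp add: half_sines_def)
  have "pi / real N * ((real N - 1 / 2 - real k) * (real N - 1 / 2 - real i)) = pi * real N + (- (pi * real (i + k + 1)) + pi * of_int (int (2 * i + 1) * int (2 * k + 1)) / (4 * real N))"
    using assms(1) by (simp add: field_simps)
  moreover have "sin (- (pi * real m) + x) = (- 1) ^ m * sin x" for m x
    using sin_pi_nat_plus[of m "- x"] by (metis minus_add_distrib minus_minus mult_minus_right sin_minus)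
  ultimately have "half_sines N $$ (i, k) = (- 1) ^ N * ((- 1) ^ (i + k + 1) * sn N (int (2 * i + 1) * int (2 * k + 1)))"
    using assms by (simp only: half_sines_def index_mat case_prod_conv sin_pi_nat_plus sn_def)
  then have "(- 1) ^ (i + k) * det (mat_delete (half_sines N) i k) * (real N / 2) = det (half_sines N) * ((- 1) ^ N * ((- 1) ^ (i + k + 1) * sn N (int (2 * i + 1) * int (2 * k + 1))))"
    using orthogonal_rows_minor(1)[OF c half_sines_orth[OF assms(1)] assms(2,3)] by simp
  then have "(- 1) ^ (i + k) * (det (mat_delete (half_sines N) i k) * (real N / 2)) = (- 1) ^ (i + k) * (det (half_sines N) * ((- 1) ^ (N + 1) * sn N (int (2 * i + 1) * int (2 * k + 1))))"
    by (simp add: mult_ac)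
  then have "det (mat_delete (half_sines N) i k) * (real N / 2) = det (half_sines N) * ((- 1) ^ (N + 1) * sn N (int (2 * i + 1) * int (2 * k + 1)))"
    by (subst (asm) mult_cancel_left) auto
  then show ?thesis using assms(1) by (simp add: field_simps)
qed

text \<open>As for \<open>half_sines\<close>, except that rewriting the cosine as a sine at an index
  from 2N on leaves a sign (-1)^i. It is absorbed later by \<open>index_of\<close>.\<close>

lemma mixed_sines_minor:
  assumes "N > 0" "j < N" "i < N"
  shows "det (mat_delete (mixed_sines N) j i) = (- 1) ^ (N + 1) * (2 / real N) * det (mixed_sines N) *
    ((if j = 0 then 1 / 2 else 1) * ((- 1) ^ i * sn N (int (2 * i + 1) * int (2 * N + 2 * j))))"
proof -
  have c: "mixed_sines N \<in> carrier_mat N N" by (simp add: mixed_sines_def)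
  let ?t = "pi * real (j * (2 * i + 1)) / (2 * real N)"
  have "pi / real N * ((real N - 1 / 2 - real i) * (real N - real j)) = pi * real N + (- (pi * real (i + j)) + (?t - pi / 2))"
    using assms(1) by (simp add: field_simps)
  moreover have "sin (- (pi * real m) + x) = (- 1) ^ m * sin x" for m x
    using sin_pi_nat_plus[of m "- x"] by (metis minus_add_distrib minus_minus mult_minus_right sin_minus)
  ultimately have "mixed_sines N $$ (j, i) = (- 1) ^ N * ((- 1) ^ (i + j) * sin (?t - pi / 2))"
    using assms by (simp only: mixed_sines_def index_mat case_prod_conv sin_pi_nat_plus)
  moreover have "sin (?t - pi / 2) = - cos ?t" by (simp add: sin_diff)
  moreover have "sn N (int (2 * i + 1) * int (2 * N + 2 * j)) = (- 1) ^ i * cos ?t"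
  proof -
    have "pi * of_int (int (2 * i + 1) * int (2 * N + 2 * j)) / (4 * real N) = pi * real i + (pi / 2 + ?t)"
      using assms(1) by (simp add: field_simps)
    then have "sn N (int (2 * i + 1) * int (2 * N + 2 * j)) = (- 1) ^ i * sin (pi / 2 + ?t)"
      by (simp only: sn_def sin_pi_nat_plus)
    then show ?thesis by (simp add: sin_add)
  qed
  then have "cos ?t = (- 1) ^ i * sn N (int (2 * i + 1) * int (2 * N + 2 * j))"
    by (simp flip: mult.assoc power_add mult_2)
  ultimately have e: "mixed_sines N $$ (j, i) = (- 1) ^ (j + i) * ((- 1) ^ (N + 1) * ((- 1) ^ i * sn N (int (2 * i + 1) * int (2 * N + 2 * j))))"
    by (simp add: mult_ac add.commute)
  let ?d = "if j = 0 then real N else real N / 2"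
  have "(- 1) ^ (j + i) * (det (mat_delete (mixed_sines N) j i) * ?d) = (- 1) ^ (j + i) * (det (mixed_sines N) * ((- 1) ^ (N + 1) * ((- 1) ^ i * sn N (int (2 * i + 1) * int (2 * N + 2 * j)))))"
    using orthogonal_rows_minor(1)[OF c mixed_sines_orth[OF assms(1)] assms(2,3)] unfolding e by (simp only: mult_ac)
  then have "det (mat_delete (mixed_sines N) j i) * ?d = det (mixed_sines N) * ((- 1) ^ (N + 1) * ((- 1) ^ i * sn N (int (2 * i + 1) * int (2 * N + 2 * j))))"
    by (subst (asm) mult_cancel_left) auto
  then show ?thesis using assms(1) by (simp add: field_simps split: if_splits)
qed

text \<open>The squared determinants are the products of the squared row norms; the exceptional row
  of \<open>mixed_sines\<close> accounts for the factor 2, the origin of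
  \<open>k2\<^sup>2 = 2 * k1\<^sup>2\<close>.\<close>

lemma sines_det:
  assumes "N > 0"
  shows "(det (half_sines N))\<^sup>2 \<noteq> 0" "(det (mixed_sines N))\<^sup>2 = 2 * (det (half_sines N))\<^sup>2"
proof -
  have h: "(det (half_sines N))\<^sup>2 = (real N / 2) ^ N"
    using orthogonal_rows_minor(2)[of "half_sines N" N "\<lambda>_. real N / 2" 0 0] half_sines_orth[OF assms] assms
    by (simp add: half_sines_def power2_eq_square)
  then show "(det (half_sines N))\<^sup>2 \<noteq> 0" using assms by simp
  have "(det (mixed_sines N))\<^sup>2 = (\<Prod>i = 0..<N. if i = 0 then real N else real N / 2)"
    using orthogonal_rows_minor(2)[of "mixed_sines N" N "\<lambda>i. if i = 0 then real N else real N / 2" 0 0] mixed_sines_orth[OF assms] assms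
    by (simp add: mixed_sines_def power2_eq_square)
  also have "\<dots> = 2 * (\<Prod>i = 0..<N. real N / 2)"
    using assms by (cases N) (simp_all add: prod.atLeast0_lessThan_Suc_shift del: prod.op_ivl_Suc)
  finally show "(det (mixed_sines N))\<^sup>2 = 2 * (det (half_sines N))\<^sup>2" by (simp add: h)
qed

section \<open>Weights of level 3\<close>

text \<open>Labels for the level 3 weights: \<open>(False, i, e)\<close> is $\Lambda_i$ and \<open>(True, i, e)\<close> is
  $\Lambda_r + \Lambda_i$, with $2\Lambda_r$ in place of $\Lambda_i$ for $i = r$, filled up with
  multiples of $\Lambda_0$; \<open>e\<close> records an application of $J_b$.\<close>
definition labels :: "nat \<Rightarrow> (bool \<times> nat \<times> bool) set" where
  "labels r = {(s, i, e). i \<le> r \<and> (s \<and> e \<longrightarrow> i = 0)}"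

definition label0 :: "bool \<Rightarrow> nat \<Rightarrow> nat" where
  "label0 s i = (if i = 0 then if s then 2 else 3 else if i = 1 then if s then 1 else 2 else if s then 0 else 1)"

definition label1 :: "nat \<Rightarrow> nat" where
  "label1 i = (if i = 1 then 1 else 0)"

fun weight_of :: "nat \<Rightarrow> bool \<times> nat \<times> bool \<Rightarrow> nat vec" where
  "weight_of r (s, i, e) = vec (r + 1) (\<lambda>k.
     if k = 0 then if e then label1 i else label0 s i
     else if k = 1 then if e then label0 s i else label1 i
     else if k = r then (if s then 1 else 0) + (if i = r then 2 else 0)
     else if k = i then 1 else 0)"

text \<open>The twist \<open>e = odd i\<close> encodes two signs. Against odd \<lambda>_r, S
  acquires (-1)^i from \<open>mixed_sines_minor\<close> and -1 from J_b, and replacing 2i + 1 by 4N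
  - (2i + 1) negates the sine at even frequencies. Against even \<lambda>_r the replacement is
  invisible.\<close>

fun index_of :: "nat \<Rightarrow> bool \<times> nat \<times> bool \<Rightarrow> nat" where
  "index_of r (s, i, e) =
     (if s then if e then 4 * (r + 1) else 2 * (r + 1) + 2 * i
      else if e = odd i then 2 * i + 1 else 4 * (r + 1) - (2 * i + 1))"

text \<open>The decreasing list r + 1 - k or r + 1/2 - k for k from 0 to r, with the entry k = i
  left out; such a gap matches a deleted row or column.\<close>

fun base_coord :: "nat \<Rightarrow> bool \<times> nat \<times> bool \<Rightarrow> nat \<Rightarrow> real" where
  "base_coord r (s, i, e) p = real r + (if s then 1 else 1 / 2) - real (if p < i then p else Suc p)"

text \<open>On shifted weights J_b is the affine reflection of the first coordinate about N, where
  2N is the height.\<close>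

fun coord :: "nat \<Rightarrow> bool \<times> nat \<times> bool \<Rightarrow> nat \<Rightarrow> real" where
  "coord r (s, i, e) p = (if e \<and> p = 0 then 2 * (real r + 1) - base_coord r (s, i, e) p else base_coord r (s, i, e) p)"

context
  fixes r :: nat
  assumes r3: "r \<ge> 3"
begin

lemma index_of_bij: "bij_betw (index_of r) (labels r) (Od (r + 1) \<union> Ev (r + 1))"
  unfolding bij_betw_def
proof
  show "inj_on (index_of r) (labels r)"
  proof (rule inj_onI)
    fix x y assume xy: "x \<in> labels r" "y \<in> labels r" "index_of r x = index_of r y"
    obtain s i e s' i' e' where x: "x = (s, i, e)" and y: "y = (s', i', e')"
      by (cases x, cases y) auto
    note l = xy(1,2)[unfolded x y] and eq = xy(3)[unfolded x y]
    have i: "i \<le> r" "i' \<le> r" "s \<and> e \<Longrightarrow> i = 0" "s' \<and> e' \<Longrightarrow> i' = 0" using l by (auto simp: labels_def)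
    have "even (index_of r (s, i, e)) = s" "even (index_of r (s', i', e')) = s'"
      using i by (auto simp: even_diff_nat)
    then have s: "s = s'" using eq by simp
    show "x = y"
    proof (cases s)
      case True
      then show ?thesis unfolding x y using eq s i by (cases e; cases e') auto
    next
      case False
      have eq': "(if e = odd i then 2 * i + 1 else 4 * r + 3 - 2 * i) = (if e' = odd i' then 2 * i' + 1 else 4 * r + 3 - 2 * i')"
      proof -
        have "4 * (r + 1) - (2 * k + 1) = 4 * r + 3 - 2 * k" for k by simp
        then show ?thesis using eq s False by (simp only: index_of.simps if_False)
      qed
      then have ii: "i = i'" using i by (simp split: if_splits; linarith)
      have "2 * i + 1 \<noteq> 4 * r + 3 - 2 * i" using i by linarith
      then have "e = odd i \<longleftrightarrow> e' = odd i" using eq' unfolding ii by (auto split: if_splits)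
      then show ?thesis unfolding x y using s ii by auto
    qed
  qed
  show "index_of r ` labels r = Od (r + 1) \<union> Ev (r + 1)"
  proof (intro equalityI subsetI)
    fix t assume "t \<in> index_of r ` labels r"
    then obtain s i e where "(s, i, e) \<in> labels r" "t = index_of r (s, i, e)" by auto
    then show "t \<in> Od (r + 1) \<union> Ev (r + 1)"
      by (cases s) (auto simp: labels_def Od_def Ev_def even_diff_nat)
  next
    fix t assume "t \<in> Od (r + 1) \<union> Ev (r + 1)"
    then show "t \<in> index_of r ` labels r"
    proof
      assume "t \<in> Ev (r + 1)"
      then have t: "even t" "2 * (r + 1) \<le> t" "t \<le> 4 * (r + 1)" by (auto simp: Ev_def)
      show ?thesis
      proof (cases "t = 4 * (r + 1)")
        case True
        then have "t = index_of r (True, 0, True)" by simp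
        then show ?thesis by (rule image_eqI) (simp add: labels_def)
      next
        case False
        obtain u where u: "t = 2 * u" using t(1) by (rule evenE)
        have "t = index_of r (True, u - (r + 1), False)" using u t by simp
        then show ?thesis using u t False by (intro image_eqI[of _ _ "(True, u - (r + 1), False)"]) (auto simp: labels_def)
      qed
    next
      assume "t \<in> Od (r + 1)"
      then have t: "odd t" "t < 4 * (r + 1)" by (auto simp: Od_def)
      obtain u where u: "t = 2 * u + 1" using t(1) by (rule oddE)
      show ?thesis
      proof (cases "u \<le> r")
        case True
        have "t = index_of r (False, u, odd u)" using u by simp
        then show ?thesis using True by (intro image_eqI[of _ _ "(False, u, odd u)"]) (auto simp: labels_def)
      next
        case False
        define v where "v = 2 * r + 1 - u"
        have v: "u = 2 * r + 1 - v" "v \<le> r" using u t False by (auto simp: v_def)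
        then have "t = index_of r (False, v, even v)" using u by simp
        then show ?thesis using v by (intro image_eqI[of _ _ "(False, v, even v)"]) (auto simp: labels_def)
      qed
    qed
  qed
qed

lemma weight_of_index:
  "weight_of r (s, i, e) $ 0 = (if e then label1 i else label0 s i)"
  "weight_of r (s, i, e) $ 1 = (if e then label0 s i else label1 i)"
  "weight_of r (s, i, e) $ r = (if s then 1 else 0) + (if i = r then 2 else 0)"
  "2 \<le> k \<Longrightarrow> k < r \<Longrightarrow> weight_of r (s, i, e) $ k = (if k = i then 1 else 0)"
  using r3 by simp_all

lemma weight_of_P_plus:
  assumes "(s, i, e) \<in> labels r"
  shows "weight_of r (s, i, e) \<in> P_plus r 3"
proof -
  have i: "i \<le> r" "s \<and> e \<Longrightarrow> i = 0" using assms by (auto simp: labels_def)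
  have "(\<Sum>k = 2..r - 1. weight_of r (s, i, e) $ k) = (\<Sum>k = 2..r - 1. if k = i then 1 else 0)"
    using r3 by (intro sum.cong refl) (auto simp del: weight_of.simps simp: weight_of_index)
  also have "\<dots> = (if 2 \<le> i \<and> i < r then 1 else 0)" using r3 by auto
  finally have "(\<Sum>k = 2..r - 1. weight_of r (s, i, e) $ k) = (if 2 \<le> i \<and> i < r then 1 else 0)" .
  moreover have "weight_of r (s, i, e) \<in> carrier_vec (r + 1)" by simp
  ultimately show ?thesis using i r3 unfolding P_plus_def mem_Collect_eq weight_of_index
    by (cases e; cases s) (auto simp: label0_def label1_def)
qed

lemma weight_of_inj: "inj_on (weight_of r) (labels r)"
proof (rule inj_onI)
  fix x y assume xy: "x \<in> labels r" "y \<in> labels r" "weight_of r x = weight_of r y"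
  obtain s i e s' i' e' where x: "x = (s, i, e)" and y: "y = (s', i', e')"
    by (cases x, cases y) auto
  note l = xy(1,2)[unfolded x y] and eq = xy(3)[unfolded x y]
  have i: "i \<le> r" "i' \<le> r" "s \<and> e \<Longrightarrow> i = 0" "s' \<and> e' \<Longrightarrow> i' = 0" using l by (auto simp: labels_def)
  have e0: "(if e then label1 i else label0 s i) = (if e' then label1 i' else label0 s' i')"
    using arg_cong[OF eq, of "\<lambda>v. v $ 0"] unfolding weight_of_index .
  have e1: "(if e then label0 s i else label1 i) = (if e' then label0 s' i' else label1 i')"
    using arg_cong[OF eq, of "\<lambda>v. v $ 1"] unfolding weight_of_index .
  have er: "(if s then 1 else 0) + (if i = r then 2 else 0) = (if s' then 1 else 0) + (if i' = r then 2 else (0 :: nat))"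
    using arg_cong[OF eq, of "\<lambda>v. v $ r"] unfolding weight_of_index .
  have em: "(if k = i then 1 else 0) = (if k = i' then 1 else (0 :: nat))" if "2 \<le> k" "k < r" for k
    using arg_cong[OF eq, of "\<lambda>v. v $ k"] unfolding weight_of_index(4)[OF that] .
  have s: "s = s'" "i = r \<longleftrightarrow> i' = r" using er by (auto split: if_splits)
  have ii: "i = i'"
  proof (cases "(2 \<le> i \<and> i < r) \<or> (2 \<le> i' \<and> i' < r)")
    case True
    then show ?thesis
    proof (elim disjE conjE)
      assume "2 \<le> i" "i < r"
      from em[OF this] show ?thesis by (simp split: if_splits)
    next
      assume "2 \<le> i'" "i' < r"
      from em[OF this] show ?thesis by (simp split: if_splits)
    qed
  next
    case False
    then have "i = 0 \<or> i = 1 \<or> i = r" "i' = 0 \<or> i' = 1 \<or> i' = r" using i by auto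
    then show ?thesis using e0 e1 s r3
      by (elim disjE) (simp_all add: label0_def label1_def split: if_splits)
  qed
  have "e = e'"
  proof (rule ccontr)
    assume "e \<noteq> e'"
    then have "label0 s i = label1 i" using e0 unfolding s(1)[symmetric] ii[symmetric] by (cases e) auto
    moreover have "s \<longrightarrow> i = 0" using i(3,4) \<open>e \<noteq> e'\<close> unfolding s(1)[symmetric] ii[symmetric] by blast
    ultimately show False by (auto simp: label0_def label1_def split: if_splits)
  qed
  then show "x = y" unfolding x y using s(1) ii by blast
qed

lemma weight_eqI:
  assumes "v \<in> carrier_vec (r + 1)" "w \<in> carrier_vec (r + 1)" "v $ 0 = w $ 0" "v $ 1 = w $ 1" "v $ r = w $ r"
    and "\<And>k. 2 \<le> k \<Longrightarrow> k < r \<Longrightarrow> v $ k = w $ k"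
  shows "v = w"
proof (rule eq_vecI)
  fix k assume "k < dim_vec w"
  then consider "k = 0" | "k = 1" | "k = r" | "2 \<le> k" "k < r" using assms(2) by fastforce
  then show "v $ k = w $ k" using assms by cases auto
qed (use assms in auto)

text \<open>At level 3 the labels strictly between 1 and r sum to at most 1. If they vanish, ten
  triples of outer labels remain; otherwise one middle label is 1 and a single outer label is
  1.\<close>

lemma weight_of_surj:
  assumes "lam \<in> P_plus r 3"
  shows "lam \<in> weight_of r ` labels r"
proof -
  define m where "m = (\<Sum>k = 2..r - 1. lam $ k)"
  have c: "lam \<in> carrier_vec (r + 1)" and lev: "3 = lam $ 0 + lam $ 1 + 2 * m + lam $ r"
    using assms by (auto simp: P_plus_def m_def)
  have in_image: "lam \<in> weight_of r ` labels r"
    if "(s, i, e) \<in> labels r" "lam $ 0 = (if e then label1 i else label0 s i)" "lam $ 1 = (if e then label0 s i else label1 i)"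
      "lam $ r = (if s then 1 else 0) + (if i = r then 2 else 0)" "\<And>k. 2 \<le> k \<Longrightarrow> k < r \<Longrightarrow> lam $ k = (if k = i then 1 else 0)" for s i e
  proof -
    have "lam = weight_of r (s, i, e)"
      by (rule weight_eqI) (simp_all only: weight_of_index that c, simp)
    then show ?thesis using that(1) by blast
  qed
  have "m = 0 \<or> m = 1" using lev by presburger
  then show ?thesis
  proof
    assume m: "m = 0"
    then have mid: "lam $ k = 0" if "2 \<le> k" "k < r" for k using that by (auto simp: m_def)
    have im: "lam \<in> weight_of r ` labels r" if "(s, i, e) \<in> labels r" "i \<in> {0, 1, r}" "lam $ 0 = (if e then label1 i else label0 s i)" "lam $ 1 = (if e then label0 s i else label1 i)"
      "lam $ r = (if s then 1 else 0) + (if i = r then 2 else 0)" for s i e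
      using that by (intro in_image[OF that(1,3,4,5)]) (auto simp: mid)
    have sum3: "lam $ 0 + lam $ 1 + lam $ r = 3" using lev m by simp
    have "a = 3 \<and> b = 0 \<and> c = 0 \<or> a = 0 \<and> b = 3 \<and> c = 0 \<or> a = 2 \<and> b = 1 \<and> c = 0 \<or> a = 1 \<and> b = 2 \<and> c = 0 \<or>
      a = 2 \<and> b = 0 \<and> c = 1 \<or> a = 0 \<and> b = 2 \<and> c = 1 \<or> a = 1 \<and> b = 1 \<and> c = 1 \<or> a = 1 \<and> b = 0 \<and> c = 2 \<or>
      a = 0 \<and> b = 1 \<and> c = 2 \<or> a = 0 \<and> b = 0 \<and> c = 3" if "a + b + c = 3" for a b c :: nat
    proof -
      have "a = 0 \<or> a = 1 \<or> a = 2 \<or> a = 3" "c = 0 \<or> c = 1 \<or> c = 2 \<or> c = 3" using that by linarith+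
      then show ?thesis using that by (elim disjE) simp_all
    qed
    from this[OF sum3] show ?thesis
    proof (elim disjE conjE, goal_cases)
      case 1 then show ?thesis using r3 by (intro im[of False 0 False]) (auto simp: labels_def label0_def label1_def)
    next
      case 2 then show ?thesis using r3 by (intro im[of False 0 True]) (auto simp: labels_def label0_def label1_def)
    next
      case 3 then show ?thesis using r3 by (intro im[of False 1 False]) (auto simp: labels_def label0_def label1_def)
    next
      case 4 then show ?thesis using r3 by (intro im[of False 1 True]) (auto simp: labels_def label0_def label1_def)
    next
      case 5 then show ?thesis using r3 by (intro im[of True 0 False]) (auto simp: labels_def label0_def label1_def)
    next
      case 6 then show ?thesis using r3 by (intro im[of True 0 True]) (auto simp: labels_def label0_def label1_def)
    next
      case 7 then show ?thesis using r3 by (intro im[of True 1 False]) (auto simp: labels_def label0_def label1_def)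
    next
      case 8 then show ?thesis using r3 by (intro im[of False r False]) (auto simp: labels_def label0_def label1_def)
    next
      case 9 then show ?thesis using r3 by (intro im[of False r True]) (auto simp: labels_def label0_def label1_def)
    next
      case 10 then show ?thesis using r3 by (intro im[of True r False]) (auto simp: labels_def label0_def label1_def)
    qed
  next
    assume m: "m = 1"
    then have "\<exists>i\<in>{2..r - 1}. lam $ i = 1 \<and> (\<forall>k\<in>{2..r - 1}. i \<noteq> k \<longrightarrow> lam $ k = 0)"
      unfolding m_def by (subst (asm) sum_eq_1_iff) simp_all
    then obtain i where i: "i \<in> {2..r - 1}" "lam $ i = 1" "\<forall>k\<in>{2..r - 1}. i \<noteq> k \<longrightarrow> lam $ k = 0"
      by blast
    have mid: "lam $ k = (if k = i then 1 else 0)" if "2 \<le> k" "k < r" for k using i that by auto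
    have "lam $ 0 + lam $ 1 + lam $ r = 1" using lev m by simp
    then consider "lam $ 0 = 1" "lam $ 1 = 0" "lam $ r = 0" | "lam $ 0 = 0" "lam $ 1 = 1" "lam $ r = 0"
      | "lam $ 0 = 0" "lam $ 1 = 0" "lam $ r = 1" by linarith
    then show ?thesis
    proof cases
      case 1 then show ?thesis using i(1) mid by (intro in_image[of False i False]) (auto simp: labels_def label0_def label1_def)
    next
      case 2 then show ?thesis using i(1) mid by (intro in_image[of False i True]) (auto simp: labels_def label0_def label1_def)
    next
      case 3 then show ?thesis using i(1) mid by (intro in_image[of True i False]) (auto simp: labels_def label0_def label1_def)
    qed
  qed
qed

lemma weight_of_bij: "bij_betw (weight_of r) (labels r) (P_plus r 3)"
  unfolding bij_betw_def using weight_of_inj weight_of_P_plus weight_of_surj by auto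

lemma shifted_coord:
  assumes "p < r"
  shows "(finite_part r lam + finite_part r (rho r)) $ p = real (\<Sum>k\<in>{Suc p..<r}. lam $ k) + real (lam $ r) / 2 + (real r - real p - 1 / 2)"
proof -
  have fp: "finite_part r v $ p = real (\<Sum>k\<in>{Suc p..<r}. v $ k) + real (v $ r) / 2" for v
  proof -
    have "finite_part r v $ p = (\<Sum>i\<in>insert r {1..<r}. real (v $ i) * fund_weight r i $ p)"
      using assms r3 by (simp add: finite_part_def atLeastLessThanSuc_atLeastAtMost[symmetric] atLeastLessThanSuc)
    also have "\<dots> = real (v $ r) / 2 + (\<Sum>i\<in>{1..<r}. if i \<in> {Suc p..<r} then real (v $ i) else 0)"
      using assms by (auto simp: fund_weight_def intro!: sum.cong)
    also have "(\<Sum>i\<in>{1..<r}. if i \<in> {Suc p..<r} then real (v $ i) else 0) = (\<Sum>i\<in>{1..<r} \<inter> {Suc p..<r}. real (v $ i))"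
      by (rule sum.inter_restrict[symmetric]) simp
    also have "{1..<r} \<inter> {Suc p..<r} = {Suc p..<r}" by auto
    finally show ?thesis by simp
  qed
  have "(\<Sum>k\<in>{Suc p..<r}. rho r $ k) = r - Suc p" by (simp add: rho_def)
  moreover have "rho r $ r = 1" by (simp add: rho_def)
  moreover have "real (r - Suc p) = real r - real p - 1" using assms by (simp add: of_nat_diff)
  moreover have "(finite_part r lam + finite_part r (rho r)) $ p = finite_part r lam $ p + finite_part r (rho r) $ p"
    using assms by (simp add: finite_part_def)
  ultimately show ?thesis unfolding fp by simp
qed

text \<open>Adding \<Lambda>_i (or 2\<Lambda>_r for i = r) raises the first i coordinates of the
  shifted vector by one, which amounts to moving the gap in the list to position i; a further
  \<Lambda>_r adds 1/2 everywhere.\<close>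

lemma weight_of_coord:
  assumes "(s, i, e) \<in> labels r" "p < r"
  shows "(finite_part r (weight_of r (s, i, e)) + finite_part r (rho r)) $ p = coord r (s, i, e) p"
proof -
  have i: "i \<le> r" "s \<and> e \<Longrightarrow> i = 0" using assms by (auto simp: labels_def)
  have mid: "(\<Sum>k\<in>{Suc p..<r}. weight_of r (s, i, e) $ k) = (if p < i \<and> i < r then 1 else 0)" if "p \<ge> 1" for p
  proof -
    have "(\<Sum>k\<in>{Suc p..<r}. weight_of r (s, i, e) $ k) = (\<Sum>k\<in>{Suc p..<r}. if k = i then 1 else 0)"
      using that by (intro sum.cong refl) (auto simp del: weight_of.simps simp: weight_of_index)
    then show ?thesis by auto
  qed
  show ?thesis
  proof (cases "p = 0")
    case False
    then show ?thesis using i assms(2) unfolding shifted_coord[OF assms(2)]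
      by (simp add: mid weight_of_index del: weight_of.simps) 
  next
    case True
    have "{Suc 0..<r} = insert 1 {Suc 1..<r}" using r3 by auto
    then have "(\<Sum>k\<in>{Suc 0..<r}. weight_of r (s, i, e) $ k) = (if e then label0 s i else label1 i) + (if 1 < i \<and> i < r then 1 else 0)"
      using mid[of 1] by (simp add: weight_of_index(2) del: weight_of.simps One_nat_def)
    moreover have "0 < r" using r3 by simp
    ultimately show ?thesis using i r3 unfolding True shifted_coord[OF \<open>0 < r\<close>]
      by (cases e; cases s) (auto simp: weight_of_index(3) label0_def label1_def simp del: weight_of.simps)
  qed
qed

end

section \<open>The determinants belonging to pairs of labels\<close>

lemma sin_reflect:
  assumes "N > 0"
  shows "sin (pi / real N * ((2 * real N - u) * of_int k)) = - sin (pi / real N * (u * of_int k))"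
    and "sin (pi / real N * ((2 * real N - u) * (of_int k + 1 / 2))) = sin (pi / real N * (u * (of_int k + 1 / 2)))"
proof -
  have "pi / real N * ((2 * real N - u) * of_int k) = 2 * pi * of_int k - pi / real N * (u * of_int k)"
    using assms by (simp add: field_simps)
  then show "sin (pi / real N * ((2 * real N - u) * of_int k)) = - sin (pi / real N * (u * of_int k))"
    by (simp add: sin_diff cos_int_2pin sin_int_2pin)
  have "pi / real N * ((2 * real N - u) * (of_int k + 1 / 2)) = 2 * pi * of_int k + (pi - pi / real N * (u * (of_int k + 1 / 2)))"
    using assms by (simp add: field_simps)
  then show "sin (pi / real N * ((2 * real N - u) * (of_int k + 1 / 2))) = sin (pi / real N * (u * (of_int k + 1 / 2)))"
    by (simp add: sin_add cos_int_2pin sin_int_2pin sin_diff)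
qed

lemma coord_parity: "\<exists>k. coord r (s, i, e) p = of_int k + (if s then 0 else 1 / 2)"
proof -
  define q where "q = (if p < i then p else Suc p)"
  have "base_coord r (s, i, e) p = of_int (int r - int q + (if s then 1 else 0)) + (if s then 0 else 1 / 2)"
    by (simp add: q_def)
  moreover have "2 * (real r + 1) - base_coord r (s, i, e) p = of_int (int r + 1 + int q) + (if s then 0 else 1 / 2)"
    by (simp add: q_def)
  ultimately show ?thesis unfolding coord.simps by metis
qed

lemma base_coord_parity: "\<exists>k. base_coord r (s, i, e) p = of_int k + (if s then 0 else 1 / 2)"
  using coord_parity[of r s i False p] by simp

definition base_det :: "nat \<Rightarrow> bool \<Rightarrow> nat \<Rightarrow> bool \<Rightarrow> nat \<Rightarrow> real" where
  "base_det r s i s' i' = det (mat r r (\<lambda>(p, q). sin (pi / real (r + 1) * (base_coord r (s, i, False) q * base_coord r (s', i', False) p))))"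

lemma sin_coord:
  assumes "\<exists>k. y = of_int k + (if s' then 0 else 1 / 2)"
  shows "sin (pi / real (r + 1) * (coord r (s, i, e) q * y)) =
    (if q = 0 then if e \<and> s' then - 1 else 1 else 1) * sin (pi / real (r + 1) * (base_coord r (s, i, False) q * y))"
proof -
  have N: "r + 1 > 0" by simp
  have two: "2 * (real r + 1) = 2 * real (r + 1)" by simp
  show ?thesis
    using assms sin_reflect[OF N, of "base_coord r (s, i, False) q"] unfolding coord.simps two
    by (cases s') auto
qed

text \<open>J_b touches only the first coordinate, hence one row or column. By
  \<open>sin_reflect\<close> this is negated when the other weight has integral coordinates and
  unchanged when they are half-integral.\<close>

lemma det_coord:
  assumes "r > 0"
  shows "det (mat r r (\<lambda>(p, q). sin (pi / real (r + 1) * (coord r (s, i, e) q * coord r (s', i', e') p))))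
    = (if e \<and> s' then - 1 else 1) * (if e' \<and> s then - 1 else 1) * base_det r s i s' i'"
proof -
  have e2: "sin (pi / real (r + 1) * (x * coord r (s', i', e') p)) = (if p = 0 then if e' \<and> s then - 1 else 1 else 1) * sin (pi / real (r + 1) * (x * base_coord r (s', i', False) p))"
    if "\<exists>k. x = of_int k + (if s then 0 else 1 / 2)" for p x
    using sin_coord[OF that, of r s' i' e' p] by (simp only: mult.commute[of x])
  have "sin (pi / real (r + 1) * (coord r (s, i, e) q * coord r (s', i', e') p)) =
    (if p = 0 then if e' \<and> s then - 1 else 1 else 1) * (if q = 0 then if e \<and> s' then - 1 else 1 else 1) *
      sin (pi / real (r + 1) * (base_coord r (s, i, False) q * base_coord r (s', i', False) p))" for p q
    unfolding sin_coord[OF coord_parity] e2[OF base_coord_parity] by (simp only: mult_ac)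
  then have "det (mat r r (\<lambda>(p, q). sin (pi / real (r + 1) * (coord r (s, i, e) q * coord r (s', i', e') p))))
    = (\<Prod>p = 0..<r. if p = 0 then if e' \<and> s then - 1 else 1 else 1) * (\<Prod>q = 0..<r. if q = 0 then if e \<and> s' then - 1 else 1 else 1) * base_det r s i s' i'"
    unfolding base_det_def det_scale_rows_cols[symmetric] by (simp only:)
  then show ?thesis using assms by (simp add: mult.commute)
qed

lemma base_det_half: "base_det r False i False k = det (mat_delete (half_sines (r + 1)) k i)"
  unfolding base_det_def half_sines_def mat_delete_def
  by (intro arg_cong[of _ _ det] eq_matI) (auto simp: add.commute)

lemma base_det_mixed: "base_det r False i True j = det (mat_delete (mixed_sines (r + 1)) j i)"
  unfolding base_det_def mixed_sines_def mat_delete_def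
  by (intro arg_cong[of _ _ det] eq_matI) (auto simp: add.commute)

text \<open>For j > 0 the first coordinate of the left weight is N, so the first column consists of
  sines of integral multiples of \<pi>.\<close>

lemma base_det_spin_zero:
  assumes "j > 0" "r > 0"
  shows "base_det r True j True k = 0"
proof -
  let ?s = "\<lambda>p q. sin (pi / real (r + 1) * (base_coord r (True, j, False) q * base_coord r (True, k, False) p))"
  have "?s p 0 = 0" for p
  proof -
    obtain m where m: "base_coord r (True, k, False) p = of_int m + (if True then 0 else 1 / 2)"
      using base_coord_parity by blast
    have "pi / real (r + 1) * (base_coord r (True, j, False) 0 * base_coord r (True, k, False) p) = of_int m * pi"
      unfolding m using assms(1) by (simp add: field_simps)
    then show ?thesis by (simp only: sin_zero_iff_int2) blast
  qed
  then have "?s p q = 1 * (if q = 0 then 0 else 1) * ?s p q" for p q by (cases "q = 0") auto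
  then have "base_det r True j True k = det (mat r r (\<lambda>(p, q). 1 * (if q = 0 then 0 else 1) * ?s p q))"
    unfolding base_det_def by presburger
  also have "\<dots> = 0" unfolding det_scale_rows_cols using assms(2) by simp
  finally show ?thesis .
qed

definition S_const :: "nat \<Rightarrow> complex" where
  "S_const r = \<i> ^ card (pos_roots r) * of_real (real (height r 3) powr (- real r / 2))
     * of_real (real (card (weight_coroot_quotient r)) powr (- 1 / 2)) * (- 2 * \<i>) ^ r"

lemma S_const_nonzero:
  assumes "r \<ge> 3"
  shows "S_const r \<noteq> 0"
proof -
  have "card (weight_coroot_quotient r) \<noteq> 0"
    using weight_coroot_quotient_finite[of r] assms by simp
  then show ?thesis by (simp add: S_const_def height_def)
qed

section \<open>The entries of S and T in terms of labels\<close>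

context
  fixes r :: nat
  assumes r3: "r \<ge> 3"
begin

lemma height3: "height r 3 = 2 * (r + 1)"
  using r3 by (simp add: height_def dual_coxeter_def)

lemma S_matrix_weight_of:
  assumes z: "(s, i, e) \<in> labels r" and z': "(s', i', e') \<in> labels r"
  shows "S_matrix r 3 (weight_of r (s, i, e)) (weight_of r (s', i', e')) =
    S_const r * of_real ((if e \<and> s' then - 1 else 1) * (if e' \<and> s then - 1 else 1) * base_det r s i s' i')"
proof -
  let ?x = "finite_part r (weight_of r (s, i, e)) + finite_part r (rho r)"
  let ?y = "finite_part r (weight_of r (s', i', e')) + finite_part r (rho r)"
  let ?c = "pi / real (r + 1)"
  have xy: "?x \<in> carrier_vec r" "?y \<in> carrier_vec r" by (simp_all add: finite_part_def)
  have c: "2 * of_real pi * \<i> / of_nat (height r 3) = \<i> * complex_of_real ?c"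
  proof -
    have "2 * x * y / of_nat (2 * (r + 1)) = y * (x / of_nat (r + 1))" for x y :: complex
    proof -
      define a where "a = complex_of_nat (r + 1)"
      have "of_nat (2 * (r + 1)) = 2 * a" unfolding a_def by (simp only: of_nat_mult of_nat_numeral)
      moreover have "a \<noteq> 0" unfolding a_def of_nat_eq_0_iff by simp
      ultimately show ?thesis unfolding a_def[symmetric] by (simp add: field_simps)
    qed
    then show ?thesis unfolding height3 of_real_divide of_real_of_nat_eq .
  qed
  have "mat r r (\<lambda>(p, q). sin (?c * (?x $ q * ?y $ p))) = mat r r (\<lambda>(p, q). sin (?c * (coord r (s, i, e) q * coord r (s', i', e') p)))"
    by (rule eq_matI) (simp_all add: weight_of_coord[OF r3 z] weight_of_coord[OF r3 z'] del: weight_of.simps coord.simps index_add_vec)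
  then have "det (mat r r (\<lambda>(p, q). sin (?c * (?x $ q * ?y $ p)))) =
    (if e \<and> s' then - 1 else 1) * (if e' \<and> s then - 1 else 1) * base_det r s i s' i'"
    using det_coord[of r s i e s' i' e'] r3 by simp
  then show ?thesis
    unfolding S_matrix_def c weyl_sum[OF xy] S_const_def by (simp only: mult.assoc)
qed

lemma S_matrix_sym:
  assumes z: "(s, i, e) \<in> labels r" and z': "(s', i', e') \<in> labels r"
  shows "S_matrix r 3 (weight_of r (s, i, e)) (weight_of r (s', i', e')) = S_matrix r 3 (weight_of r (s', i', e')) (weight_of r (s, i, e))"
proof -
  let ?A = "mat r r (\<lambda>(p, q). sin (pi / real (r + 1) * (base_coord r (s, i, False) q * base_coord r (s', i', False) p)))"
  have "transpose_mat ?A = mat r r (\<lambda>(p, q). sin (pi / real (r + 1) * (base_coord r (s', i', False) q * base_coord r (s, i, False) p)))"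
    by (rule eq_matI) (simp_all add: mult.commute del: base_coord.simps)
  then have "base_det r s i s' i' = base_det r s' i' s i"
    unfolding base_det_def using det_transpose[of ?A r] by simp
  then show ?thesis unfolding S_matrix_weight_of[OF z z'] S_matrix_weight_of[OF z' z] by simp
qed

lemma sum_skip:
  fixes f :: "nat \<Rightarrow> real"
  assumes "i \<le> r"
  shows "(\<Sum>p = 0..<r. f (if p < i then p else Suc p)) = (\<Sum>k = 0..r. f k) - f i"
proof -
  have "(\<Sum>p = 0..<r. f (if p < i then p else Suc p)) = (\<Sum>k\<in>{0..r} - {i}. f k)"
    by (rule sum.reindex_bij_witness[of _ "\<lambda>k. if k < i then k else k - 1" "\<lambda>p. if p < i then p else Suc p"]) (use assms in auto)
  then show ?thesis using assms by (simp add: sum_diff1)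
qed

lemma coord_norm:
  assumes "(s, i, e) \<in> labels r"
  shows "(\<Sum>p = 0..<r. (coord r (s, i, e) p)\<^sup>2) =
    (\<Sum>k = 0..r. (real r + (if s then 1 else 1 / 2) - real k)\<^sup>2) - (real r + (if s then 1 else 1 / 2) - real i)\<^sup>2
    + (if e then 4 * (real r + 1)\<^sup>2 - 4 * (real r + 1) * base_coord r (s, i, e) 0 else 0)"
proof -
  have i: "i \<le> r" using assms by (simp add: labels_def)
  have b: "(\<Sum>p = 0..<r. (base_coord r (s, i, e) p)\<^sup>2) = (\<Sum>k = 0..r. (real r + (if s then 1 else 1 / 2) - real k)\<^sup>2) - (real r + (if s then 1 else 1 / 2) - real i)\<^sup>2"
    unfolding base_coord.simps using sum_skip[OF i, of "\<lambda>k. (real r + (if s then 1 else 1 / 2) - real k)\<^sup>2"] .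
  have "(coord r (s, i, e) p)\<^sup>2 = (base_coord r (s, i, e) p)\<^sup>2 + (if p = 0 then if e then 4 * (real r + 1)\<^sup>2 - 4 * (real r + 1) * base_coord r (s, i, e) p else 0 else 0)" for p
    unfolding coord.simps by (simp add: power2_eq_square algebra_simps del: base_coord.simps)
  then have "(\<Sum>p = 0..<r. (coord r (s, i, e) p)\<^sup>2) = (\<Sum>p = 0..<r. (base_coord r (s, i, e) p)\<^sup>2)
     + (\<Sum>p = 0..<r. if p = 0 then if e then 4 * (real r + 1)\<^sup>2 - 4 * (real r + 1) * base_coord r (s, i, e) p else 0 else 0)"
    by (simp only: sum.distrib)
  then show ?thesis unfolding b using r3 by simp
qed

lemma sum_squares_diff: "(\<Sum>k = 0..m. (c + 1 - real k)\<^sup>2) = (\<Sum>k = 0..m. (c + 1 / 2 - real k)\<^sup>2) + (real m + 1) * (c + 3 / 4 - real m / 2)"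
  by (induction m) (simp_all add: power2_eq_square field_simps)

text \<open>The phase common to all entries of T. The terms -\<pi>N/2 + \<pi>/2 are left over when
  the omitted square (N - A/2)^2 with A = 2i + 1 is expanded.\<close>

definition T_angle :: real where
  "T_angle = pi * (\<Sum>k = 0..r. (real r + 1 / 2 - real k)\<^sup>2) / (2 * real (r + 1)) - pi * real (r + 1) / 2 + pi / 2"

text \<open>The norm is the full sum of squares minus the omitted square, plus a correction for J_b.
  Expanding the omitted square leaves the exponent of T and integral multiples of \<pi>; that these
  are even multiples is where the twist in \<open>index_of\<close> is needed again.\<close>

lemma coord_norm_phase:
  assumes "(s, i, e) \<in> labels r"
  shows "\<exists>m :: int. pi * (\<Sum>p = 0..<r. (coord r (s, i, e) p)\<^sup>2) / (2 * real (r + 1)) =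
    T_angle + pi * of_int (T_exp (r + 1) (index_of r (s, i, e))) / (8 * real (r + 1)) + 2 * pi * of_int m"
proof -
  let ?N = "real (r + 1)" and ?C = "\<Sum>k = 0..r. (real r + 1 / 2 - real k)\<^sup>2"
  have N: "?N > 0" by simp
  have i: "i \<le> r" "s \<and> e \<Longrightarrow> i = 0" using assms by (auto simp: labels_def)
  show ?thesis
  proof (cases s)
    case True
    have "real_of_int (T_exp (r + 1) (index_of r (s, i, e))) = 3 * ?N * (2 * ?N - 1) - (2 * ?N + 2 * real i)\<^sup>2"
      using True i by (auto simp: T_exp_def ang_def)
    moreover have "(\<Sum>k = 0..r. (real r + 1 - real k)\<^sup>2) = ?C + ?N * (?N / 2 + 1 / 4)"
      unfolding sum_squares_diff by (simp add: field_simps)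
    moreover have "(if e then 4 * (real r + 1)\<^sup>2 - 4 * (real r + 1) * base_coord r (s, i, e) 0 else 0) = 4 * ?N * (if e then 1 else 0)"
      using True i by (auto simp: power2_eq_square algebra_simps)
    moreover have "pi * ((C + n * (n / 2 + 1 / 4)) - (n - I)\<^sup>2 + 4 * n * \<delta>) / (2 * n) =
      (pi * C / (2 * n) - pi * n / 2 + pi / 2) + pi * (3 * n * (2 * n - 1) - (2 * n + 2 * I)\<^sup>2) / (8 * n) + 2 * pi * (I + \<delta>)"
      if "n > 0" for C n I \<delta> :: real
      using that by (simp add: power2_eq_square field_simps)
    note this[OF N, of ?C "real i" "if e then 1 else 0"]
    ultimately have "pi * (\<Sum>p = 0..<r. (coord r (s, i, e) p)\<^sup>2) / (2 * ?N) =
      T_angle + pi * of_int (T_exp (r + 1) (index_of r (s, i, e))) / (8 * ?N) + 2 * pi * of_int (int i + (if e then 1 else 0))"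
      unfolding coord_norm[OF assms] T_angle_def using True by (cases e) (simp_all add: add.commute)
    then show ?thesis by blast
  next
    case False
    \<comment> \<open>J_b adds 4N(N - x) to the norm, where the first coordinate x is N - 3/2 if
      position 0 is the gap and N - 1/2 otherwise; this equals 2Nd.\<close>
    define d :: int where "d = (if e then if i = 0 then 3 else 1 else 0)"
    \<comment> \<open>The multiple of \<pi> arising from A -> 4N - A in the exponent. It is odd and
      occurs exactly when i + d is odd.\<close>
    define x :: int where "x = (if e = odd i then 0 else 2 * int (r + 1) - (2 * int i + 1))"
    define A where "A = (if e = odd i then 2 * real i + 1 else 4 * ?N - (2 * real i + 1))"
    have t: "real_of_int (T_exp (r + 1) (index_of r (s, i, e))) = - A\<^sup>2"
    proof -
      have "odd (index_of r (s, i, e))" using False i by auto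
      moreover have "real (index_of r (s, i, e)) = A" using False i by (auto simp: A_def of_nat_diff)
      ultimately show ?thesis by (simp add: T_exp_def del: index_of.simps)
    qed
    have "(if e then 4 * (real r + 1)\<^sup>2 - 4 * (real r + 1) * base_coord r (s, i, e) 0 else 0) = 2 * ?N * of_int d"
      using False by (auto simp: d_def power2_eq_square algebra_simps)
    then have norm: "(\<Sum>p = 0..<r. (coord r (s, i, e) p)\<^sup>2) = ?C - (?N - 1 / 2 - real i)\<^sup>2 + 2 * ?N * of_int d"
      unfolding coord_norm[OF assms] using False by (simp add: add.commute)
    have "pi * (C - (n - 1 / 2 - I)\<^sup>2 + 2 * n * \<delta>) / (2 * n) =
      (pi * C / (2 * n) - pi * n / 2 + pi / 2) + pi * (- (2 * I + 1)\<^sup>2) / (8 * n) + pi * (I + \<delta>)"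
      "pi * (C - (n - 1 / 2 - I)\<^sup>2 + 2 * n * \<delta>) / (2 * n) =
      (pi * C / (2 * n) - pi * n / 2 + pi / 2) + pi * (- (4 * n - (2 * I + 1))\<^sup>2) / (8 * n) + pi * (I + \<delta> + (2 * n - (2 * I + 1)))"
      if "n > 0" for C n I \<delta> :: real
      using that by (simp_all add: power2_eq_square field_simps)
    note formula = this[OF N, of ?C "real i" "of_int d"]
    have eq: "pi * (\<Sum>p = 0..<r. (coord r (s, i, e) p)\<^sup>2) / (2 * ?N) =
      T_angle + pi * of_int (T_exp (r + 1) (index_of r (s, i, e))) / (8 * ?N) + pi * of_int (int i + d + x)"
    proof (cases "e = odd i")
      case True
      then have "A = 2 * real i + 1" "x = 0" by (simp_all add: A_def x_def)
      then show ?thesis unfolding norm t T_angle_def using formula(1) by simp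
    next
      case False
      then have "A = 4 * ?N - (2 * real i + 1)" "real_of_int x = 2 * ?N - (2 * real i + 1)" by (simp_all add: A_def x_def)
      then show ?thesis unfolding norm t T_angle_def formula(2) by simp
    qed
    have "even (int i + d + x)"
      by (cases e; cases "odd i") (auto simp: d_def x_def)
    then obtain m where "int i + d + x = 2 * m"
      by (rule evenE)
    then show ?thesis using eq by (intro exI[of _ m]) simp
  qed
qed

definition T_const :: complex where
  "T_const = cis (T_angle - pi * (finite_part r (rho r) \<bullet> finite_part r (rho r)) / real (dual_coxeter r))"

lemma T_matrix_weight_of:
  assumes z: "(s, i, e) \<in> labels r"
  shows "T_matrix r 3 (weight_of r (s, i, e)) (weight_of r (s, i, e)) = T_const * ph (r + 1) (T_exp (r + 1) (index_of r (s, i, e)))"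
proof -
  let ?x = "finite_part r (weight_of r (s, i, e)) + finite_part r (rho r)"
  let ?R = "pi * (finite_part r (rho r) \<bullet> finite_part r (rho r)) / real (dual_coxeter r)"
  have "dim_vec ?x = r" by (simp add: finite_part_def)
  then have x: "?x \<bullet> ?x = (\<Sum>p = 0..<r. (coord r (s, i, e) p)\<^sup>2)"
    unfolding scalar_prod_def power2_eq_square
    by (intro sum.cong) (simp_all add: weight_of_coord[OF r3 z] del: weight_of.simps coord.simps index_add_vec)
  obtain m :: int where m: "pi * (\<Sum>p = 0..<r. (coord r (s, i, e) p)\<^sup>2) / (2 * real (r + 1)) =
    T_angle + pi * of_int (T_exp (r + 1) (index_of r (s, i, e))) / (8 * real (r + 1)) + 2 * pi * of_int m"
    using coord_norm_phase[OF z] by blast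
  have "T_matrix r 3 (weight_of r (s, i, e)) (weight_of r (s, i, e)) = cis (pi * (?x \<bullet> ?x) / real (height r 3) - ?R)"
    unfolding T_matrix_def cis_conv_exp by (simp add: algebra_simps del: weight_of.simps)
  also have "pi * (?x \<bullet> ?x) / real (height r 3) - ?R = (T_angle - ?R + pi * of_int (T_exp (r + 1) (index_of r (s, i, e))) / (8 * real (r + 1))) + 2 * pi * of_int m"
    using m unfolding x height3 by simp
  also have "cis \<dots> = T_const * ph (r + 1) (T_exp (r + 1) (index_of r (s, i, e)))"
  proof -
    have "cis (2 * pi * of_int m) = 1" by (simp add: complex_eq_iff)
    then show ?thesis unfolding T_const_def ph_def cis_mult[symmetric] by simp
  qed
  finally show ?thesis .
qed

end

section \<open>Classification\<close>

lemma commute_on_reindex: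
  assumes "bij_betw f B A"
  shows "commute_on A M X \<longleftrightarrow> commute_on B (\<lambda>i j. M (f i) (f j)) (\<lambda>i j. X (f i) (f j))"
proof -
  have im: "A = f ` B" using assms by (simp add: bij_betw_def)
  have s: "(\<Sum>u\<in>A. g u) = (\<Sum>i\<in>B. g (f i))" for g :: "_ \<Rightarrow> complex"
    by (rule sum.reindex_bij_betw[OF assms, symmetric])
  show ?thesis unfolding commute_on_def s unfolding im by simp
qed

lemma commute_on_cong:
  assumes "\<And>i j. i \<in> A \<Longrightarrow> j \<in> A \<Longrightarrow> M i j = M' i j"
  shows "commute_on A M X \<longleftrightarrow> commute_on A M' X"
  unfolding commute_on_def using assms by (simp cong: sum.cong)

lemma commute_on_permutation:
  assumes "finite A" and \<pi>: "\<And>i. i \<in> A \<Longrightarrow> \<pi> i \<in> A" "\<And>i. \<pi> (\<pi> i) = i"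
    and X: "\<And>i j. i \<in> A \<Longrightarrow> j \<in> A \<Longrightarrow> X (\<pi> i) j = X i (\<pi> j)"
  shows "commute_on A (\<lambda>i j. if \<pi> i = j then 1 else 0) X"
  unfolding commute_on_def
proof (intro ballI)
  fix i j assume ij: "i \<in> A" "j \<in> A"
  have "(\<Sum>u\<in>A. (if \<pi> i = u then 1 else 0) * X u j) = X (\<pi> i) j"
    using assms(1) \<pi>(1)[OF ij(1)] by (simp add: if_distrib[of "\<lambda>c. c * _"] cong: if_cong)
  moreover have "(\<Sum>u\<in>A. X i u * (if \<pi> u = j then 1 else 0)) = X i (\<pi> j)"
  proof -
    have "\<pi> u = j \<longleftrightarrow> u = \<pi> j" for u using \<pi>(2) by metis
    then show ?thesis using assms(1) \<pi>(1)[OF ij(2)] by (simp add: if_distrib[of "(*) _"] cong: if_cong)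
  qed
  ultimately show "(\<Sum>u\<in>A. (if \<pi> i = u then 1 else 0) * X u j) = (\<Sum>u\<in>A. X i u * (if \<pi> u = j then 1 else 0))"
    using X[OF ij] by simp
qed

context modular_data
begin

lemma sw_I: "i \<in> I \<Longrightarrow> sw i \<in> I"
  by (auto simp: transpose_def Ev_def)

lemma T_exp_sw: "T_exp N (sw i) = T_exp N i"
  by (auto simp: transpose_def T_exp_def ang_def)

text \<open>Rows 2N and 4N of S agree off the pair, and on the pair S has equal diagonal and equal
  off-diagonal entries.\<close>

lemma S_sw:
  assumes "i \<in> I" "j \<in> I"
  shows "S (sw i) j = S i (sw j)"
proof -
  have E: "2 * N \<in> Ev N" "4 * N \<in> Ev N" by (simp_all add: Ev_def)
  have fixed: "sw k = k" if "k \<notin> {2 * N, 4 * N}" for k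
    using that by (intro transpose_apply_other) auto
  have spin: "S (4 * N) k = S (2 * N) k" if k: "k \<in> I" "k \<notin> {2 * N, 4 * N}" for k
  proof (cases "k \<in> Od N")
    case True
    then show ?thesis using N0 by (simp add: S_eo E ang_def wgt_def)
  next
    case False
    then have "k \<in> Ev N" using k by simp
    then show ?thesis using S_ee[OF _ _ k(2)] E S_sym[of k "2 * N"] S_sym[of k "4 * N"] by simp
  qed
  have one: "S (sw k) l = S k l" if "k \<in> I" "l \<in> I" "l \<notin> {2 * N, 4 * N}" for k l
  proof (cases "k \<in> {2 * N, 4 * N}")
    case True
    then show ?thesis using spin[OF that(2,3)] by auto
  qed (simp add: fixed)
  show ?thesis
  proof (cases "j \<in> {2 * N, 4 * N}")
    case j: True
    show ?thesis
    proof (cases "i \<in> {2 * N, 4 * N}")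
      case True
      have "S (4 * N) (2 * N) = S (2 * N) (4 * N)" using E by (intro S_sym) auto
      then show ?thesis using True j S_sigma by (elim insertE emptyE) simp_all
    next
      case False
      have "S i (sw j) = S (sw j) i" using assms sw_I by (intro S_sym) auto
      also have "\<dots> = S j i" by (rule one[OF assms(2,1) False])
      also have "\<dots> = S i j" using assms by (intro S_sym) auto
      finally show ?thesis by (simp add: fixed[OF False])
    qed
  next
    case False
    then show ?thesis using one[OF assms] by (simp add: fixed)
  qed
qed

end

section \<open>Transfer between weights and numbers\<close>

context
  fixes r :: nat
  assumes r3: "r \<ge> 3"
begin

definition weight :: "nat \<Rightarrow> nat vec" where
  "weight t = weight_of r (inv_into (labels r) (index_of r) t)"

lemma weight_index: "z \<in> labels r \<Longrightarrow> weight (index_of r z) = weight_of r z"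
  using index_of_bij[of r] r3 by (simp add: weight_def bij_betw_def)

lemma weight_bij: "bij_betw weight (Od (r + 1) \<union> Ev (r + 1)) (P_plus r 3)"
  using bij_betw_trans[OF bij_betw_inv_into[OF index_of_bij[OF r3]] weight_of_bij[OF r3]]
  by (simp add: o_def weight_def[abs_def])

lemma I_label:
  assumes "i \<in> Od (r + 1) \<union> Ev (r + 1)"
  obtains s k e where "(s, k, e) \<in> labels r" "i = index_of r (s, k, e)"
proof -
  have "i \<in> index_of r ` labels r" using index_of_bij[OF r3] assms by (simp only: bij_betw_def)
  then obtain z where z: "i = index_of r z" "z \<in> labels r" by (rule imageE)
  show ?thesis by (cases z) (use z that in blast)
qed

lemma Od_label:
  assumes "A \<in> Od (r + 1)"
  obtains i e where "(False, i, e) \<in> labels r" "A = index_of r (False, i, e)"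
proof -
  obtain s i e where z: "(s, i, e) \<in> labels r" "A = index_of r (s, i, e)"
    by (rule I_label[of A]) (use assms in blast)+
  have "even (index_of r (True, i, e))" by simp
  then have "\<not> s" using z assms by (cases s) (auto simp: Od_def simp del: index_of.simps)
  then show ?thesis using that z by auto
qed

lemma Ev_label:
  assumes "B \<in> Ev (r + 1)"
  obtains i e where "(True, i, e) \<in> labels r" "B = index_of r (True, i, e)"
proof -
  obtain s i e where z: "(s, i, e) \<in> labels r" "B = index_of r (s, i, e)"
    by (rule I_label[of B]) (use assms in blast)+
  have "odd (index_of r (False, i, e))" if "(False, i, e) \<in> labels r" using that by (auto simp: labels_def even_diff_nat)
  then have s using z assms by (cases s) (auto simp: Ev_def simp del: index_of.simps)
  then show ?thesis using that z by auto
qed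

definition S_half :: complex where
  "S_half = S_const r * of_real ((- 1) ^ (r + 2) * (2 / real (r + 1)) * det (half_sines (r + 1)))"

definition S_mixed :: complex where
  "S_mixed = S_const r * of_real ((- 1) ^ (r + 2) * (2 / real (r + 1)) * det (mixed_sines (r + 1)))"

text \<open>Odd x does not distinguish 2i + 1 from 4N - (2i + 1), whereas even x gives a sign;
  combined with the twist in \<open>index_of\<close> this sign is that of e times (-1)^i.\<close>

lemma sn_index:
  assumes "(False, i, e) \<in> labels r"
  shows "odd x \<Longrightarrow> sn (r + 1) (int (index_of r (False, i, e)) * x) = sn (r + 1) (int (2 * i + 1) * x)"
    and "even x \<Longrightarrow> sn (r + 1) (int (index_of r (False, i, e)) * x) = (if e then - 1 else 1) * ((- 1) ^ i * sn (r + 1) (int (2 * i + 1) * x))"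
proof -
  have i: "int (index_of r (False, i, e)) = (if e = odd i then int (2 * i + 1) else 4 * int (r + 1) - int (2 * i + 1))"
    using assms by (auto simp: labels_def of_nat_diff)
  show "sn (r + 1) (int (index_of r (False, i, e)) * x) = sn (r + 1) (int (2 * i + 1) * x)" if "odd x"
    unfolding i using sn_fold[of "r + 1" x "int (2 * i + 1)"] that by (simp del: of_nat_add of_nat_mult)
  assume "even x"
  then obtain y where y: "x = 2 * y" by (rule evenE)
  have "(4 * int (r + 1) - int (2 * i + 1)) * x = - (int (2 * i + 1) * x) + 8 * int (r + 1) * y"
    unfolding y by (simp add: algebra_simps)
  then have f: "sn (r + 1) ((4 * int (r + 1) - int (2 * i + 1)) * x) = - sn (r + 1) (int (2 * i + 1) * x)"
    by (simp only: sn_shift[of "r + 1"] sn_uminus)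
  show "sn (r + 1) (int (index_of r (False, i, e)) * x) = (if e then - 1 else 1) * ((- 1) ^ i * sn (r + 1) (int (2 * i + 1) * x))"
  proof (cases "e = odd i")
    case True
    then have "(if e then - 1 else 1) * (- 1) ^ i = (1 :: real)" by (cases e) auto
    then show ?thesis unfolding i if_P[OF True] mult.assoc[symmetric] by (simp only: mult_1_left)
  next
    case False
    then have "(if e then - 1 else 1) * (- 1) ^ i = (- 1 :: real)" by (cases e) auto
    then show ?thesis unfolding i if_not_P[OF False] f mult.assoc[symmetric] by (simp only: mult_minus1)
  qed
qed

text \<open>Minors of \<open>half_sines\<close> give the block of even \<lambda>_r, those of
  \<open>mixed_sines\<close> the mixed block, and \<open>base_det_spin_zero\<close> the zeros. On
  the pair 2N, 4N only the signs of \<open>det_coord\<close> vary.\<close>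

lemma modular_data: "modular_data (r + 1) (\<lambda>i j. S_matrix r 3 (weight i) (weight j)) S_half S_mixed"
proof
  have N: "r + 1 > 0" by simp
  show "4 \<le> r + 1" using r3 by simp
  show "S_half \<noteq> 0"
  proof -
    have "complex_of_nat (r + 1) \<noteq> 0" unfolding of_nat_eq_0_iff by simp
    then show ?thesis using S_const_nonzero[OF r3] sines_det(1)[OF N] by (simp add: S_half_def)
  qed
  show "S_mixed\<^sup>2 = 2 * S_half\<^sup>2"
  proof -
    have "(of_real (det (mixed_sines (r + 1))))\<^sup>2 = (2 :: complex) * (of_real (det (half_sines (r + 1))))\<^sup>2"
      using arg_cong[OF sines_det(2)[OF N], of complex_of_real] by simp
    then show ?thesis by (simp add: S_half_def S_mixed_def power_mult_distrib power_divide)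
  qed
  show "S_matrix r 3 (weight i) (weight j) = S_matrix r 3 (weight j) (weight i)"
    if ij: "i \<in> Od (r + 1) \<union> Ev (r + 1)" "j \<in> Od (r + 1) \<union> Ev (r + 1)" for i j
  proof -
    obtain s k e where z: "(s, k, e) \<in> labels r" "i = index_of r (s, k, e)" by (rule I_label[OF ij(1)])
    obtain s' k' e' where z': "(s', k', e') \<in> labels r" "j = index_of r (s', k', e')" by (rule I_label[OF ij(2)])
    show ?thesis
      unfolding z(2) z'(2) weight_index[OF z(1)] weight_index[OF z'(1)] by (rule S_matrix_sym[OF r3 z(1) z'(1)])
  qed
  show "S_matrix r 3 (weight A) (weight C) = S_half * of_real (sn (r + 1) (int A * int C))"
    if A: "A \<in> Od (r + 1)" and C: "C \<in> Od (r + 1)" for A C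
  proof -
    obtain i e where i: "(False, i, e) \<in> labels r" "A = index_of r (False, i, e)" using Od_label[OF A] .
    obtain k e' where k: "(False, k, e') \<in> labels r" "C = index_of r (False, k, e')" using Od_label[OF C] .
    have ik: "i < r + 1" "k < r + 1" using i(1) k(1) by (auto simp: labels_def)
    have oC: "odd (int C)" using C by (simp add: Od_def)
    have "sn (r + 1) (int A * int C) = sn (r + 1) (int (2 * i + 1) * int C)"
      unfolding i(2) by (rule sn_index(1)[OF i(1) oC])
    also have "\<dots> = sn (r + 1) (int (2 * i + 1) * int (2 * k + 1))"
      using sn_index(1)[OF k(1), of "int (2 * i + 1)"] unfolding k(2) by (simp add: mult.commute del: index_of.simps)
    finally have sn: "sn (r + 1) (int A * int C) = sn (r + 1) (int (2 * k + 1) * int (2 * i + 1))" by (simp add: mult.commute)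
    show ?thesis
      unfolding i(2) k(2) weight_index[OF i(1)] weight_index[OF k(1)] S_matrix_weight_of[OF r3 i(1) k(1)] base_det_half half_sines_minor[OF N ik(2,1)]
      unfolding i(2)[symmetric] k(2)[symmetric] sn S_half_def by simp
  qed
  show "S_matrix r 3 (weight A) (weight B) = S_mixed * of_real (wgt (r + 1) B * sn (r + 1) (int A * ang (r + 1) B))"
    if A: "A \<in> Od (r + 1)" and B: "B \<in> Ev (r + 1)" for A B
  proof -
    obtain i e where i: "(False, i, e) \<in> labels r" "A = index_of r (False, i, e)" using Od_label[OF A] .
    obtain j e' where j: "(True, j, e') \<in> labels r" "B = index_of r (True, j, e')" using Ev_label[OF B] .
    have ij: "i < r + 1" "j < r + 1" using i(1) j(1) by (auto simp: labels_def)
    have aw: "ang (r + 1) B = int (2 * (r + 1) + 2 * j)" "wgt (r + 1) B = (if j = 0 then 1 / 2 else 1)"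
      using j ij unfolding j(2) by (auto simp: ang_def wgt_def labels_def)
    have sn: "sn (r + 1) (int A * ang (r + 1) B) = (if e then - 1 else 1) * ((- 1) ^ i * sn (r + 1) (int (2 * i + 1) * int (2 * (r + 1) + 2 * j)))"
      unfolding i(2) aw(1) by (rule sn_index(2)[OF i(1)]) simp
    show ?thesis
      unfolding sn aw(2) unfolding i(2) j(2) weight_index[OF i(1)] weight_index[OF j(1)] S_matrix_weight_of[OF r3 i(1) j(1)] base_det_mixed mixed_sines_minor[OF N ij(2,1)] S_mixed_def
      by (simp add: mult_ac)
  qed
  show "S_matrix r 3 (weight B) (weight B') = 0"
    if B: "B \<in> Ev (r + 1)" "B' \<in> Ev (r + 1)" "B \<notin> {2 * (r + 1), 4 * (r + 1)}" for B B'
  proof -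
    obtain j e where j: "(True, j, e) \<in> labels r" "B = index_of r (True, j, e)" using Ev_label[OF B(1)] .
    obtain k e' where k: "(True, k, e') \<in> labels r" "B' = index_of r (True, k, e')" using Ev_label[OF B(2)] .
    have "j > 0" using j B(3) by (cases e) auto
    then have "base_det r True j True k = 0" using r3 by (intro base_det_spin_zero) auto
    then show ?thesis unfolding j(2) k(2) weight_index[OF j(1)] weight_index[OF k(1)] S_matrix_weight_of[OF r3 j(1) k(1)] by simp
  qed
  have l: "(True, 0, e) \<in> labels r" for e by (simp add: labels_def)
  have w: "weight (2 * (r + 1)) = weight_of r (True, 0, False)" "weight (4 * (r + 1)) = weight_of r (True, 0, True)"
    using weight_index[OF l[of False]] weight_index[OF l[of True]] by (simp_all del: weight_of.simps)
  show "S_matrix r 3 (weight (2 * (r + 1))) (weight (4 * (r + 1))) = - S_matrix r 3 (weight (2 * (r + 1))) (weight (2 * (r + 1)))"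
    "S_matrix r 3 (weight (4 * (r + 1))) (weight (4 * (r + 1))) = S_matrix r 3 (weight (2 * (r + 1))) (weight (2 * (r + 1)))"
    unfolding w S_matrix_weight_of[OF r3 l l] by simp_all
qed

interpretation modular_data "r + 1" "\<lambda>i j. S_matrix r 3 (weight i) (weight j)" S_half S_mixed
  by (rule modular_data)

lemma T_matrix_weight:
  assumes "i \<in> I" "j \<in> I"
  shows "T_matrix r 3 (weight i) (weight j) = (if i = j then T_const r * ph (r + 1) (T_exp (r + 1) i) else 0)"
proof (cases "i = j")
  case True
  obtain s k e where z: "(s, k, e) \<in> labels r" "i = index_of r (s, k, e)" by (rule I_label[OF assms(1)])
  show ?thesis unfolding if_P[OF True] unfolding True[symmetric] z(2) weight_index[OF z(1)] by (rule T_matrix_weight_of[OF r3 z(1)])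
next
  case False
  then have "weight i \<noteq> weight j" using weight_bij assms unfolding bij_betw_def inj_on_def by blast
  then show ?thesis using False by (simp add: T_matrix_def)
qed

lemma vacuum_weight: "vacuum r 3 = weight 1"
proof -
  have "(False, 0, False) \<in> labels r" by (simp add: labels_def)
  from weight_index[OF this] have "weight 1 = weight_of r (False, 0, False)" by simp
  also have "\<dots> = vacuum r 3"
    using r3 by (intro weight_eqI[OF r3]) (auto simp: vacuum_def label0_def label1_def)
  finally show ?thesis by simp
qed

lemma commute_T_phase:
  assumes "commute_on I m (\<lambda>i j. T_matrix r 3 (weight i) (weight j))" "i \<in> I" "j \<in> I" "m i j \<noteq> 0"
  shows "ph (r + 1) (T_exp (r + 1) i) = ph (r + 1) (T_exp (r + 1) j)"
proof -
  have f: "finite I" by simp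
  have "(\<Sum>u\<in>I. m i u * T_matrix r 3 (weight u) (weight j)) = (\<Sum>u\<in>I. if u = j then m i j * (T_const r * ph (r + 1) (T_exp (r + 1) j)) else 0)"
    using assms by (intro sum.cong refl) (auto simp: T_matrix_weight)
  also have "\<dots> = m i j * (T_const r * ph (r + 1) (T_exp (r + 1) j))"
    unfolding sum.delta[OF f] if_P[OF assms(3)] ..
  finally have L: "(\<Sum>u\<in>I. m i u * T_matrix r 3 (weight u) (weight j)) = m i j * (T_const r * ph (r + 1) (T_exp (r + 1) j))" .
  have "(\<Sum>u\<in>I. T_matrix r 3 (weight i) (weight u) * m u j) = (\<Sum>u\<in>I. if u = i then T_const r * ph (r + 1) (T_exp (r + 1) i) * m i j else 0)"
    using assms by (intro sum.cong refl) (auto simp: T_matrix_weight)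
  also have "\<dots> = T_const r * ph (r + 1) (T_exp (r + 1) i) * m i j"
    unfolding sum.delta[OF f] if_P[OF assms(2)] ..
  finally have R: "(\<Sum>u\<in>I. T_matrix r 3 (weight i) (weight u) * m u j) = T_const r * ph (r + 1) (T_exp (r + 1) i) * m i j" .
  have "m i j * (T_const r * ph (r + 1) (T_exp (r + 1) j)) = T_const r * ph (r + 1) (T_exp (r + 1) i) * m i j"
    using assms(1-3) unfolding commute_on_def L[symmetric] R[symmetric] by blast
  moreover have "T_const r \<noteq> 0" by (simp add: T_const_def[OF r3])
  ultimately show ?thesis using assms(4) by simp
qed

text \<open>The phase condition keeps l = 1 for odd \<lambda>_r and l = 2 for even \<lambda>_r,
  where J_b acts twice and hence trivially. Among weights with odd \<lambda>_r only 2\<Lambda>_0 +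
  \<Lambda>_r and 2\<Lambda>_1 + \<Lambda>_r are moved.\<close>

lemma simple_current_weight:
  assumes "i \<in> I" "j \<in> I"
  shows "simple_current_invariant r (weight i) (weight j) = (if sw i = j then 1 else 0)"
proof -
  obtain s k e where l: "(s, k, e) \<in> labels r" and ik: "i = index_of r (s, k, e)" by (rule I_label[OF assms(1)])
  have wi: "weight i = weight_of r (s, k, e)" unfolding ik by (rule weight_index[OF l])
  have J: "J_b r (weight i) = vec (r + 1) (\<lambda>k. weight i $ (if k = 0 then 1 else if k = 1 then 0 else k))"
    by (simp add: J_b_def)
  have JJ: "J_b r (J_b r (weight i)) = weight i"
    unfolding J_b_def wi by (intro eq_vecI) (use r3 in auto)
  have wr: "weight i $ r = (if s then 1 else 0) + (if k = r then 2 else 0)"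
    unfolding wi weight_of_index[OF r3] ..
  have Z: "real m / 2 \<in> \<int> \<longleftrightarrow> even m" for m :: nat
  proof
    assume "real m / 2 \<in> \<int>"
    then obtain q where "real m / 2 = of_int q" by (auto elim: Ints_cases)
    then have "int m = 2 * q" by linarith
    then show "even m" by presburger
  next
    assume "even m"
    then obtain q where "m = 2 * q" by (rule evenE)
    then show "real m / 2 \<in> \<int>" by simp
  qed
  have d1: "delta1 (real (weight i $ r) / 2 + 3 * real 1 / 2) = (if s then 1 else 0)"
    using Z[of "weight i $ r + 3"] by (auto simp: delta1_def wr add_divide_distrib)
  have d2: "delta1 (real (weight i $ r) / 2 + 3 * real 2 / 2) = (if s then 0 else 1)"
    using Z[of "weight i $ r + 6"] by (auto simp: delta1_def wr add_divide_distrib)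
  have sci: "simple_current_invariant r (weight i) (weight j) = (if (if s then J_b r (weight i) else weight i) = weight j then 1 else 0)"
  proof -
    have "{1..2::nat} = {1, 2}" by auto
    then show ?thesis unfolding simple_current_invariant_def using JJ d1 d2 by (simp add: numeral_2_eq_2)
  qed
  have "(if s then J_b r (weight i) else weight i) = weight (sw i)"
  proof (cases s)
    case False
    then have "i \<noteq> 2 * (r + 1)" "i \<noteq> 4 * (r + 1)" using ik l by (auto simp: labels_def; presburger)+
    then show ?thesis using False by simp
  next
    case True
    show ?thesis
    proof (cases "k = 0")
      case k: True
      have l': "(True, 0, \<not> e) \<in> labels r" by (simp add: labels_def)
      have "sw i = index_of r (True, 0, \<not> e)" using ik True k by simp
      moreover have "J_b r (weight i) = weight_of r (True, 0, \<not> e)"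
        unfolding J_b_def wi using True k r3 by (intro eq_vecI) auto
      ultimately show ?thesis using True weight_index[OF l'] by (simp del: weight_of.simps index_of.simps)
    next
      case k: False
      then have "\<not> e" using l True by (auto simp: labels_def)
      then have "i \<noteq> 2 * (r + 1)" "i \<noteq> 4 * (r + 1)" using ik l True k by (auto simp: labels_def)
      moreover have "J_b r (weight i) = weight i"
        unfolding J_b_def wi using True k r3 \<open>\<not> e\<close> by (intro eq_vecI) (auto simp: label0_def label1_def)
      ultimately show ?thesis using True by simp
    qed
  qed
  moreover have "weight (sw i) = weight j \<longleftrightarrow> sw i = j"
    using weight_bij assms sw_I[OF assms(1)] unfolding bij_betw_def inj_on_def by blast
  ultimately show ?thesis unfolding sci by simp
qed

lemma equal_on_weight: "equal_on (P_plus r 3) M X \<longleftrightarrow> (\<forall>i\<in>I. \<forall>j\<in>I. M (weight i) (weight j) = X (weight i) (weight j))"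
proof -
  have "P_plus r 3 = weight ` I" using weight_bij by (simp add: bij_betw_def)
  then show ?thesis by (simp add: equal_on_def)
qed

lemma identity_weight:
  assumes "i \<in> I" "j \<in> I"
  shows "identity_invariant (weight i) (weight j) = (if i = j then 1 else 0)"
proof -
  have "weight i = weight j \<longleftrightarrow> i = j" using weight_bij assms unfolding bij_betw_def inj_on_def by blast
  then show ?thesis by (simp add: identity_invariant_def)
qed

lemma physical_invariant_imp:
  assumes "physical_invariant r 3 M"
  shows "equal_on (P_plus r 3) M identity_invariant \<or> equal_on (P_plus r 3) M (simple_current_invariant r)"
proof -
  define n where "n i j = nat \<lfloor>Re (M (weight i) (weight j))\<rfloor>" for i j
  have P: "weight i \<in> P_plus r 3" if "i \<in> I" for i using weight_bij that unfolding bij_betw_def by blast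
  have n: "M (weight i) (weight j) = of_nat (n i j)" if ij: "i \<in> I" "j \<in> I" for i j
  proof -
    have "M (weight i) (weight j) \<in> \<nat>" using assms P ij unfolding physical_invariant_def by blast
    then show ?thesis by (auto simp: n_def elim: Nats_cases)
  qed
  have S: "commute_on I (\<lambda>i j. of_nat (n i j)) (\<lambda>i j. S_matrix r 3 (weight i) (weight j))"
    and T: "commute_on I (\<lambda>i j. of_nat (n i j)) (\<lambda>i j. T_matrix r 3 (weight i) (weight j))"
    using assms commute_on_reindex[OF weight_bij, of M] commute_on_cong[of I "\<lambda>i j. M (weight i) (weight j)" "\<lambda>i j. of_nat (n i j)", OF n]
    unfolding physical_invariant_def by blast+
  have "complex_of_nat (n 1 1) = 1"
    using n[of 1 1] one_Od(1) assms unfolding physical_invariant_def vacuum_weight by simp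
  then have "n 1 1 = 1" by (simp only: of_nat_eq_1_iff)
  then have "invariant n"
    unfolding invariant_def using S commute_T_phase[OF T] by auto
  from classification[OF this] show ?thesis
    unfolding equal_on_weight by (auto simp: n identity_weight simple_current_weight)
qed

text \<open>Both candidates are matrices of involutions \<pi>, so commuting with X amounts to
  X(\<pi>i, j) = X(i, \<pi>j); this holds for S by \<open>S_sw\<close> and for T by
  \<open>T_exp_sw\<close>.\<close>

lemma imp_physical_invariant:
  assumes \<pi>: "\<pi> = id \<or> \<pi> = sw" and M: "\<And>i j. i \<in> I \<Longrightarrow> j \<in> I \<Longrightarrow> M (weight i) (weight j) = (if \<pi> i = j then 1 else 0)"
  shows "physical_invariant r 3 M"
proof -
  have f: "finite I" by simp
  have p1: "\<pi> i \<in> I" if "i \<in> I" for i using \<pi> sw_I[OF that] that by auto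
  have p2: "\<pi> (\<pi> i) = i" for i using \<pi> by auto
  have thp: "T_exp (r + 1) (\<pi> i) = T_exp (r + 1) i" for i using \<pi> T_exp_sw by auto
  have "commute_on I (\<lambda>i j. if \<pi> i = j then 1 else 0) (\<lambda>i j. S_matrix r 3 (weight i) (weight j))"
    using \<pi> S_sw by (intro commute_on_permutation f p1 p2) auto
  moreover have "commute_on I (\<lambda>i j. if \<pi> i = j then 1 else 0) (\<lambda>i j. T_matrix r 3 (weight i) (weight j))"
  proof (intro commute_on_permutation f p1 p2)
    fix i j assume ij: "i \<in> I" "j \<in> I"
    have "\<pi> i = j \<longleftrightarrow> i = \<pi> j" using p2 by metis
    then show "T_matrix r 3 (weight (\<pi> i)) (weight j) = T_matrix r 3 (weight i) (weight (\<pi> j))"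
      unfolding T_matrix_weight[OF p1[OF ij(1)] ij(2)] T_matrix_weight[OF ij(1) p1[OF ij(2)]] thp by (simp only:)
  qed
  ultimately have "commute_on (P_plus r 3) M (S_matrix r 3)" "commute_on (P_plus r 3) M (T_matrix r 3)"
    unfolding commute_on_reindex[OF weight_bij] using commute_on_cong[of I "\<lambda>i j. M (weight i) (weight j)", OF M] by simp_all
  moreover have "\<forall>\<mu>\<in>P_plus r 3. \<forall>\<nu>\<in>P_plus r 3. M \<mu> \<nu> \<in> \<nat>"
  proof -
    have "P_plus r 3 = weight ` I" using weight_bij by (simp add: bij_betw_def)
    then show ?thesis by (auto simp: M)
  qed
  moreover have "M (vacuum r 3) (vacuum r 3) = 1"
  proof -
    have "sw 1 = 1" by (intro transpose_apply_other) auto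
    then show ?thesis unfolding vacuum_weight using M[of 1 1] one_Od(1) \<pi> by auto
  qed
  ultimately show ?thesis unfolding physical_invariant_def by blast
qed

end

theorem theorem2p3:
  fixes r :: nat and M :: "nat vec \<Rightarrow> nat vec \<Rightarrow> complex"
  assumes "r \<ge> 3"
  shows "physical_invariant r 3 M \<longleftrightarrow>
           equal_on (P_plus r 3) M identity_invariant \<or>
           equal_on (P_plus r 3) M (simple_current_invariant r)"
proof
  assume "physical_invariant r 3 M"
  then show "equal_on (P_plus r 3) M identity_invariant \<or> equal_on (P_plus r 3) M (simple_current_invariant r)"
    by (rule physical_invariant_imp[OF assms])
next
  assume "equal_on (P_plus r 3) M identity_invariant \<or> equal_on (P_plus r 3) M (simple_current_invariant r)"
  then show "physical_invariant r 3 M"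
  proof
    assume "equal_on (P_plus r 3) M identity_invariant"
    then show ?thesis
      unfolding equal_on_weight[OF assms]
      by (intro imp_physical_invariant[OF assms, of id]) (auto simp: identity_weight[OF assms])
  next
    assume "equal_on (P_plus r 3) M (simple_current_invariant r)"
    then show ?thesis
      unfolding equal_on_weight[OF assms]
      by (intro imp_physical_invariant[OF assms, of "Transposition.transpose (2 * (r + 1)) (4 * (r + 1))"]) (auto simp: simple_current_weight[OF assms])
  qed
qed

end
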